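(* Let $(p^{(1)},p^{(2)})$ and $(q^{(1)},q^{(2)})$ be dichotomies and assume $\operatorname{supp}p^{(1)}\subsetneq\operatorname{supp}p^{(2)}$. The following conditions are equivalent. (i) For all $\alpha\in(0,\infty]$, $D_\alpha(p^{(1)}\|p^{(2)})\ge D_\alpha(q^{(1)}\|q^{(2)})$. (ii) For all $\varepsilon>0$ there are a stochastic matrix $T_\varepsilon$ and dichotomies $(q_\varepsilon^{(1)},q_\varepsilon^{(2)})$ and $(r_\varepsilon^{(1)},r_\varepsilon^{(2)})$ such that $$\|q^{(k)}-q_\varepsilon^{(k)}\|_1\le\varepsilon\quad\text{and}\quad T_\varepsilon(r_\varepsilon^{(k)}\otimes p^{(k)})=r_\varepsilon^{(k)}\otimes q_\varepsilon^{(k)},\qquad k=1,2.$$ One may choose $r_\varepsilon^{(k)}=\frac1{n+1}\bigoplus_{\ell=0}^n(q_\varepsilon^{(k)})^{\otimes\ell}\otimes(p^{(k)})^{\otimes(n-\ell)}$, $k=1,2$, for sufficiently large $n\in\mathbb N$. (iii) For all $\varepsilon>0$ there is a dichotomy $(q_\varepsilon^{(1)},q_\varepsilon^{(2)})$ such that $\|q^{(k)}-q_\varepsilon^{(k)}\|_1\le\varepsilon$ for $k=1,2$, and for $n\in\mathbb N$ sufficiently large there is a stochastic matrix $T_{\varepsilon,n}$ such that $$T_{\varepsilon,n}(p^{(k)})^{\otimes n}=(q_\varepsilon^{(k)})^{\otimes n},\qquad k=1,2.$$ Moreover, in statements (ii) and (iii) one may assume that $q_\varepsilon^{(2)}=q^{(2)}$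 for all $\varepsilon>0$.
   Context: A dichotomy is a pair $(p^{(1)},p^{(2)})$ of (finite) probability vectors of the same length with $\operatorname{supp}p^{(1)}\subseteq\operatorname{supp}p^{(2)}$, where $\operatorname{supp}x$ is the set of indices of nonzero entries. $\mathbb N=\{1,2,\ldots\}$; $\otimes$ is the Kronecker product of vectors, $p^{\otimes0}=(1)$; $\oplus$ is concatenation; vectors of different lengths are compared in $\|\cdot\|_1$ after padding with zeros. A stochastic matrix has non-negative entries and columns summing to $1$. For a dichotomy $(p,q)$ with $I=\operatorname{supp}p$, the Rényi divergences are $D_\alpha(p\|q)=\frac1{\alpha-1}\log\sum_{i\in I}p_i^\alpha q_i^{1-\alpha}$ for $\alpha\in(0,1)\cup(1,\infty)$, $D_1(p\|q)=\sum_{i\in I}p_i\log\frac{p_i}{q_i}$, and $D_\infty(p\|q)=\max_{i\in I}\log\frac{p_i}{q_i}$. *)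

theory Defs
  imports
    Complex_Main
    "HOL-Library.Extended_Real"
    "Jordan_Normal_Form.Matrix"
begin

definition prob_vec :: "real vec \<Rightarrow> bool" where
  "prob_vec x \<longleftrightarrow> (\<forall>i<dim_vec x. 0 \<le> x $ i) \<and> (\<Sum>i<dim_vec x. x $ i) = 1"

definition supp_vec :: "real vec \<Rightarrow> nat set" where
  "supp_vec x = {i. i < dim_vec x \<and> x $ i \<noteq> 0}"

definition dichotomy :: "real vec \<Rightarrow> real vec \<Rightarrow> bool" where
  "dichotomy x y \<longleftrightarrow>
     prob_vec x \<and> prob_vec y \<and> dim_vec x = dim_vec y \<and> supp_vec x \<subseteq> supp_vec y"

definition stochastic_mat :: "real mat \<Rightarrow> bool" where
  "stochastic_mat T \<longleftrightarrow>
     (\<forall>i<dim_row T. \<forall>j<dim_col T. 0 \<le> T $$ (i, j)) \<and>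
     (\<forall>j<dim_col T. (\<Sum>i<dim_row T. T $$ (i, j)) = 1)"

(* The product T *\<^sub>v x does not check that dim_col T = dim_vec x, hence the explicit carrier. *)
definition maps_vec :: "real mat \<Rightarrow> real vec \<Rightarrow> real vec \<Rightarrow> bool" where
  "maps_vec T x y \<longleftrightarrow> T \<in> carrier_mat (dim_vec y) (dim_vec x) \<and> T *\<^sub>v x = y"

definition kron_vec :: "real vec \<Rightarrow> real vec \<Rightarrow> real vec" (infixl \<open>\<otimes>\<^sub>v\<close> 70) where
  "x \<otimes>\<^sub>v y = vec (dim_vec x * dim_vec y) (\<lambda>i. x $ (i div dim_vec y) * y $ (i mod dim_vec y))"

primrec kron_pow :: "real vec \<Rightarrow> nat \<Rightarrow> real vec" where
  "kron_pow x 0 = vec 1 (\<lambda>_. 1)"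
| "kron_pow x (Suc n) = kron_pow x n \<otimes>\<^sub>v x"

(* direct_sum_vec f n is the concatenation of f 0, ..., f n, with f n included. *)
primrec direct_sum_vec :: "(nat \<Rightarrow> real vec) \<Rightarrow> nat \<Rightarrow> real vec" where
  "direct_sum_vec f 0 = f 0"
| "direct_sum_vec f (Suc n) = direct_sum_vec f n @\<^sub>v f (Suc n)"

definition catalyst :: "real vec \<Rightarrow> real vec \<Rightarrow> nat \<Rightarrow> real vec" where
  "catalyst x y n =
     (1 / (real n + 1)) \<cdot>\<^sub>v direct_sum_vec (\<lambda>l. kron_pow y l \<otimes>\<^sub>v kron_pow x (n - l)) n"

definition pad_vec :: "real vec \<Rightarrow> nat \<Rightarrow> real" where
  "pad_vec x i = (if i < dim_vec x then x $ i else 0)"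

definition l1_dist :: "real vec \<Rightarrow> real vec \<Rightarrow> real" where
  "l1_dist x y = (\<Sum>i<max (dim_vec x) (dim_vec y). \<bar>pad_vec x i - pad_vec y i\<bar>)"

(* Meant for dichotomies (x, y) and 0 < \<alpha> \<le> \<infinity>: then supp_vec x is nonempty and contained in
   supp_vec y, so all three expressions are finite and no default value of ln or division is used. *)
definition renyi_div :: "ereal \<Rightarrow> real vec \<Rightarrow> real vec \<Rightarrow> real" where
  "renyi_div \<alpha> x y =
     (if \<alpha> = \<infinity> then Max ((\<lambda>i. ln (x $ i / y $ i)) ` supp_vec x)
      else if \<alpha> = 1 then (\<Sum>i\<in>supp_vec x. x $ i * ln (x $ i / y $ i))
      else (let a = real_of_ereal \<alpha>
            in 1 / (a - 1) * ln (\<Sum>i\<in>supp_vec x. (x $ i) powr a * (y $ i) powr (1 - a))))"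

end

theory Submission
  imports Defs "HOL-Analysis.Function_Topology" "HOL-Analysis.Convex"
begin

text \<open>
  Write \<open>S\<^sub>\<alpha>(x,y) = \<Sum>i. x\<^sub>i powr \<alpha> * y\<^sub>i powr (1-\<alpha>)\<close>. The divergence conditions say that
  \<open>S\<^sub>\<alpha>(p) \<le> S\<^sub>\<alpha>(q)\<close> for \<open>0 < \<alpha> < 1\<close> and \<open>S\<^sub>\<alpha>(p) \<ge> S\<^sub>\<alpha>(q)\<close> for \<open>\<alpha> > 1\<close>; the cases \<open>\<alpha> = 1\<close> and
  \<open>\<alpha> = \<infinity>\<close> follow by differentiating at 1 and by comparing growth rates. As \<open>S\<^sub>\<alpha>\<close> is multiplicative,
  monotone under stochastic maps (Hoelder) and semicontinuous, these conditions are necessary.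

  For the converse, replace \<open>q\<^sup>1\<close> by \<open>(1-\<delta>) q\<^sup>1 + \<delta> q\<^sup>2\<close>. Since the support of \<open>p\<^sup>1\<close> is strictly smaller
  than that of \<open>p\<^sup>2\<close>, all inequalities become strict, including \<open>\<alpha> = 0\<close>, the derivative at 1 and the
  largest likelihood ratio. By Blackwell's theorem a stochastic map exists iff the hockey-stick
  divergences \<open>E\<^sub>t(x,y) = \<Sum>i. max 0 (x\<^sub>i - t y\<^sub>i)\<close>, \<open>t \<ge> 0\<close>, are ordered. For tensor powers and \<open>t = s ^ n\<close>,
  Chernoff upper bounds and matching Cramer lower bounds (exponential tilting at the minimiser of
  \<open>s powr (1-\<alpha>) * S\<^sub>\<alpha>\<close>) order them for large \<open>n\<close>, locally uniformly in \<open>s\<close>, and compactness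
  makes this uniform. Finally, \<open>E\<^sub>t\<close> is additive on direct sums, so for the catalyst the
  difference of the divergences telescopes to that of the \<open>(n+1)\<close>-st powers.
\<close>

section \<open>Sums over pairs of vectors\<close>

text \<open>With \<open>t = s ^ n\<close>, \<open>excess\<close> of n-th powers is exponentially
  close to 1 when \<open>ln s\<close> is below the relative entropy \<open>renyi_deriv 1\<close>,
  and exponentially small when it is above. Orders \<alpha> > 1 only see the second regime; in the
  first one the complement \<open>overlap\<close> is compared instead, through orders in [0,1]. At
  the relative entropy itself both optimal rates are 1 and decide nothing. The strict gap between
  the relative entropies of p and the modified q removes this obstacle: every s is strictly below
  the one of p or strictly above the one of q.

  Negative orders never enter: \<open>excess t\<close> is at least 1 - t for every dichotomy, with
  equality below the smallest likelihood ratio. Mixing makes this ratio positive for q on the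
  support of \<open>q2\<close>. Order 0 does enter, because the minimum over [0,1] may be attained
  there; the Renyi sum is then the mass of the second vector on the support of the first.

  Since mixing moves only the first vector, \<open>q2\<close> is never perturbed.\<close>

definition pair_sum :: "(real \<Rightarrow> real \<Rightarrow> real) \<Rightarrow> real vec \<Rightarrow> real vec \<Rightarrow> real" where
  "pair_sum f x y = (\<Sum>i<dim_vec x. f (x $ i) (y $ i))"

text \<open>Since \<open>0 powr a = 0\<close> for every exponent, indices with a zero first entry
  drop out even at \<alpha> = 0, where the sum becomes the mass of y on the support of x. For
  \<alpha> > 1 a zero of y would call for an infinite term; in a dichotomy the first entry is then 0
  as well.\<close>

definition renyi_sum :: "real \<Rightarrow> real vec \<Rightarrow> real vec \<Rightarrow> real" where
  "renyi_sum \<alpha> = pair_sum (\<lambda>u v. u powr \<alpha> * v powr (1 - \<alpha>))"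

definition excess :: "real \<Rightarrow> real vec \<Rightarrow> real vec \<Rightarrow> real" where
  "excess t = pair_sum (\<lambda>u v. max 0 (u - t * v))"

text \<open>Complement of \<open>excess\<close> on dichotomies: the two add up to the total mass 1.
  It stays informative where \<open>excess\<close> is close to 1.\<close>

definition overlap :: "real \<Rightarrow> real vec \<Rightarrow> real vec \<Rightarrow> real" where
  "overlap t = pair_sum (\<lambda>u v. min u (t * v))"

lemma sum_div_mod:
  fixes g :: "nat \<Rightarrow> nat \<Rightarrow> 'a::comm_monoid_add"
  shows "(\<Sum>i<a * b. g (i div b) (i mod b)) = (\<Sum>i<a. \<Sum>j<b. g i j)"
proof -
  have "(\<Sum>i<a * b. g (i div b) (i mod b)) = (\<Sum>m<a. \<Sum>i = m * b..<m * b + b. g (i div b) (i mod b))"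
    by (rule sum.nat_group [symmetric])
  also have "\<dots> = (\<Sum>m<a. \<Sum>j<b. g m j)"
  proof (rule sum.cong [OF refl])
    fix m
    have "(\<Sum>i = m * b..<m * b + b. g (i div b) (i mod b)) = (\<Sum>i = 0..<b. g ((i + m * b) div b) ((i + m * b) mod b))"
      using sum.shift_bounds_nat_ivl [of "\<lambda>i. g (i div b) (i mod b)" 0 "m * b" b] by (simp add: add.commute)
    also have "\<dots> = (\<Sum>j<b. g m j)"
      by (rule sum.cong) auto
    finally show "(\<Sum>i = m * b..<m * b + b. g (i div b) (i mod b)) = (\<Sum>j<b. g m j)" .
  qed
  finally show ?thesis .
qed

lemma dim_kron_vec [simp]: "dim_vec (x \<otimes>\<^sub>v y) = dim_vec x * dim_vec y"
  by (simp add: kron_vec_def)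

lemma dim_kron_pow [simp]: "dim_vec (kron_pow x n) = dim_vec x ^ n"
  by (induction n) auto

lemma mod_less_of_mult: "i < a * b \<Longrightarrow> i mod b < (b::nat)"
  by (cases "b = 0") auto

lemma div_less_of_mult: "i < a * b \<Longrightarrow> i div b < (a::nat)"
  by (simp add: less_mult_imp_div_less)

lemma pair_sum_cong:
  assumes "\<And>i. i < dim_vec x \<Longrightarrow> f (x $ i) (y $ i) = g (x $ i) (y $ i)"
  shows "pair_sum f x y = pair_sum g x y"
  using assms by (simp add: pair_sum_def)

lemma pair_sum_mono:
  assumes "\<And>i. i < dim_vec x \<Longrightarrow> f (x $ i) (y $ i) \<le> g (x $ i) (y $ i)"
  shows "pair_sum f x y \<le> pair_sum g x y"
  using assms unfolding pair_sum_def by (intro sum_mono) auto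

lemma pair_sum_swap:
  "pair_sum (\<lambda>u v. pair_sum (f u v) y1 y2) x1 x2 =
   pair_sum (\<lambda>u' v'. pair_sum (\<lambda>u v. f u v u' v') x1 x2) y1 y2"
  unfolding pair_sum_def by (rule sum.swap)

lemma pair_sum_cmult: "pair_sum (\<lambda>u v. c * f u v) x y = c * pair_sum f x y"
  by (simp add: pair_sum_def sum_distrib_left)

lemma pair_sum_kron:
  assumes "dim_vec x1 = dim_vec x2" "dim_vec y1 = dim_vec y2"
  shows "pair_sum f (x1 \<otimes>\<^sub>v y1) (x2 \<otimes>\<^sub>v y2) =
         pair_sum (\<lambda>u v. pair_sum (\<lambda>u' v'. f (u * u') (v * v')) y1 y2) x1 x2"
proof -
  have "pair_sum f (x1 \<otimes>\<^sub>v y1) (x2 \<otimes>\<^sub>v y2) =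
      (\<Sum>i<dim_vec x1 * dim_vec y1. f (x1 $ (i div dim_vec y1) * y1 $ (i mod dim_vec y1))
         (x2 $ (i div dim_vec y1) * y2 $ (i mod dim_vec y1)))"
    unfolding pair_sum_def using assms by (intro sum.cong) (auto simp: kron_vec_def)
  also have "\<dots> = (\<Sum>i<dim_vec x1. \<Sum>j<dim_vec y1. f (x1 $ i * y1 $ j) (x2 $ i * y2 $ j))"
    by (rule sum_div_mod [of "\<lambda>k l. f (x1 $ k * y1 $ l) (x2 $ k * y2 $ l)"])
  finally show ?thesis by (simp add: pair_sum_def)
qed

lemma pair_sum_unit: "pair_sum f (kron_pow x 0) (kron_pow y 0) = f 1 1"
  by (simp add: pair_sum_def)

lemma pair_sum_append:
  assumes "dim_vec x1 = dim_vec x2" "dim_vec y1 = dim_vec y2"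
  shows "pair_sum f (x1 @\<^sub>v y1) (x2 @\<^sub>v y2) = pair_sum f x1 x2 + pair_sum f y1 y2"
proof -
  let ?a = "dim_vec x1" and ?b = "dim_vec y1"
  let ?h = "\<lambda>i. f ((x1 @\<^sub>v y1) $ i) ((x2 @\<^sub>v y2) $ i)"
  have "pair_sum f (x1 @\<^sub>v y1) (x2 @\<^sub>v y2) = sum ?h {..<?a + ?b}"
    by (simp add: pair_sum_def)
  also have "\<dots> = sum ?h {..<?a} + sum ?h {?a..<?a + ?b}"
    using sum.atLeastLessThan_concat[of 0 ?a "?a + ?b" ?h] by (simp add: atLeast0LessThan)
  also have "sum ?h {..<?a} = pair_sum f x1 x2"
    unfolding pair_sum_def using assms by (intro sum.cong) auto
  also have "sum ?h {?a..<?a + ?b} = sum (\<lambda>i. ?h (i + ?a)) {0..<?b}"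
    using sum.shift_bounds_nat_ivl [of ?h 0 ?a ?b] by (simp add: add.commute)
  also have "\<dots> = pair_sum f y1 y2"
    unfolding pair_sum_def using assms by (intro sum.cong) auto
  finally show ?thesis .
qed

lemma dim_direct_sum_cong:
  assumes "\<And>l. l \<le> n \<Longrightarrow> dim_vec (g l) = dim_vec (h l)"
  shows "dim_vec (direct_sum_vec g n) = dim_vec (direct_sum_vec h n)"
  using assms by (induction n) auto

lemma pair_sum_direct_sum:
  assumes "\<And>l. l \<le> n \<Longrightarrow> dim_vec (g l) = dim_vec (h l)"
  shows "pair_sum f (direct_sum_vec g n) (direct_sum_vec h n) = (\<Sum>l\<le>n. pair_sum f (g l) (h l))"
  using assms
proof (induction n)
  case (Suc n)
  moreover have "dim_vec (direct_sum_vec g n) = dim_vec (direct_sum_vec h n)"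
    using Suc by (intro dim_direct_sum_cong) auto
  ultimately show ?case by (simp add: pair_sum_append)
qed simp

lemma pair_sum_smult:
  assumes "dim_vec x = dim_vec y"
  shows "pair_sum f (c \<cdot>\<^sub>v x) (c \<cdot>\<^sub>v y) = pair_sum (\<lambda>u v. f (c * u) (c * v)) x y"
  using assms by (simp add: pair_sum_def)

section \<open>Dichotomies under products, powers and the catalyst construction\<close>

lemma dichotomy_iff:
  "dichotomy x y \<longleftrightarrow> dim_vec x = dim_vec y \<and>
     (\<forall>i<dim_vec x. 0 \<le> x $ i \<and> 0 \<le> y $ i \<and> (y $ i = 0 \<longrightarrow> x $ i = 0)) \<and>
     pair_sum (\<lambda>u v. u) x y = 1 \<and> pair_sum (\<lambda>u v. v) x y = 1"
  by (auto simp: dichotomy_def prob_vec_def supp_vec_def pair_sum_def)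

lemma dichotomyD:
  assumes "dichotomy x y"
  shows "dim_vec x = dim_vec y"
    and "i < dim_vec x \<Longrightarrow> 0 \<le> x $ i"
    and "i < dim_vec x \<Longrightarrow> 0 \<le> y $ i"
    and "i < dim_vec x \<Longrightarrow> y $ i = 0 \<Longrightarrow> x $ i = 0"
    and "(\<Sum>i<dim_vec x. x $ i) = 1"
    and "(\<Sum>i<dim_vec x. y $ i) = 1"
  using assms by (auto simp: dichotomy_iff pair_sum_def)

lemma dichotomy_kron:
  assumes "dichotomy x1 x2" "dichotomy y1 y2"
  shows "dichotomy (x1 \<otimes>\<^sub>v y1) (x2 \<otimes>\<^sub>v y2)"
proof -
  note [simp] = dichotomyD(1)[OF assms(1), symmetric] dichotomyD(1)[OF assms(2), symmetric]
  have "pair_sum (\<lambda>u v. u) (x1 \<otimes>\<^sub>v y1) (x2 \<otimes>\<^sub>v y2) = 1"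
       "pair_sum (\<lambda>u v. v) (x1 \<otimes>\<^sub>v y1) (x2 \<otimes>\<^sub>v y2) = 1"
    using assms by (simp_all add: pair_sum_kron pair_sum_cmult dichotomy_iff)
  moreover have "0 \<le> (x1 \<otimes>\<^sub>v y1) $ i \<and> 0 \<le> (x2 \<otimes>\<^sub>v y2) $ i \<and> ((x2 \<otimes>\<^sub>v y2) $ i = 0 \<longrightarrow> (x1 \<otimes>\<^sub>v y1) $ i = 0)"
    if "i < dim_vec x1 * dim_vec y1" for i
    using dichotomyD(2-4)[OF assms(1) div_less_of_mult[OF that]]
      dichotomyD(2-4)[OF assms(2) mod_less_of_mult[OF that]] that
    by (auto simp: kron_vec_def)
  ultimately show ?thesis
    by (auto simp: dichotomy_iff)
qed

lemma dichotomy_kron_pow: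
  assumes "dichotomy x y"
  shows "dichotomy (kron_pow x n) (kron_pow y n)"
proof (induction n)
  case 0
  show ?case by (simp add: dichotomy_iff pair_sum_def)
qed (simp add: dichotomy_kron assms)

lemma dichotomy_direct_sum_entries:
  assumes "\<And>l. l \<le> n \<Longrightarrow> dichotomy (g l) (h l)" "i < dim_vec (direct_sum_vec g n)"
  shows "0 \<le> direct_sum_vec g n $ i \<and> 0 \<le> direct_sum_vec h n $ i \<and>
    (direct_sum_vec h n $ i = 0 \<longrightarrow> direct_sum_vec g n $ i = 0)"
  using assms
proof (induction n arbitrary: i)
  case (Suc n)
  have "dim_vec (direct_sum_vec g n) = dim_vec (direct_sum_vec h n)"
    by (rule dim_direct_sum_cong, rule dichotomyD(1), rule Suc.prems(1)) simp
  moreover have "dim_vec (g (Suc n)) = dim_vec (h (Suc n))"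
    using Suc.prems(1) dichotomyD(1) by blast
  ultimately show ?case
    using Suc.IH[of i] Suc.prems dichotomyD(2-4)[OF Suc.prems(1)[of "Suc n"], of "i - dim_vec (direct_sum_vec g n)"]
    by (auto simp: index_append_vec)
qed (auto dest: dichotomyD)

lemma dichotomy_catalyst:
  assumes "dichotomy p1 p2" "dichotomy q1 q2"
  shows "dichotomy (catalyst p1 q1 n) (catalyst p2 q2 n)"
proof -
  let ?g = "\<lambda>p q l. kron_pow q l \<otimes>\<^sub>v kron_pow p (n - l)"
  have d: "dichotomy (?g p1 q1 l) (?g p2 q2 l)" for l
    by (intro dichotomy_kron dichotomy_kron_pow assms)
  have dims: "dim_vec (direct_sum_vec (?g p1 q1) n) = dim_vec (direct_sum_vec (?g p2 q2) n)"
    by (rule dim_direct_sum_cong, rule dichotomyD(1), rule d)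
  have "pair_sum (\<lambda>u v. u) (direct_sum_vec (?g p1 q1) n) (direct_sum_vec (?g p2 q2) n) = real n + 1"
    "pair_sum (\<lambda>u v. v) (direct_sum_vec (?g p1 q1) n) (direct_sum_vec (?g p2 q2) n) = real n + 1"
    using d by (simp_all add: pair_sum_direct_sum dichotomyD(1)[OF d] dichotomy_iff)
  moreover have "1 / (real n + 1) * (real n + 1) = 1" by simp
  ultimately show ?thesis
    using dichotomy_direct_sum_entries[OF d] dims
    unfolding dichotomy_iff catalyst_def
    by (auto simp: pair_sum_smult pair_sum_cmult simp del: times_divide_eq_left)
qed

section \<open>Hockey-stick divergences of the catalyst\<close>

lemma excess_kron_assoc:
  assumes "dichotomy x1 x2" "dichotomy y1 y2" "dichotomy z1 z2"
  shows "excess t (x1 \<otimes>\<^sub>v y1 \<otimes>\<^sub>v z1) (x2 \<otimes>\<^sub>v y2 \<otimes>\<^sub>v z2) = excess t (x1 \<otimes>\<^sub>v (y1 \<otimes>\<^sub>v z1)) (x2 \<otimes>\<^sub>v (y2 \<otimes>\<^sub>v z2))"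
  using assms[THEN dichotomyD(1)] by (simp add: excess_def pair_sum_kron mult.assoc)

text \<open>Kronecker products commute only up to a permutation of the entries: the vectors differ,
  but a sum over all pairs of entries does not notice.\<close>

lemma excess_kron_right_swap:
  assumes "dichotomy x1 x2" "dichotomy y1 y2" "dichotomy z1 z2"
  shows "excess t (x1 \<otimes>\<^sub>v y1 \<otimes>\<^sub>v z1) (x2 \<otimes>\<^sub>v y2 \<otimes>\<^sub>v z2) = excess t (x1 \<otimes>\<^sub>v z1 \<otimes>\<^sub>v y1) (x2 \<otimes>\<^sub>v z2 \<otimes>\<^sub>v y2)"
  using assms[THEN dichotomyD(1)]
  by (simp add: excess_def pair_sum_kron) (subst (2) pair_sum_swap, simp add: mult_ac)

text \<open>\<open>excess\<close> is additive over direct sums and homogeneous of degree 1 in the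
  pair of vectors, so the catalyst decouples into its summands and its normalising weight comes out
  as a factor.\<close>

lemma excess_catalyst_kron:
  assumes "dichotomy p1 p2" "dichotomy q1 q2" "dichotomy x1 x2"
  shows "excess t (catalyst p1 q1 n \<otimes>\<^sub>v x1) (catalyst p2 q2 n \<otimes>\<^sub>v x2) =
    (\<Sum>l\<le>n. excess t (kron_pow q1 l \<otimes>\<^sub>v kron_pow p1 (n - l) \<otimes>\<^sub>v x1) (kron_pow q2 l \<otimes>\<^sub>v kron_pow p2 (n - l) \<otimes>\<^sub>v x2))
      / (real n + 1)"
proof -
  let ?c = "1 / (real n + 1)"
  let ?g = "\<lambda>p q l. kron_pow q l \<otimes>\<^sub>v kron_pow p (n - l)"
  have d: "dim_vec (?g p1 q1 l) = dim_vec (?g p2 q2 l)" for l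
    using assms[THEN dichotomyD(1)] by simp
  have dims: "dim_vec (direct_sum_vec (?g p1 q1) n) = dim_vec (direct_sum_vec (?g p2 q2) n)"
    using d by (intro dim_direct_sum_cong) auto
  have hom: "max 0 (?c * u - t * (?c * v)) = ?c * max 0 (u - t * v)" for u v
  proof -
    have "?c * u - t * (?c * v) = ?c * (u - t * v)" by (simp only: right_diff_distrib mult.left_commute)
    then show ?thesis using max_mult_distrib_left[of ?c 0 "u - t * v"] by simp
  qed
  have "excess t (catalyst p1 q1 n \<otimes>\<^sub>v x1) (catalyst p2 q2 n \<otimes>\<^sub>v x2) =
    ?c * (\<Sum>l\<le>n. excess t (?g p1 q1 l \<otimes>\<^sub>v x1) (?g p2 q2 l \<otimes>\<^sub>v x2))"
    using d dims assms[THEN dichotomyD(1)]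
    by (simp add: excess_def catalyst_def pair_sum_kron pair_sum_smult pair_sum_direct_sum mult.assoc
        hom[unfolded mult.assoc] pair_sum_cmult del: times_divide_eq_left)
  then show ?thesis by simp
qed

text \<open>The summand of index l multiplied by q agrees, up to the order of factors, with the
  summand of index l + 1 multiplied by p. Only the pure powers of exponent n + 1 at the two ends
  survive.\<close>

lemma excess_catalyst:
  assumes p: "dichotomy p1 p2" and q: "dichotomy q1 q2"
  shows "excess t (catalyst p1 q1 n \<otimes>\<^sub>v p1) (catalyst p2 q2 n \<otimes>\<^sub>v p2) -
         excess t (catalyst p1 q1 n \<otimes>\<^sub>v q1) (catalyst p2 q2 n \<otimes>\<^sub>v q2) =
    (excess t (kron_pow p1 (Suc n)) (kron_pow p2 (Suc n)) - excess t (kron_pow q1 (Suc n)) (kron_pow q2 (Suc n)))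
      / (real n + 1)"
proof -
  define H where "H l k = excess t (kron_pow q1 l \<otimes>\<^sub>v kron_pow p1 k) (kron_pow q2 l \<otimes>\<^sub>v kron_pow p2 k)" for l k
  note dp = dichotomy_kron_pow[OF p] and dq = dichotomy_kron_pow[OF q]
  have 1: "excess t (kron_pow q1 l \<otimes>\<^sub>v kron_pow p1 k \<otimes>\<^sub>v p1) (kron_pow q2 l \<otimes>\<^sub>v kron_pow p2 k \<otimes>\<^sub>v p2) = H l (Suc k)" for l k
    by (simp add: H_def excess_kron_assoc[OF dq dp p])
  have 2: "excess t (kron_pow q1 l \<otimes>\<^sub>v kron_pow p1 k \<otimes>\<^sub>v q1) (kron_pow q2 l \<otimes>\<^sub>v kron_pow p2 k \<otimes>\<^sub>v q2) = H (Suc l) k" for l k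
    by (simp add: H_def excess_kron_right_swap[OF dq dp q])
  have "(\<Sum>l\<le>n. H l (Suc (n - l))) - (\<Sum>l\<le>n. H (Suc l) (n - l)) =
      (\<Sum>l\<le>n. H l (Suc n - l) - H (Suc l) (Suc n - Suc l))"
    by (simp add: Suc_diff_le sum_subtractf)
  also have "\<dots> = H 0 (Suc n) - H (Suc n) 0"
    using sum_telescope[of "\<lambda>l. H l (Suc n - l)" n] by simp
  also have "H 0 (Suc n) = excess t (kron_pow p1 (Suc n)) (kron_pow p2 (Suc n))"
    unfolding H_def excess_def
    by (subst pair_sum_kron) (simp_all add: p[THEN dichotomyD(1)] pair_sum_unit del: kron_pow.simps(2) dim_kron_vec, simp add: pair_sum_def)
  also have "H (Suc n) 0 = excess t (kron_pow q1 (Suc n)) (kron_pow q2 (Suc n))"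
    unfolding H_def excess_def
    by (subst pair_sum_kron) (simp_all add: q[THEN dichotomyD(1)] pair_sum_unit del: kron_pow.simps(2) dim_kron_vec, simp add: pair_sum_def)
  finally show ?thesis
    by (simp only: excess_catalyst_kron[OF p q p] excess_catalyst_kron[OF p q q] 1 2 flip: diff_divide_distrib)
qed

section \<open>Blackwell's theorem for dichotomies\<close>

text \<open>The last conjunct, that the interpolant stays below \<open>g\<close> to the right of \<open>X\<close>, keeps the weights
  non-negative when points are added from left to right.\<close>

lemma convex_interpolation:
  fixes g :: "real \<Rightarrow> real"
  assumes "finite X" and sub: "\<And>x. \<exists>m. \<forall>y. g x + m * (y - x) \<le> g y"
  shows "\<exists>c d w. (\<forall>k. 0 \<le> w k) \<and>
    (\<forall>x\<in>X. g x = c + d * x + (\<Sum>k\<in>X. w k * max 0 (x - k))) \<and>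
    (\<forall>x. (\<forall>k\<in>X. k < x) \<longrightarrow> c + d * x + (\<Sum>k\<in>X. w k * max 0 (x - k)) \<le> g x)"
  using assms(1)
proof (induction X rule: finite_linorder_max_induct)
  case empty
  obtain m where "g 0 + m * (y - 0) \<le> g y" for y using sub[of 0] by blast
  then show ?case by (intro exI[of _ "g 0"] exI[of _ m] exI[of _ "\<lambda>_. 0"]) auto
next
  case (insert y X)
  obtain my where my: "g y + my * (x - y) \<le> g x" for x using sub[of y] by blast
  show ?case
  proof (cases "X = {}")
    case True
    then show ?thesis
      using my by (intro exI[of _ "g y - my * y"] exI[of _ my] exI[of _ "\<lambda>_. 0"]) (auto simp: algebra_simps)
  next
    case False
    define z where "z = Max X"
    have z: "z \<in> X" "\<And>k. k \<in> X \<Longrightarrow> k \<le> z" "z < y"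
      using insert False by (auto simp: z_def)
    obtain c d w where w: "\<And>k. 0 \<le> w k"
      and eq: "\<And>x. x \<in> X \<Longrightarrow> g x = c + d * x + (\<Sum>k\<in>X. w k * max 0 (x - k))"
      and le: "\<And>x. (\<forall>k\<in>X. k < x) \<Longrightarrow> c + d * x + (\<Sum>k\<in>X. w k * max 0 (x - k)) \<le> g x"
      using insert.IH by blast
    define G where "G x = c + d * x + (\<Sum>k\<in>X. w k * max 0 (x - k))" for x
    \<comment> \<open>The slope increase, placed at the last node z, that lifts the interpolant onto
      g at y. The third conjunct of the induction hypothesis makes it non-negative; y itself enters
      with weight 0.\<close>
    define \<delta> where "\<delta> = (g y - G y) / (y - z)"
    have \<delta>: "0 \<le> \<delta>" using le[of y] insert.hyps(2) z(3) by (simp add: \<delta>_def G_def)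
    have \<delta>y: "\<delta> * (y - z) = g y - G y" using z(3) by (simp add: \<delta>_def)
    define w' where "w' = w(z := w z + \<delta>, y := 0)"
    have w': "0 \<le> w' k" for k using w \<delta> by (simp add: w'_def)
    have yX: "y \<notin> X" using insert.hyps by auto
    have sum': "(\<Sum>k\<in>insert y X. w' k * max 0 (x - k)) = (\<Sum>k\<in>X. w k * max 0 (x - k)) + \<delta> * max 0 (x - z)" for x
    proof -
      have "(\<Sum>k\<in>insert y X. w' k * max 0 (x - k)) = (\<Sum>k\<in>X. w' k * max 0 (x - k))"
        using insert.hyps(1) yX by (simp add: w'_def)
      also have "\<dots> = (\<Sum>k\<in>X. w k * max 0 (x - k) + (if k = z then \<delta> * max 0 (x - z) else 0))"
        using yX z(3) by (intro sum.cong refl) (auto simp: w'_def algebra_simps)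
      finally show ?thesis using insert.hyps(1) z(1) by (simp add: sum.distrib)
    qed
    define B where "B = d + (\<Sum>k\<in>X. w k)"
    define A where "A = c - (\<Sum>k\<in>X. w k * k)"
    have lin: "G x = A + B * x" if "z \<le> x" for x
    proof -
      have "(\<Sum>k\<in>X. w k * max 0 (x - k)) = (\<Sum>k\<in>X. w k * (x - k))"
        using z(2) that by (intro sum.cong refl) fastforce
      then show ?thesis
        by (simp add: G_def A_def B_def algebra_simps sum_subtractf sum_distrib_left)
    qed
    have "g x = G x + \<delta> * max 0 (x - z)" if "x \<in> insert y X" for x
      using that
    proof
      assume "x = y" then show ?thesis using \<delta>y z(3) by simp
    next
      assume "x \<in> X" then show ?thesis using eq[of x] z(2)[of x] by (simp add: G_def)
    qed
    moreover have "G x + \<delta> * max 0 (x - z) \<le> g x" if "y < x" for x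
    proof -
      have gz: "g z = A + B * z" using eq[OF z(1)] lin[of z] by (simp add: G_def)
      have gy: "g y = A + B * y + \<delta> * (y - z)" using \<delta>y lin[of y] z(3) by simp
      \<comment> \<open>B + \<delta> is the slope of the chord of g from z to y, and a subgradient
        at the right endpoint is at least that slope.\<close>
      have "my * (y - z) \<ge> (B + \<delta>) * (y - z)"
        using my[of z] gz gy by (simp add: algebra_simps)
      then have "B + \<delta> \<le> my" using z(3) by simp
      then have "(B + \<delta>) * (x - y) \<le> my * (x - y)" using that by (intro mult_right_mono) auto
      then show ?thesis using my[of x] gy lin[of x] that z(3) by (simp add: algebra_simps)
    qed
    ultimately show ?thesis
      using w' by (intro exI[of _ c] exI[of _ d] exI[of _ w']) (auto simp only: sum' G_def add.assoc ball_simps simp_thms)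
  qed
qed

text \<open>Here f is the perspective of the convex function g. On the finitely many ratios that
  occur, g is affine plus a non-negative combination of hinges; the perspective of a hinge at k is
  the summand of \<open>excess k\<close>, and the affine part sums to the same constant for both
  normalised pairs. The knots are ratios, hence non-negative.\<close>

lemma pair_sum_sublinear:
  fixes g :: "real \<Rightarrow> real"
  assumes x: "dichotomy x1 x2" and y: "dichotomy y1 y2"
    and ex: "\<And>t. 0 \<le> t \<Longrightarrow> excess t y1 y2 \<le> excess t x1 x2"
    and sub: "\<And>x. \<exists>m. \<forall>y. g x + m * (y - x) \<le> g y"
    and f: "\<And>u v. 0 < v \<Longrightarrow> f u v = v * g (u / v)" and f0: "f 0 0 = 0"
  shows "pair_sum f y1 y2 \<le> pair_sum f x1 x2"
proof -
  \<comment> \<open>A pair of zero entries contributes the ratio 0 through division by zero, which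
    is a harmless extra knot.\<close>
  define X where "X = (\<lambda>i. x1 $ i / x2 $ i) ` {..<dim_vec x1} \<union> (\<lambda>i. y1 $ i / y2 $ i) ` {..<dim_vec y1}"
  have fin: "finite X" by (simp add: X_def)
  have X0: "0 \<le> k" if "k \<in> X" for k
    using that dichotomyD(2,3)[OF x] dichotomyD(2,3)[OF y] by (auto simp: X_def)
  obtain c d w where w: "\<And>k. 0 \<le> w k"
    and eq: "\<And>x. x \<in> X \<Longrightarrow> g x = c + d * x + (\<Sum>k\<in>X. w k * max 0 (x - k))"
    using convex_interpolation[of X g, OF fin sub] by blast
  have val: "pair_sum f z1 z2 = c + d + (\<Sum>k\<in>X. w k * excess k z1 z2)"
    if z: "dichotomy z1 z2" and zX: "\<And>i. i < dim_vec z1 \<Longrightarrow> z1 $ i / z2 $ i \<in> X" for z1 z2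
  proof -
    have "f (z1 $ i) (z2 $ i) = c * z2 $ i + d * z1 $ i + (\<Sum>k\<in>X. w k * max 0 (z1 $ i - k * z2 $ i))"
      if i: "i < dim_vec z1" for i
    proof (cases "z2 $ i = 0")
      case True
      then show ?thesis using dichotomyD(4)[OF z i] by (simp add: f0)
    next
      case False
      then have pos: "0 < z2 $ i" using dichotomyD(3)[OF z i] by simp
      have "z2 $ i * max 0 (z1 $ i / z2 $ i - k) = max 0 (z1 $ i - k * z2 $ i)" for k
        using pos by (auto simp: max_def field_simps)
      then have "z2 $ i * (\<Sum>k\<in>X. w k * max 0 (z1 $ i / z2 $ i - k)) = (\<Sum>k\<in>X. w k * max 0 (z1 $ i - k * z2 $ i))"
        by (simp add: sum_distrib_left mult.left_commute)
      then show ?thesis using pos eq[OF zX[OF i]] by (simp add: f algebra_simps)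
    qed
    then have "pair_sum f z1 z2 = (\<Sum>i<dim_vec z1. c * z2 $ i + d * z1 $ i + (\<Sum>k\<in>X. w k * max 0 (z1 $ i - k * z2 $ i)))"
      by (simp add: pair_sum_def)
    also have "\<dots> = c * (\<Sum>i<dim_vec z1. z2 $ i) + d * (\<Sum>i<dim_vec z1. z1 $ i)
        + (\<Sum>i<dim_vec z1. \<Sum>k\<in>X. w k * max 0 (z1 $ i - k * z2 $ i))"
      by (simp add: sum.distrib sum_distrib_left)
    also have "(\<Sum>i<dim_vec z1. \<Sum>k\<in>X. w k * max 0 (z1 $ i - k * z2 $ i)) = (\<Sum>k\<in>X. w k * excess k z1 z2)"
      by (subst sum.swap) (simp add: excess_def pair_sum_def sum_distrib_left)
    finally show ?thesis using dichotomyD(5,6)[OF z] by simp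
  qed
  have "pair_sum f y1 y2 = c + d + (\<Sum>k\<in>X. w k * excess k y1 y2)"
    by (rule val[OF y]) (auto simp: X_def)
  also have "\<dots> \<le> c + d + (\<Sum>k\<in>X. w k * excess k x1 x2)"
    using w ex X0 by (intro add_left_mono sum_mono mult_left_mono) auto
  also have "\<dots> = pair_sum f x1 x2"
    by (rule val[OF x, symmetric]) (auto simp: X_def)
  finally show ?thesis .
qed

text \<open>Functions on all index pairs rather than matrices: the set is then a closed subset of a
  product of copies of [0,1], and compactness comes from Tychonoff. Entries outside the relevant
  block are merely confined to [0,1].\<close>

definition stoch_fun :: "nat \<Rightarrow> nat \<Rightarrow> (nat \<times> nat \<Rightarrow> real) set" where
  "stoch_fun m n = {T. (\<forall>p. 0 \<le> T p \<and> T p \<le> 1) \<and> (\<forall>i<n. (\<Sum>j<m. T (j, i)) = 1)}"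

lemma compact_stoch_fun: "compact (stoch_fun m n)"
proof -
  have "compactin (product_topology (\<lambda>_. euclidean) UNIV) (\<Pi>\<^sub>E p\<in>(UNIV :: (nat \<times> nat) set). {0..1::real})"
    by (simp add: compactin_PiE)
  then have "compact (\<Pi>\<^sub>E p\<in>(UNIV :: (nat \<times> nat) set). {0..1::real})"
    by (simp add: euclidean_product_topology)
  moreover have "closed {T :: nat \<times> nat \<Rightarrow> real. (\<Sum>j<m. T (j, i)) = 1}" for i
    by (intro closed_Collect_eq continuous_intros continuous_on_product_coordinates)
  then have "closed (\<Inter>i\<in>{..<n}. {T :: nat \<times> nat \<Rightarrow> real. (\<Sum>j<m. T (j, i)) = 1})"
    by (intro closed_INT) auto
  moreover have "stoch_fun m n = (\<Pi>\<^sub>E p\<in>(UNIV :: (nat \<times> nat) set). {0..1::real}) \<inter>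
      (\<Inter>i\<in>{..<n}. {T. (\<Sum>j<m. T (j, i)) = 1})"
    by (auto simp: stoch_fun_def)
  ultimately show ?thesis by (simp add: compact_Int_closed)
qed

lemma stoch_fun_convex:
  assumes "S \<in> stoch_fun m n" "T \<in> stoch_fun m n" "0 \<le> c" "c \<le> 1"
  shows "(\<lambda>p. S p + c * (T p - S p)) \<in> stoch_fun m n"
proof -
  have "0 \<le> S p + c * (T p - S p) \<and> S p + c * (T p - S p) \<le> 1" for p
  proof -
    have b: "0 \<le> S p" "S p \<le> 1" "0 \<le> T p" "T p \<le> 1"
      using assms unfolding stoch_fun_def by blast+
    have "S p + c * (T p - S p) = (1 - c) * S p + c * T p" by (simp add: algebra_simps)
    moreover have "(1 - c) * S p + c * T p \<le> (1 - c) * 1 + c * 1"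
      using assms b by (intro add_mono mult_left_mono) auto
    moreover have "0 \<le> (1 - c) * S p + c * T p"
      using assms b by (intro add_nonneg_nonneg mult_nonneg_nonneg) auto
    ultimately show ?thesis by simp
  qed
  then show ?thesis
    using assms by (simp add: stoch_fun_def sum.distrib sum_subtractf flip: sum_distrib_left)
qed

text \<open>First-order condition at the left end of [0,1]: for positive C the linear term would
  outweigh the quadratic one at small c.\<close>

lemma quadratic_min_at_0:
  fixes C D :: real
  assumes "\<And>c. 0 < c \<Longrightarrow> c \<le> 1 \<Longrightarrow> 0 \<le> c\<^sup>2 * D - 2 * c * C"
  shows "C \<le> 0"
proof (rule ccontr)
  assume "\<not> C \<le> 0"
  define c where "c = min 1 (C / (\<bar>D\<bar> + 1))"
  have c: "0 < c" "c \<le> 1" "c \<le> C / (\<bar>D\<bar> + 1)" using \<open>\<not> C \<le> 0\<close> by (auto simp: c_def)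
  have "0 \<le> c * (c * D - 2 * C)" using assms[OF c(1,2)] by (simp add: algebra_simps power2_eq_square)
  then have "2 * C \<le> c * D" using c(1) by (simp add: zero_le_mult_iff)
  also have "\<dots> \<le> c * (\<bar>D\<bar> + 1)" using c(1) by (intro mult_left_mono) auto
  also have "\<dots> \<le> C" using c(3) by (simp add: field_simps)
  finally show False using \<open>\<not> C \<le> 0\<close> by simp
qed

text \<open>The matrix minimising the squared distance of the images to the target satisfies a variational
  inequality; testing it with the matrix that maps each point to the index maximising \<open>a\<^sub>j u + b\<^sub>j v\<close>
  (with \<open>a\<close>, \<open>b\<close> the residuals) shows that the residuals vanish.\<close>

lemma blackwell_dichotomy:
  assumes x: "dichotomy x1 x2" and y: "dichotomy y1 y2"
    and ex: "\<And>t. 0 \<le> t \<Longrightarrow> excess t y1 y2 \<le> excess t x1 x2"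
  shows "\<exists>T. stochastic_mat T \<and> maps_vec T x1 y1 \<and> maps_vec T x2 y2"
proof -
  define n where "n = dim_vec x1"
  define m where "m = dim_vec y1"
  have dims: "dim_vec x1 = n" "dim_vec x2 = n" "dim_vec y1 = m" "dim_vec y2 = m"
    using dichotomyD(1)[OF x] dichotomyD(1)[OF y] by (auto simp: n_def m_def)
  have m0: "0 < m" using dichotomyD(5)[OF y] by (cases m) (auto simp: dims)
  define ap where "ap T v j = (\<Sum>i<n. T (j, i) * v $ i)" for T :: "nat \<times> nat \<Rightarrow> real" and v :: "real vec" and j
  define h where "h T = (\<Sum>j<m. (y1 $ j - ap T x1 j)\<^sup>2 + (y2 $ j - ap T x2 j)\<^sup>2)" for T
  have "continuous_on (stoch_fun m n) h"
    unfolding h_def ap_def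
    by (intro continuous_intros continuous_on_subset[OF continuous_on_product_coordinates]) auto
  moreover have "(\<lambda>(j, i). if j = 0 then 1 else 0) \<in> stoch_fun m n"
    using m0 by (auto simp: stoch_fun_def sum.delta)
  then have "stoch_fun m n \<noteq> {}" by blast
  ultimately obtain S where S: "S \<in> stoch_fun m n" and min: "\<And>T. T \<in> stoch_fun m n \<Longrightarrow> h S \<le> h T"
    using continuous_attains_inf[OF compact_stoch_fun] by metis
  define a where "a j = y1 $ j - ap S x1 j" for j
  define b where "b j = y2 $ j - ap S x2 j" for j
  have hS: "h S = (\<Sum>j<m. (a j)\<^sup>2 + (b j)\<^sup>2)" by (simp add: h_def a_def b_def)
  have var: "(\<Sum>j<m. a j * ap T x1 j + b j * ap T x2 j) \<le> (\<Sum>j<m. a j * ap S x1 j + b j * ap S x2 j)"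
    if T: "T \<in> stoch_fun m n" for T
  proof -
    define C where "C = (\<Sum>j<m. a j * (ap T x1 j - ap S x1 j) + b j * (ap T x2 j - ap S x2 j))"
    define D where "D = (\<Sum>j<m. (ap T x1 j - ap S x1 j)\<^sup>2 + (ap T x2 j - ap S x2 j)\<^sup>2)"
    have "C \<le> 0"
    proof (rule quadratic_min_at_0)
      fix c :: real assume c: "0 < c" "c \<le> 1"
      define U where "U = (\<lambda>p. S p + c * (T p - S p))"
      have "ap U v j = ap S v j + c * (ap T v j - ap S v j)" for v j
        by (simp add: ap_def U_def algebra_simps sum.distrib sum_subtractf sum_distrib_left)
      moreover have "(y - (s + c * (t - s)))\<^sup>2 = (y - s)\<^sup>2 - 2 * c * ((y - s) * (t - s)) + c\<^sup>2 * (t - s)\<^sup>2" for y s t :: real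
        by (simp add: power2_eq_square algebra_simps)
      ultimately have "h U = (\<Sum>j<m. ((a j)\<^sup>2 + (b j)\<^sup>2) - 2 * c * (a j * (ap T x1 j - ap S x1 j) + b j * (ap T x2 j - ap S x2 j))
          + c\<^sup>2 * ((ap T x1 j - ap S x1 j)\<^sup>2 + (ap T x2 j - ap S x2 j)\<^sup>2))"
        unfolding h_def a_def b_def by (intro sum.cong refl) (simp add: distrib_left)
      also have "\<dots> = h S - 2 * c * C + c\<^sup>2 * D"
        unfolding hS C_def D_def by (simp only: distrib_left sum.distrib sum_subtractf sum_distrib_left)
      finally show "0 \<le> c\<^sup>2 * D - 2 * c * C"
        using min[of U] stoch_fun_convex[OF S T, of c] c by (simp add: U_def)
    qed
    then show ?thesis by (simp add: C_def algebra_simps sum.distrib sum_subtractf)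
  qed
  \<comment> \<open>The support function of the finite set of residual pairs. It is convex and
    positively homogeneous, so the order of \<open>excess\<close> controls its sums.\<close>
  define f where "f u v = Max ((\<lambda>j. a j * u + b j * v) ` {..<m})" for u v
  have ne: "{..<m} \<noteq> {}" using m0 by auto
  have f_ge: "a j * u + b j * v \<le> f u v" if "j < m" for j u v
    using that unfolding f_def by (intro Max_ge) auto
  have f_ex: "\<exists>j<m. f u v = a j * u + b j * v" for u v
  proof -
    have "f u v \<in> (\<lambda>j. a j * u + b j * v) ` {..<m}"
      unfolding f_def using ne by (intro Max_in) auto
    then show ?thesis by auto
  qed
  have "pair_sum f y1 y2 \<le> pair_sum f x1 x2"
  proof (rule pair_sum_sublinear[OF x y ex, where g = "\<lambda>r. f r 1"])
    fix r :: real
    obtain j where j: "j < m" "f r 1 = a j * r + b j * 1" using f_ex by blast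
    have "f r 1 + a j * (s - r) \<le> f s 1" for s
      using f_ge[OF j(1), of s 1] j(2) by (simp add: algebra_simps)
    then show "\<exists>k. \<forall>s. f r 1 + k * (s - r) \<le> f s 1" by blast
  next
    fix u v :: real assume v: "0 < v"
    obtain j where j: "j < m" "f (u / v) 1 = a j * (u / v) + b j * 1" using f_ex by blast
    obtain k where k: "k < m" "f u v = a k * u + b k * v" using f_ex by blast
    have "v * f (u / v) 1 = a j * u + b j * v" using j v by (simp add: field_simps)
    then have "v * f (u / v) 1 \<le> f u v" using f_ge[OF j(1)] by metis
    moreover have "v * (a k * (u / v) + b k * 1) \<le> v * f (u / v) 1"
      using v f_ge[OF k(1), of "u / v" 1] by (intro mult_left_mono) auto
    moreover have "v * (a k * (u / v) + b k * 1) = f u v" using k(2) v by (simp add: field_simps)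
    ultimately show "f u v = v * f (u / v) 1" by simp
  next
    show "f 0 0 = 0" using f_ex[of 0 0] by auto
  qed simp
  moreover have "pair_sum f x1 x2 \<le> (\<Sum>j<m. a j * ap S x1 j + b j * ap S x2 j)"
  proof -
    obtain J where J: "\<And>i. J i < m" "\<And>i. f (x1 $ i) (x2 $ i) = a (J i) * x1 $ i + b (J i) * x2 $ i"
    proof -
      have "\<forall>i. \<exists>j. j < m \<and> f (x1 $ i) (x2 $ i) = a j * x1 $ i + b j * x2 $ i" using f_ex by blast
      then show ?thesis using that by metis
    qed
    define T where "T = (\<lambda>(j, i). if j = J i then 1 else 0 :: real)"
    have T: "T \<in> stoch_fun m n"
      using J(1) by (auto simp: stoch_fun_def T_def sum.delta)
    have "pair_sum f x1 x2 = (\<Sum>i<n. a (J i) * x1 $ i + b (J i) * x2 $ i)"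
      by (simp add: pair_sum_def dims J(2))
    also have "\<dots> = (\<Sum>i<n. \<Sum>j<m. T (j, i) * (a j * x1 $ i + b j * x2 $ i))"
      using J(1) by (intro sum.cong refl) (simp add: T_def if_distrib[of "\<lambda>t. t * _"] sum.delta cong: if_cong)
    also have "\<dots> = (\<Sum>j<m. \<Sum>i<n. T (j, i) * (a j * x1 $ i + b j * x2 $ i))"
      by (rule sum.swap)
    also have "\<dots> = (\<Sum>j<m. a j * ap T x1 j + b j * ap T x2 j)"
      by (simp add: ap_def sum_distrib_left sum.distrib algebra_simps)
    finally show ?thesis using var[OF T] by simp
  qed
  \<comment> \<open>The target is the image under S plus the residual, so pairing both with the
    residual differs by exactly the squared distance \<open>h S\<close>. The surrounding
    inequalities bound the larger side by the smaller one, forcing \<open>h S\<close> to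
    vanish.\<close>
  moreover have "(\<Sum>j<m. a j * ap S x1 j + b j * ap S x2 j) + h S = (\<Sum>j<m. a j * y1 $ j + b j * y2 $ j)"
    unfolding hS a_def b_def by (simp add: power2_eq_square algebra_simps flip: sum.distrib)
  moreover have "(\<Sum>j<m. a j * y1 $ j + b j * y2 $ j) \<le> pair_sum f y1 y2"
    unfolding pair_sum_def dims by (intro sum_mono f_ge) auto
  ultimately have "h S \<le> 0" by linarith
  then have "(\<Sum>j<m. (a j)\<^sup>2 + (b j)\<^sup>2) = 0" unfolding hS
    by (intro antisym sum_nonneg) auto
  then have "\<forall>j\<in>{..<m}. (a j)\<^sup>2 + (b j)\<^sup>2 = 0"
    by (subst (asm) sum_nonneg_eq_0_iff) auto
  then have zero: "a j = 0 \<and> b j = 0" if "j < m" for j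
    using that by (simp add: sum_power2_eq_zero_iff)
  define M where "M = mat m n S"
  have "stochastic_mat M"
    using S by (auto simp: stochastic_mat_def M_def stoch_fun_def)
  moreover have "M *\<^sub>v v = w" if "dim_vec v = n" "dim_vec w = m" "\<And>j. j < m \<Longrightarrow> ap S v j = w $ j" for v w
    using that by (intro eq_vecI) (auto simp: M_def ap_def scalar_prod_def atLeast0LessThan)
  ultimately show ?thesis
    using zero dims by (intro exI[of _ M]) (auto simp: maps_vec_def a_def b_def M_def)
qed

section \<open>Exponential tilting and large deviations\<close>

text \<open>At \<alpha> = 1 this is the relative entropy, the divergence of order 1.\<close>

definition renyi_deriv :: "real \<Rightarrow> real vec \<Rightarrow> real vec \<Rightarrow> real" where
  "renyi_deriv \<alpha> = pair_sum (\<lambda>u v. u powr \<alpha> * v powr (1 - \<alpha>) * ln (u / v))"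

text \<open>The moment generating function, in \<alpha> - 1 and under x, of the log likelihood ratio
  shifted by \<open>ln s\<close>. Tensor powers at the threshold \<open>s ^ n\<close> turn it into
  its n-th power, so its minima over \<alpha> are exponential rates.\<close>

definition tilt :: "real \<Rightarrow> real \<Rightarrow> real vec \<Rightarrow> real vec \<Rightarrow> real" where
  "tilt s \<alpha> x y = s powr (1 - \<alpha>) * renyi_sum \<alpha> x y"

lemma powr_perspective:
  assumes "0 \<le> u" "0 < (v::real)"
  shows "u powr \<alpha> * v powr (1 - \<alpha>) = v * (u / v) powr \<alpha>"
  using assms by (simp add: powr_divide powr_diff)

lemma renyi_sum_kron:
  assumes "dichotomy x1 x2" "dichotomy y1 y2"
  shows "renyi_sum \<alpha> (x1 \<otimes>\<^sub>v y1) (x2 \<otimes>\<^sub>v y2) = renyi_sum \<alpha> x1 x2 * renyi_sum \<alpha> y1 y2"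
proof -
  have "renyi_sum \<alpha> (x1 \<otimes>\<^sub>v y1) (x2 \<otimes>\<^sub>v y2) =
      pair_sum (\<lambda>u v. pair_sum (\<lambda>u' v'. (u * u') powr \<alpha> * (v * v') powr (1 - \<alpha>)) y1 y2) x1 x2"
    unfolding renyi_sum_def by (rule pair_sum_kron) (use assms in \<open>auto dest: dichotomyD(1)\<close>)
  also have "\<dots> = pair_sum (\<lambda>u v. u powr \<alpha> * v powr (1 - \<alpha>) * pair_sum (\<lambda>u' v'. u' powr \<alpha> * v' powr (1 - \<alpha>)) y1 y2) x1 x2"
    using dichotomyD(1-3)[OF assms(1)] dichotomyD(1-3)[OF assms(2)]
    by (intro pair_sum_cong) (simp add: pair_sum_def powr_mult mult_ac sum_distrib_left)
  also have "\<dots> = renyi_sum \<alpha> x1 x2 * renyi_sum \<alpha> y1 y2"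
    by (simp add: renyi_sum_def pair_sum_def sum_distrib_right)
  finally show ?thesis .
qed

lemma renyi_sum_kron_pow:
  assumes "dichotomy x y"
  shows "renyi_sum \<alpha> (kron_pow x n) (kron_pow y n) = renyi_sum \<alpha> x y ^ n"
proof (induction n)
  case 0
  show ?case by (simp add: renyi_sum_def pair_sum_def)
next
  case (Suc n)
  then show ?case
    using renyi_sum_kron[OF dichotomy_kron_pow[OF assms] assms] by (simp add: mult.commute)
qed

lemma renyi_sum_1:
  assumes "dichotomy x y"
  shows "renyi_sum 1 x y = 1"
proof -
  have "(x $ i) powr 1 * (y $ i) powr (1 - 1) = x $ i" if i: "i < dim_vec x" for i
    using dichotomyD(2-4)[OF assms i] by (cases "y $ i = 0") auto
  then show ?thesis
    using dichotomyD(5)[OF assms] by (simp add: renyi_sum_def pair_sum_def)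
qed

lemma renyi_sum_pos:
  assumes "dichotomy x y"
  shows "0 < renyi_sum \<alpha> x y"
proof -
  obtain i where i: "i < dim_vec x" "x $ i \<noteq> 0"
    using dichotomyD(5)[OF assms] by (metis lessThan_iff sum.neutral zero_neq_one)
  then have "y $ i \<noteq> 0" using dichotomyD(4)[OF assms] by blast
  then have "0 < (x $ i) powr \<alpha> * (y $ i) powr (1 - \<alpha>)" using i by simp
  also have "\<dots> \<le> renyi_sum \<alpha> x y"
    unfolding renyi_sum_def pair_sum_def using i
    by (intro member_le_sum[of i _ "\<lambda>i. (x $ i) powr \<alpha> * (y $ i) powr (1 - \<alpha>)"]) auto
  finally show ?thesis .
qed

lemma has_real_derivative_renyi_sum:
  assumes "dichotomy x y"
  shows "((\<lambda>\<alpha>. renyi_sum \<alpha> x y) has_real_derivative renyi_deriv \<alpha> x y) (at \<alpha>)"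
  unfolding renyi_sum_def renyi_deriv_def pair_sum_def
proof (rule DERIV_sum)
  fix i assume "i \<in> {..<dim_vec x}"
  then have i: "i < dim_vec x" by simp
  show "((\<lambda>\<alpha>. (x $ i) powr \<alpha> * (y $ i) powr (1 - \<alpha>)) has_real_derivative
        (x $ i) powr \<alpha> * (y $ i) powr (1 - \<alpha>) * ln (x $ i / y $ i)) (at \<alpha>)"
  proof (cases "x $ i = 0")
    case False
    then have "0 < x $ i" "0 < y $ i"
      using dichotomyD(2-4)[OF assms i] by force+
    then show ?thesis
      by (auto intro!: derivative_eq_intros simp: ln_div algebra_simps)
  qed simp
qed

text \<open>At \<alpha> = 1 the derivative is \<open>renyi_deriv 1 x y - ln s\<close>. Comparing
  \<open>ln s\<close> with the relative entropy thus tells on which side of 1 the function drops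
  below its value 1.\<close>

lemma has_real_derivative_tilt:
  assumes "dichotomy x y" "0 < s"
  shows "((\<lambda>\<alpha>. tilt s \<alpha> x y) has_real_derivative
     s powr (1 - \<alpha>) * (renyi_deriv \<alpha> x y - ln s * renyi_sum \<alpha> x y)) (at \<alpha>)"
  unfolding tilt_def
  using assms(2) by (auto intro!: derivative_eq_intros has_real_derivative_renyi_sum[OF assms(1)] simp: algebra_simps)

lemma continuous_on_tilt:
  assumes "dichotomy x y" "0 < s"
  shows "continuous_on A (\<lambda>\<alpha>. tilt s \<alpha> x y)"
  using has_real_derivative_tilt[OF assms] by (intro DERIV_continuous_on) (auto intro: has_field_derivative_at_within)

lemma tilt_1: "dichotomy x y \<Longrightarrow> 0 < s \<Longrightarrow> tilt s 1 x y = 1"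
  by (simp add: tilt_def renyi_sum_1)

lemma tilt_pos: "dichotomy x y \<Longrightarrow> 0 < s \<Longrightarrow> 0 < tilt s \<alpha> x y"
  by (simp add: tilt_def renyi_sum_pos)

lemma tilt_rescale: "0 < s \<Longrightarrow> 0 < c \<Longrightarrow> tilt (c * s) \<alpha> x y = c powr (1 - \<alpha>) * tilt s \<alpha> x y"
  by (simp add: tilt_def powr_mult)

lemma powr_power_swap: "0 < (s::real) \<Longrightarrow> (s ^ n) powr a = (s powr a) ^ n"
  by (simp add: powr_powr mult.commute flip: powr_realpow)

lemma tilt_kron_pow:
  assumes "dichotomy x y" "0 < s"
  shows "tilt (s ^ n) \<alpha> (kron_pow x n) (kron_pow y n) = tilt s \<alpha> x y ^ n"
  using assms by (simp add: tilt_def renyi_sum_kron_pow powr_power_swap power_mult_distrib)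

lemma tilt_eq_pair_sum:
  assumes "dichotomy x y" "0 < t"
  shows "tilt t \<alpha> x y = pair_sum (\<lambda>u v. t * v * (u / (t * v)) powr \<alpha>) x y"
proof -
  have "t powr (1 - \<alpha>) * ((x $ i) powr \<alpha> * (y $ i) powr (1 - \<alpha>)) = t * y $ i * (x $ i / (t * y $ i)) powr \<alpha>"
    if i: "i < dim_vec x" for i
  proof (cases "y $ i = 0")
    case False
    then have "0 < y $ i" using dichotomyD(3)[OF assms(1) i] by simp
    then show ?thesis
      using powr_perspective[of "x $ i" "t * y $ i" \<alpha>] assms(2) dichotomyD(2)[OF assms(1) i]
      by (simp add: powr_mult mult_ac)
  qed simp
  then show ?thesis
    by (simp add: tilt_def renyi_sum_def pair_sum_def sum_distrib_left)
qed

section \<open>Chernoff bounds and truncated lower bounds for \<open>excess\<close> and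
  \<open>overlap\<close>\<close>

lemma excess_eq_overlap:
  assumes "dichotomy x y"
  shows "excess t x y = 1 - overlap t x y"
proof -
  have "excess t x y + overlap t x y = (\<Sum>i<dim_vec x. x $ i)"
    unfolding excess_def overlap_def pair_sum_def sum.distrib[symmetric]
    by (intro sum.cong refl) (auto simp: max_def min_def)
  then show ?thesis using dichotomyD(5)[OF assms] by simp
qed

lemma excess_antimono:
  assumes "dichotomy x y" "t \<le> t'"
  shows "excess t' x y \<le> excess t x y"
  unfolding excess_def
  using assms(2) dichotomyD(3)[OF assms(1)]
  by (intro pair_sum_mono) (smt (verit) mult_right_mono max.mono)

lemma overlap_mono:
  assumes "dichotomy x y" "t \<le> t'"
  shows "overlap t x y \<le> overlap t' x y"
  using excess_antimono[OF assms] assms(1) by (simp add: excess_eq_overlap)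

text \<open>Lowering the threshold by a factor costs at most that factor. This carries the lower
  bound at \<open>s ^ n\<close> to a whole window of thresholds.\<close>

lemma overlap_scale:
  assumes "dichotomy x y" "0 \<le> c" "c \<le> 1"
  shows "c * overlap t x y \<le> overlap (c * t) x y"
  unfolding overlap_def pair_sum_cmult[symmetric]
proof (rule pair_sum_mono)
  fix i assume "i < dim_vec x"
  then have "0 \<le> x $ i" by (rule dichotomyD(2)[OF assms(1)])
  then have "c * x $ i \<le> x $ i" using assms(3) by (simp add: mult_left_le_one_le assms(2))
  moreover have "c * min (x $ i) (t * y $ i) \<le> c * x $ i" "c * min (x $ i) (t * y $ i) \<le> c * (t * y $ i)"
    using assms(2) by (intro mult_left_mono; simp)+
  ultimately show "c * min (x $ i) (t * y $ i) \<le> min (x $ i) (c * t * y $ i)" by simp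
qed

text \<open>Reduces inequalities between \<open>overlap\<close>, \<open>excess\<close> and
  \<open>tilt\<close> to scalar ones in the normalised ratio z = u / (t * v); the weights t * v
  vanish where the ratio is meaningless.\<close>

lemma pair_sum_scaled_le:
  assumes xy: "dichotomy x y" and t: "0 < t"
    and le: "\<And>z. 0 \<le> z \<Longrightarrow> f z \<le> g z"
  shows "pair_sum (\<lambda>u v. t * v * f (u / (t * v))) x y \<le> pair_sum (\<lambda>u v. t * v * g (u / (t * v))) x y"
  using t dichotomyD(2,3)[OF xy] by (intro pair_sum_mono mult_left_mono le) auto

lemma overlap_eq_scaled:
  assumes "dichotomy x y" "0 < t"
  shows "overlap t x y = pair_sum (\<lambda>u v. t * v * min (u / (t * v)) 1) x y"
  unfolding overlap_def
proof (rule pair_sum_cong)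
  fix i assume i: "i < dim_vec x"
  show "min (x $ i) (t * y $ i) = t * y $ i * min (x $ i / (t * y $ i)) 1"
    using dichotomyD(2-4)[OF assms(1) i] assms(2)
    by (cases "y $ i = 0") (auto simp: min_def field_simps)
qed

lemma excess_eq_scaled:
  assumes "dichotomy x y" "0 < t"
  shows "excess (c * t) x y = pair_sum (\<lambda>u v. t * v * max 0 (u / (t * v) - c)) x y"
  unfolding excess_def
proof (rule pair_sum_cong)
  fix i assume i: "i < dim_vec x"
  show "max 0 (x $ i - c * t * y $ i) = t * y $ i * max 0 (x $ i / (t * y $ i) - c)"
    using dichotomyD(2-4)[OF assms(1) i] assms(2)
    by (cases "y $ i = 0") (auto simp: max_def field_simps)
qed

lemma overlap_le_tilt:
  assumes "dichotomy x y" "0 < t" "0 \<le> \<alpha>" "\<alpha> \<le> 1"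
  shows "overlap t x y \<le> tilt t \<alpha> x y"
  unfolding overlap_eq_scaled[OF assms(1,2)] tilt_eq_pair_sum[OF assms(1,2)]
proof (rule pair_sum_scaled_le[OF assms(1,2)])
  fix z :: real assume "0 \<le> z"
  show "min z 1 \<le> z powr \<alpha>"
  proof (cases "z = 0 \<or> 1 \<le> z")
    case False
    then have "z powr 1 \<le> z powr \<alpha>" using \<open>0 \<le> z\<close> assms(4) by (intro powr_mono') auto
    then show ?thesis using \<open>0 \<le> z\<close> by simp
  next
    case True
    then show ?thesis using assms(3) ge_one_powr_ge_zero[of z \<alpha>] by auto
  qed
qed

lemma excess_le_tilt:
  assumes "dichotomy x y" "0 < t" "1 \<le> \<alpha>"
  shows "excess t x y \<le> tilt t \<alpha> x y"
proof -
  have "pair_sum (\<lambda>u v. t * v * max 0 (u / (t * v) - 1)) x y \<le> pair_sum (\<lambda>u v. t * v * (u / (t * v)) powr \<alpha>) x y"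
  proof (rule pair_sum_scaled_le[OF assms(1,2)])
    fix z :: real assume "0 \<le> z"
    show "max 0 (z - 1) \<le> z powr \<alpha>"
    proof (cases "1 \<le> z")
      case True
      then show ?thesis using powr_mono[OF assms(3), of z] by simp
    qed simp
  qed
  then show ?thesis
    using excess_eq_scaled[OF assms(1,2), of 1] tilt_eq_pair_sum[OF assms(1,2)] by simp
qed

text \<open>A Markov bound: beyond k, raising the exponent by h gains the factor k powr -h. With k =
  \<kappa>^n the tail is negligible once \<kappa> powr -h times the value of \<open>tilt\<close> at
  \<alpha> + h is below its value at \<alpha>.\<close>

lemma powr_tail_upper:
  fixes z k :: real
  assumes "0 < k" "k \<le> z" "0 < h"
  shows "z powr \<alpha> \<le> k powr - h * z powr (\<alpha> + h)"
proof -
  have "k powr h \<le> z powr h" using assms by (intro powr_mono2) auto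
  then have "z powr \<alpha> * k powr h \<le> z powr \<alpha> * z powr h" by (intro mult_left_mono) auto
  then show ?thesis using assms by (simp add: powr_add powr_minus divide_simps mult.commute)
qed

lemma powr_tail_lower:
  fixes z k :: real
  assumes "0 < k" "0 \<le> z" "z * k \<le> 1" "0 < h"
  shows "z powr \<alpha> \<le> k powr - h * z powr (\<alpha> - h)"
proof (cases "z = 0")
  case False
  have "z powr h * k powr h \<le> 1"
    using powr_mono2[of h "z * k" 1] assms by (simp add: powr_mult)
  then have "z powr \<alpha> * (z powr h * k powr h) \<le> z powr \<alpha>" by (simp add: mult_left_le)
  then show ?thesis using assms False by (simp add: powr_diff powr_minus divide_simps mult_ac)
qed simp

text \<open>These two bounds discard the part of the tilted sum with likelihood ratio \<open>z\<close> outside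
  \<open>[1/k, k]\<close>. At a boundary minimiser \<open>\<alpha>\<close> one of the two tails cannot be controlled, but then it
  need not be discarded; hence the \<open>of_bool\<close> factors.\<close>

lemma min_ge_tilted:
  fixes z k :: real
  assumes "0 \<le> z" "1 < k" "0 \<le> \<alpha>" "\<alpha> \<le> 1" "0 < h" "0 < h'"
  shows "z powr \<alpha> - of_bool (0 < \<alpha>) * (k powr - h * z powr (\<alpha> + h))
      - of_bool (\<alpha> < 1) * (k powr - h' * z powr (\<alpha> - h')) \<le> k * min z 1"
proof -
  let ?A = "of_bool (0 < \<alpha>) * (k powr - h * z powr (\<alpha> + h))"
  let ?B = "of_bool (\<alpha> < 1) * (k powr - h' * z powr (\<alpha> - h'))"
  have nn: "0 \<le> ?A" "0 \<le> ?B" "0 \<le> k * min z 1" using assms by auto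
  consider "z = 0" | "0 < z" "k < z" | "0 < z" "z * k < 1" | "0 < z" "z \<le> k" "1 \<le> z * k"
    using assms(1) by linarith
  then show ?thesis
  proof cases
    case 1
    then show ?thesis by simp
  next
    case 2
    show ?thesis
    proof (cases "\<alpha> = 0")
      case True
      then have "z powr \<alpha> \<le> k * min z 1" using 2 assms(2) by simp
      then show ?thesis using nn by linarith
    next
      case False
      then have "z powr \<alpha> \<le> ?A" using powr_tail_upper[of k z h \<alpha>] 2 assms by simp
      then show ?thesis using nn by linarith
    qed
  next
    case 3
    show ?thesis
    proof (cases "\<alpha> = 1")
      case True
      have "z < k" using 3 assms(2) by (smt (verit) mult_le_cancel_left1)
      have "z < 1" using 3 assms(2) by (smt (verit) mult_le_cancel_left1)
      then have "z powr \<alpha> \<le> k * min z 1" using 3 assms(2) True by simp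
      then show ?thesis using nn by linarith
    next
      case False
      then have "z powr \<alpha> \<le> ?B" using powr_tail_lower[of k z h' \<alpha>] 3 assms by simp
      then show ?thesis using nn by linarith
    qed
  next
    case 4
    have "z powr \<alpha> \<le> k * min z 1"
    proof (cases "1 \<le> z")
      case True
      then have "z powr \<alpha> \<le> z powr 1" using assms by (intro powr_mono) auto
      then show ?thesis using 4 True by simp
    next
      case False
      have "z powr \<alpha> \<le> z powr 0" using False 4 assms by (intro powr_mono') auto
      then show ?thesis using 4 False by (simp add: mult.commute)
    qed
    then show ?thesis using nn by linarith
  qed
qed

lemma max_ge_tilted:
  fixes z k :: real
  assumes "0 \<le> z" "1 < k" "1 \<le> \<alpha>" "0 < h" "0 < h'"
  shows "(1 - 1 / k) * (z powr \<alpha> - of_bool (1 < \<alpha>) * (k powr - h * z powr (\<alpha> + h))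
      - k powr - h' * z powr (\<alpha> - h')) \<le> k powr (\<alpha> - 1) * max 0 (z - 1 / k\<^sup>2)"
proof -
  let ?A = "of_bool (1 < \<alpha>) * (k powr - h * z powr (\<alpha> + h))"
  let ?B = "k powr - h' * z powr (\<alpha> - h')"
  let ?R = "k powr (\<alpha> - 1) * max 0 (z - 1 / k\<^sup>2)"
  have nn: "0 \<le> ?A" "0 \<le> ?B" "0 \<le> ?R" "0 \<le> 1 - 1 / k" using assms by auto
  have neg: ?thesis if "z powr \<alpha> \<le> ?A + ?B"
    using mult_nonneg_nonpos[of "1 - 1 / k" "z powr \<alpha> - ?A - ?B"] that nn by linarith
  have pos: ?thesis if "1 \<le> z * k" "z powr \<alpha> \<le> k powr (\<alpha> - 1) * z"
  proof -
    \<comment> \<open>Retained ratios are at least 1 / k, so subtracting 1 / k^2 removes at most the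
      fraction 1 / k of z. This is the origin of the factor 1 - 1 / k.\<close>
    have "1 / k\<^sup>2 \<le> z / k" using that(1) assms(2) by (simp add: field_simps power2_eq_square)
    then have z: "(1 - 1 / k) * z \<le> max 0 (z - 1 / k\<^sup>2)" by (simp add: algebra_simps)
    have "(1 - 1 / k) * (z powr \<alpha> - ?A - ?B) \<le> (1 - 1 / k) * (k powr (\<alpha> - 1) * z)"
      using that(2) nn by (intro mult_left_mono) linarith+
    also have "\<dots> = k powr (\<alpha> - 1) * ((1 - 1 / k) * z)" by (simp add: mult_ac)
    also have "\<dots> \<le> ?R" using z by (intro mult_left_mono) auto
    finally show ?thesis .
  qed
  consider "z * k < 1" | "1 \<le> z * k" "\<alpha> = 1" | "1 < \<alpha>" "k < z" | "1 \<le> z * k" "1 < \<alpha>" "z \<le> k"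
    using assms by linarith
  then show ?thesis
  proof cases
    case 1
    then have "z powr \<alpha> \<le> ?B" using assms by (intro powr_tail_lower) auto
    then show ?thesis using nn by (intro neg) linarith
  next
    case 2
    then show ?thesis using assms by (intro pos) auto
  next
    case 3
    then have "z powr \<alpha> \<le> ?A" using powr_tail_upper[of k z h \<alpha>] assms by simp
    then show ?thesis using nn by (intro neg) linarith
  next
    case 4
    then have "0 < z" using assms by (cases "z = 0") auto
    then have "z powr (\<alpha> - 1) * z \<le> k powr (\<alpha> - 1) * z"
      using 4 by (intro mult_right_mono powr_mono2) auto
    then have "z powr \<alpha> \<le> k powr (\<alpha> - 1) * z" using \<open>0 < z\<close> by (simp add: powr_diff)
    then show ?thesis using 4 by (intro pos)
  qed
qed

lemma overlap_ge_tilted: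
  assumes "dichotomy x y" "0 < t" "1 < k" "0 \<le> \<alpha>" "\<alpha> \<le> 1" "0 < h" "0 < h'"
  shows "tilt t \<alpha> x y - of_bool (0 < \<alpha>) * (k powr - h * tilt t (\<alpha> + h) x y)
      - of_bool (\<alpha> < 1) * (k powr - h' * tilt t (\<alpha> - h') x y) \<le> k * overlap t x y"
  using pair_sum_scaled_le[OF assms(1,2) min_ge_tilted[OF _ assms(3-)]]
  unfolding overlap_eq_scaled[OF assms(1,2)] tilt_eq_pair_sum[OF assms(1,2)]
  by (simp only: pair_sum_def right_diff_distrib sum_subtractf sum_distrib_left mult_ac)

lemma excess_ge_tilted:
  assumes "dichotomy x y" "0 < t" "1 < k" "1 \<le> \<alpha>" "0 < h" "0 < h'"
  shows "(1 - 1 / k) * (tilt t \<alpha> x y - of_bool (1 < \<alpha>) * (k powr - h * tilt t (\<alpha> + h) x y)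
      - k powr - h' * tilt t (\<alpha> - h') x y) \<le> k powr (\<alpha> - 1) * excess (t / k\<^sup>2) x y"
proof -
  define d where "d = 1 - 1 / k"
  have "excess (t / k\<^sup>2) x y = pair_sum (\<lambda>u v. t * v * max 0 (u / (t * v) - 1 / k\<^sup>2)) x y"
    using excess_eq_scaled[OF assms(1,2), of "1 / k\<^sup>2"] by simp
  then show ?thesis
    using pair_sum_scaled_le[OF assms(1,2) max_ge_tilted[OF _ assms(3-)]]
    unfolding tilt_eq_pair_sum[OF assms(1,2)] d_def[symmetric]
    by (simp only: pair_sum_def right_diff_distrib sum_subtractf sum_distrib_left mult_ac)
qed

section \<open>Exponential rates of tensor powers\<close>

lemma eventually_powers_le:
  fixes a b1 b2 c C :: real
  assumes "0 \<le> c" "c < a" "0 \<le> b1" "b1 < a" "0 \<le> b2" "b2 < a"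
  shows "\<forall>\<^sub>F n in sequentially. C * c ^ n + b1 ^ n + b2 ^ n \<le> a ^ n"
proof -
  have a: "0 < a" using assms by linarith
  have lim: "(\<lambda>n. (b / a) ^ n) \<longlonglongrightarrow> 0" if "0 \<le> b" "b < a" for b
    using that a by (intro LIMSEQ_realpow_zero) auto
  have "(\<lambda>n. C * (c / a) ^ n + (b1 / a) ^ n + (b2 / a) ^ n) \<longlonglongrightarrow> C * 0 + 0 + 0"
    using assms by (intro tendsto_intros lim)
  then have "\<forall>\<^sub>F n in sequentially. C * (c / a) ^ n + (b1 / a) ^ n + (b2 / a) ^ n < 1"
    by (rule order_tendstoD) simp
  then show ?thesis
  proof eventually_elim
    case (elim n)
    have "C * c ^ n + b1 ^ n + b2 ^ n = (C * (c / a) ^ n + (b1 / a) ^ n + (b2 / a) ^ n) * a ^ n"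
      using a by (simp add: power_divide field_simps)
    also have "\<dots> \<le> 1 * a ^ n" using elim a by (intro mult_right_mono) auto
    finally show ?case by simp
  qed
qed

text \<open>The derivative at h = 0 of the left-hand side is D - ln \<kappa> * f \<alpha>, which is
  negative. At a minimiser of \<open>tilt\<close> this supplies the exponent shift that makes the
  discarded upper tail exponentially smaller.\<close>

lemma decay_right:
  fixes f :: "real \<Rightarrow> real"
  assumes f: "(f has_real_derivative D) (at \<alpha>)" and "D \<le> 0" "0 < f \<alpha>" "1 < \<kappa>"
  shows "\<exists>h>0. \<kappa> powr - h * f (\<alpha> + h) < f \<alpha>"
proof -
  define g where "g h = \<kappa> powr - h * f (\<alpha> + h)" for h
  have fs: "((\<lambda>h. f (\<alpha> + h)) has_real_derivative D) (at 0)"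
    using f DERIV_shift[of f D 0 \<alpha>] by (simp add: add.commute)
  have "(g has_real_derivative (- ln \<kappa>) * f \<alpha> + D) (at 0)"
    unfolding g_def using assms(4)
    by (auto intro!: derivative_eq_intros fs)
  moreover have "(- ln \<kappa>) * f \<alpha> + D < 0"
    using mult_pos_pos[OF ln_gt_zero[OF assms(4)] assms(3)] assms(2) by simp
  ultimately obtain d where d: "0 < d" "\<And>h. 0 < h \<Longrightarrow> h < d \<Longrightarrow> g (0 + h) < g 0"
    using DERIV_neg_dec_right by metis
  have "g (0 + d / 2) < g 0" using d(1) by (intro d(2)) auto
  then show ?thesis using d(1) assms(4) by (intro exI[of _ "d / 2"]) (auto simp: g_def)
qed

lemma decay_left:
  fixes f :: "real \<Rightarrow> real"
  assumes f: "(f has_real_derivative D) (at \<alpha>)" and "0 \<le> D" "0 < f \<alpha>" "1 < \<kappa>"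
  shows "\<exists>h>0. \<kappa> powr - h * f (\<alpha> - h) < f \<alpha>"
proof -
  have "((\<lambda>x. f (- x)) has_real_derivative - D) (at (- \<alpha>))"
    using DERIV_mirror[of f D "- \<alpha>"] f by simp
  from decay_right[OF this, of \<kappa>] show ?thesis using assms by simp
qed

lemma derivative_at_minimum:
  fixes f :: "real \<Rightarrow> real"
  assumes f: "(f has_real_derivative D) (at \<alpha>)"
    and min: "\<And>\<beta>. \<beta> \<in> {a..b} \<Longrightarrow> f \<alpha> \<le> f \<beta>" and \<alpha>: "\<alpha> \<in> {a..b}"
  shows "a < \<alpha> \<Longrightarrow> D \<le> 0" and "\<alpha> < b \<Longrightarrow> 0 \<le> D"
proof -
  assume "a < \<alpha>"
  show "D \<le> 0"
  proof (rule ccontr)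
    assume "\<not> D \<le> 0"
    then obtain d where d: "0 < d" "\<And>h. 0 < h \<Longrightarrow> h < d \<Longrightarrow> f (\<alpha> - h) < f \<alpha>"
      using DERIV_pos_inc_left[OF f] by force
    define h where "h = min (d / 2) (\<alpha> - a)"
    have "0 < h" "h < d" "h \<le> \<alpha> - a" using d(1) \<open>a < \<alpha>\<close> by (auto simp: h_def)
    then show False using d(2)[of h] min[of "\<alpha> - h"] \<alpha> by auto
  qed
next
  assume "\<alpha> < b"
  show "0 \<le> D"
  proof (rule ccontr)
    assume "\<not> 0 \<le> D"
    then obtain d where d: "0 < d" "\<And>h. 0 < h \<Longrightarrow> h < d \<Longrightarrow> f (\<alpha> + h) < f \<alpha>"
      using DERIV_neg_dec_right[OF f] by force
    define h where "h = min (d / 2) (b - \<alpha>)"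
    have "0 < h" "h < d" "h \<le> b - \<alpha>" using d(1) \<open>\<alpha> < b\<close> by (auto simp: h_def)
    then show False using d(2)[of h] min[of "\<alpha> + h"] \<alpha> by auto
  qed
qed

lemma tilt_minimum:
  assumes "dichotomy x y" "0 < s" "a \<le> (b::real)"
  obtains \<alpha> where "\<alpha> \<in> {a..b}" "\<And>\<beta>. \<beta> \<in> {a..b} \<Longrightarrow> tilt s \<alpha> x y \<le> tilt s \<beta> x y"
  using continuous_attains_inf[of "{a..b}" "\<lambda>\<alpha>. tilt s \<alpha> x y"] continuous_on_tilt[OF assms(1,2)] assms(3)
  by (metis atLeastAtMost_iff compact_Icc empty_iff order_refl)

lemma exists_factor_above_1:
  fixes c V W a b :: real
  assumes "c < V" "1 < W"
  shows "\<exists>\<kappa>>1. c * \<kappa> powr a < V \<and> \<kappa> powr b < W"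
proof -
  have "((\<lambda>\<kappa>. c * \<kappa> powr a) \<longlongrightarrow> c * 1 powr a) (at_right 1)" "((\<lambda>\<kappa>::real. \<kappa> powr b) \<longlongrightarrow> 1 powr b) (at_right 1)"
    by (intro tendsto_intros; simp)+
  then have "\<forall>\<^sub>F \<kappa> in at_right 1. c * \<kappa> powr a < V" "\<forall>\<^sub>F \<kappa> in at_right 1. \<kappa> powr b < W"
    using assms by (auto elim!: order_tendstoD)
  moreover have "\<forall>\<^sub>F \<kappa>::real in at_right 1. 1 < \<kappa>" by (rule eventually_at_right_less)
  ultimately have "\<forall>\<^sub>F \<kappa> in at_right 1. 1 < \<kappa> \<and> c * \<kappa> powr a < V \<and> \<kappa> powr b < W"
    by eventually_elim simp
  then show ?thesis by (rule eventually_happens'[rotated]) simp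
qed

lemma of_bool_mult_power: "0 < n \<Longrightarrow> (of_bool b * a) ^ n = of_bool b * (a::real) ^ n"
  by (cases b) auto

text \<open>The cutoff is k = \<kappa>^n at the minimising order \<alpha>. Both discarded tails have
  rates below \<open>tilt s \<alpha> x y\<close>, and the factor \<kappa>^n lost in replacing the
  truncated sum by \<open>overlap\<close> is paid for by c * \<kappa> still being below that
  rate.\<close>

lemma overlap_rate:
  assumes xy: "dichotomy x y" and s: "0 < s"
    and V: "\<And>\<beta>. 0 \<le> \<beta> \<Longrightarrow> \<beta> \<le> 1 \<Longrightarrow> V \<le> tilt s \<beta> x y" and c: "0 \<le> c" "c < V"
  shows "\<forall>\<^sub>F n in sequentially. c ^ n \<le> overlap (s ^ n) (kron_pow x n) (kron_pow y n)"
proof -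
  let ?G = "\<lambda>\<alpha>. tilt s \<alpha> x y"
  obtain \<alpha> where \<alpha>: "\<alpha> \<in> {0..1}" and min: "\<And>\<beta>. \<beta> \<in> {0..1} \<Longrightarrow> ?G \<alpha> \<le> ?G \<beta>"
    using tilt_minimum[OF xy s, of 0 1] by auto
  have cG: "c < ?G \<alpha>" using V[of \<alpha>] \<alpha> c by auto
  obtain \<kappa> where \<kappa>: "1 < \<kappa>" "c * \<kappa> powr 1 < ?G \<alpha>"
    using exists_factor_above_1[OF cG, of 2 1 1] by auto
  note D = has_real_derivative_tilt[OF xy s, of \<alpha>]
  note pos = tilt_pos[OF xy s]
  obtain h where h: "0 < h" "0 < \<alpha> \<longrightarrow> \<kappa> powr - h * ?G (\<alpha> + h) < ?G \<alpha>"
  proof (cases "0 < \<alpha>")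
    case True
    then show ?thesis
      using decay_right[OF D derivative_at_minimum(1)[OF D min \<alpha>] pos \<kappa>(1)] that by blast
  next
    case False
    then show ?thesis using that[of 1] by simp
  qed
  obtain h' where h': "0 < h'" "\<alpha> < 1 \<longrightarrow> \<kappa> powr - h' * ?G (\<alpha> - h') < ?G \<alpha>"
  proof (cases "\<alpha> < 1")
    case True
    then show ?thesis
      using decay_left[OF D derivative_at_minimum(2)[OF D min \<alpha>] pos \<kappa>(1)] that by blast
  next
    case False
    then show ?thesis using that[of 1] by simp
  qed
  define b where "b = of_bool (0 < \<alpha>) * (\<kappa> powr - h * ?G (\<alpha> + h))"
  define b' where "b' = of_bool (\<alpha> < 1) * (\<kappa> powr - h' * ?G (\<alpha> - h'))"
  have b: "0 \<le> b" "b < ?G \<alpha>" "0 \<le> b'" "b' < ?G \<alpha>"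
    using h h' pos[of \<alpha>] pos[of "\<alpha> + h", THEN less_imp_le] pos[of "\<alpha> - h'", THEN less_imp_le]
    by (auto simp: b_def b'_def)
  have "\<forall>\<^sub>F n in sequentially. 1 * (c * \<kappa>) ^ n + b ^ n + b' ^ n \<le> ?G \<alpha> ^ n"
    using b c \<kappa> by (intro eventually_powers_le) auto
  then show ?thesis using eventually_gt_at_top[of 0]
  proof eventually_elim
    case (elim n)
    have sn: "0 < s ^ n" "1 < \<kappa> ^ n" using s \<kappa>(1) elim(2) by (auto simp: one_less_power)
    have bn: "b ^ n = of_bool (0 < \<alpha>) * ((\<kappa> ^ n) powr - h * ?G (\<alpha> + h) ^ n)"
      "b' ^ n = of_bool (\<alpha> < 1) * ((\<kappa> ^ n) powr - h' * ?G (\<alpha> - h') ^ n)"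
      unfolding b_def b'_def of_bool_mult_power[OF elim(2)]
      using \<kappa>(1) by (simp_all add: power_mult_distrib powr_power_swap)
    have "?G \<alpha> ^ n - b ^ n - b' ^ n \<le> \<kappa> ^ n * overlap (s ^ n) (kron_pow x n) (kron_pow y n)"
      using overlap_ge_tilted[OF dichotomy_kron_pow[OF xy] sn, of \<alpha> h h' n] \<alpha> h(1) h'(1)
      by (simp add: tilt_kron_pow[OF xy s] bn)
    then have "\<kappa> ^ n * c ^ n \<le> \<kappa> ^ n * overlap (s ^ n) (kron_pow x n) (kron_pow y n)"
      using elim(1) by (simp add: power_mult_distrib mult.commute)
    then show ?case using \<kappa>(1) by simp
  qed
qed

text \<open>The tilting is done at \<open>\<kappa>\<^sup>2 * s\<close> instead of \<open>s\<close>, so that the relevant outcomes have a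
  likelihood ratio well above the threshold.\<close>

lemma excess_rate:
  assumes xy: "dichotomy x y" and s: "0 < s" and K: "1 < K" "1 < tilt s K x y"
    and V: "\<And>\<beta>. 1 \<le> \<beta> \<Longrightarrow> \<beta> \<le> K \<Longrightarrow> V \<le> tilt s \<beta> x y" and c: "0 \<le> c" "c < V"
  shows "\<forall>\<^sub>F n in sequentially. c ^ n \<le> excess (s ^ n) (kron_pow x n) (kron_pow y n)"
proof -
  \<comment> \<open>In the exponent 3 * (K - 1), two parts pay for tilting at \<kappa>^2 * s and one
    for the factor \<kappa> powr (\<alpha> - 1) in front of \<open>excess\<close>. The last
    inequality keeps \<open>tilt\<close> above 1 at K after the shift.\<close>
  obtain \<kappa> where \<kappa>: "1 < \<kappa>" "c * \<kappa> powr (3 * (K - 1)) < V" "\<kappa> powr (2 * (K - 1)) < tilt s K x y"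
    using exists_factor_above_1[OF c(2) K(2)] by blast
  then have \<kappa>0: "0 < \<kappa>" by simp
  define r where "r = \<kappa>\<^sup>2 * s"
  have r: "0 < r" "r ^ n / (\<kappa> ^ n)\<^sup>2 = s ^ n" for n
    using s \<kappa>(1) by (auto simp: r_def power_mult_distrib power_divide power_even_eq power_mult[symmetric] mult.commute)
  let ?G = "\<lambda>\<alpha>. tilt r \<alpha> x y"
  have G: "?G \<beta> = \<kappa> powr (2 * (1 - \<beta>)) * tilt s \<beta> x y" for \<beta>
  proof -
    have "(\<kappa>\<^sup>2) powr (1 - \<beta>) = \<kappa> powr (2 * (1 - \<beta>))"
      using \<kappa>(1) by (simp add: powr_powr flip: powr_numeral)
    then show ?thesis using \<kappa>(1) s by (simp add: r_def tilt_rescale)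
  qed
  have GK: "1 < ?G K"
  proof -
    have "\<kappa> powr (2 * (1 - K)) * \<kappa> powr (2 * (K - 1)) = 1"
      using \<kappa>(1) by (simp flip: powr_add)
    moreover have "\<kappa> powr (2 * (1 - K)) * \<kappa> powr (2 * (K - 1)) < \<kappa> powr (2 * (1 - K)) * tilt s K x y"
      using \<kappa> by (intro mult_strict_left_mono) auto
    ultimately show ?thesis by (simp add: G)
  qed
  obtain \<alpha> where \<alpha>: "\<alpha> \<in> {1..K}" and min: "\<And>\<beta>. \<beta> \<in> {1..K} \<Longrightarrow> ?G \<alpha> \<le> ?G \<beta>"
    using tilt_minimum[OF xy r(1), of 1 K] K by auto
  \<comment> \<open>\<open>tilt\<close> is 1 at order 1 and exceeds 1 at K. Hence the minimiser is
    never the right end, and the lower tail can always be discarded.\<close>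
  have \<alpha>K: "\<alpha> < K"
    using min[of 1] GK tilt_1[OF xy r(1)] \<alpha> K by (cases "\<alpha> = K") auto
  have cG: "\<kappa> powr (\<alpha> - 1) * c < ?G \<alpha>"
  proof -
    have "\<kappa> powr (\<alpha> - 1) * c * \<kappa> powr (2 * (\<alpha> - 1)) = c * \<kappa> powr (3 * (\<alpha> - 1))"
      by (simp add: algebra_simps flip: powr_add)
    also have "\<dots> \<le> c * \<kappa> powr (3 * (K - 1))"
      using c(1) \<kappa>(1) \<alpha>K by (intro mult_left_mono powr_mono) auto
    also have "\<dots> < tilt s \<alpha> x y" using \<kappa>(2) V[of \<alpha>] \<alpha> by auto
    finally have "\<kappa> powr (\<alpha> - 1) * c * \<kappa> powr (2 * (\<alpha> - 1)) * \<kappa> powr (2 * (1 - \<alpha>)) < tilt s \<alpha> x y * \<kappa> powr (2 * (1 - \<alpha>))"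
      using \<kappa>(1) by (intro mult_strict_right_mono) auto
    moreover have "\<kappa> powr (2 * (\<alpha> - 1)) * \<kappa> powr (2 * (1 - \<alpha>)) = 1"
      using \<kappa>(1) by (simp flip: powr_add)
    ultimately show ?thesis by (simp add: G mult_ac)
  qed
  note D = has_real_derivative_tilt[OF xy r(1), of \<alpha>]
  note pos = tilt_pos[OF xy r(1)]
  obtain h where h: "0 < h" "1 < \<alpha> \<longrightarrow> \<kappa> powr - h * ?G (\<alpha> + h) < ?G \<alpha>"
  proof (cases "1 < \<alpha>")
    case True
    then show ?thesis
      using decay_right[OF D derivative_at_minimum(1)[OF D min \<alpha>] pos \<kappa>(1)] that by blast
  next
    case False
    then show ?thesis using that[of 1] by simp
  qed
  obtain h' where h': "0 < h'" "\<kappa> powr - h' * ?G (\<alpha> - h') < ?G \<alpha>"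
    using decay_left[OF D derivative_at_minimum(2)[OF D min \<alpha>] pos \<kappa>(1)] \<alpha>K by blast
  define b where "b = of_bool (1 < \<alpha>) * (\<kappa> powr - h * ?G (\<alpha> + h))"
  define b' where "b' = \<kappa> powr - h' * ?G (\<alpha> - h')"
  have b: "0 \<le> b" "b < ?G \<alpha>" "0 \<le> b'" "b' < ?G \<alpha>"
    using h h' pos[of \<alpha>] pos[of "\<alpha> + h", THEN less_imp_le] pos[of "\<alpha> - h'", THEN less_imp_le]
    by (auto simp: b_def b'_def)
  \<comment> \<open>The factor 2 makes up for 1 - 1 / \<kappa>^n, which exceeds 1/2 for large
    n.\<close>
  have "\<forall>\<^sub>F n in sequentially. 2 * (\<kappa> powr (\<alpha> - 1) * c) ^ n + b ^ n + b' ^ n \<le> ?G \<alpha> ^ n"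
    using b c cG by (intro eventually_powers_le) auto
  moreover have "\<forall>\<^sub>F n in sequentially. inverse (\<kappa> ^ n) < 1 / 2"
    using LIMSEQ_inverse_realpow_zero[OF \<kappa>(1)] by (rule order_tendstoD) simp
  ultimately show ?thesis using eventually_gt_at_top[of 0]
  proof eventually_elim
    case (elim n)
    let ?E = "excess (s ^ n) (kron_pow x n) (kron_pow y n)"
    have sn: "0 < r ^ n" "1 < \<kappa> ^ n" using r(1) \<kappa>(1) elim(3) by (auto simp: one_less_power)
    have bn: "b ^ n = of_bool (1 < \<alpha>) * ((\<kappa> ^ n) powr - h * ?G (\<alpha> + h) ^ n)"
      "b' ^ n = (\<kappa> ^ n) powr - h' * ?G (\<alpha> - h') ^ n"
      unfolding b_def b'_def of_bool_mult_power[OF elim(3)]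
      using \<kappa>(1) by (simp_all add: power_mult_distrib powr_power_swap)
    have "(1 - 1 / \<kappa> ^ n) * (?G \<alpha> ^ n - b ^ n - b' ^ n) \<le> (\<kappa> ^ n) powr (\<alpha> - 1) * ?E"
      using excess_ge_tilted[OF dichotomy_kron_pow[OF xy] sn, of \<alpha> h h' n] \<alpha> h(1) h'(1)
      by (simp add: tilt_kron_pow[OF xy r(1)] bn r(2))
    moreover have "1 / 2 \<le> 1 - 1 / \<kappa> ^ n" using elim(2) by (simp add: inverse_eq_divide)
    then have "1 / 2 * (2 * (\<kappa> powr (\<alpha> - 1) * c) ^ n) \<le> (1 - 1 / \<kappa> ^ n) * (?G \<alpha> ^ n - b ^ n - b' ^ n)"
      using elim(1) c(1) by (intro mult_mono) auto
    ultimately have "(\<kappa> powr (\<alpha> - 1)) ^ n * c ^ n \<le> (\<kappa> powr (\<alpha> - 1)) ^ n * ?E"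
      unfolding powr_power_swap[OF \<kappa>0] power_mult_distrib by linarith
    then show ?case using \<kappa>(1) by simp
  qed
qed

text \<open>The term of an index whose likelihood ratio exceeds s grows exponentially with the
  order. This yields a finite right end for minimising over orders above 1, and it detects the
  largest ratio, that is, the order \<infinity>.\<close>

lemma tilt_unbounded:
  assumes xy: "dichotomy x y" and s: "0 < s" and j: "j < dim_vec x" "s * y $ j < x $ j"
  shows "\<exists>K>1. 1 < tilt s K x y"
proof -
  have y: "0 < y $ j"
    using dichotomyD(3,4)[OF xy j(1)] j(2) by (cases "y $ j = 0") auto
  define c where "c = s * y $ j"
  have c: "0 < c" "c < x $ j" using y s j(2) by (auto simp: c_def)
  define r where "r = x $ j / c"
  have r: "1 < r" using c by (simp add: r_def)
  obtain n where "1 / c < r ^ n" using real_arch_pow[OF r] by blast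
  \<comment> \<open>The shift by 2 makes the order exceed 1.\<close>
  also have "r ^ n \<le> r ^ (n + 2)" using r by (intro power_increasing) auto
  finally have "c * (1 / c) < c * r ^ (n + 2)" using c(1) by (intro mult_strict_left_mono) auto
  then have "1 < c * (x $ j / c) powr real (n + 2)"
    using c(1) r powr_realpow[of r "n + 2"] by (simp add: r_def)
  also have "\<dots> \<le> tilt s (real (n + 2)) x y"
    unfolding tilt_eq_pair_sum[OF xy s] pair_sum_def c_def
    using j(1) s dichotomyD(3)[OF xy]
    by (intro member_le_sum[of j _ "\<lambda>i. s * y $ i * (x $ i / (s * y $ i)) powr real (n + 2)"]) auto
  finally show ?thesis by (intro exI[of _ "real (n + 2)"]) auto
qed

text \<open>Each summand is x_i times a non-negative power of a ratio that is at most 1. Together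
  with \<open>tilt_unbounded\<close> this characterises the largest likelihood ratio through
  \<open>tilt\<close> at large orders.\<close>

lemma tilt_le_1:
  assumes xy: "dichotomy x y" and s: "0 < s" and \<alpha>: "1 \<le> \<alpha>"
    and le: "\<And>i. i < dim_vec x \<Longrightarrow> x $ i \<le> s * y $ i"
  shows "tilt s \<alpha> x y \<le> 1"
  unfolding tilt_eq_pair_sum[OF xy s] pair_sum_def dichotomyD(5)[OF xy, symmetric]
proof (rule sum_mono)
  fix i assume "i \<in> {..<dim_vec x}"
  then have i: "i < dim_vec x" by simp
  show "s * y $ i * (x $ i / (s * y $ i)) powr \<alpha> \<le> x $ i"
  proof (cases "x $ i = 0")
    case False
    then have pos: "0 < x $ i" "0 < y $ i" using dichotomyD(2-4)[OF xy i] by force+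
    then have "(x $ i / (s * y $ i)) powr \<alpha> \<le> (x $ i / (s * y $ i)) powr 1"
      using \<alpha> s le[OF i] by (intro powr_mono') auto
    then have "s * y $ i * (x $ i / (s * y $ i)) powr \<alpha> \<le> s * y $ i * (x $ i / (s * y $ i))"
      using pos s by (intro mult_left_mono) auto
    then show ?thesis using pos s by simp
  qed simp
qed

text \<open>The minimiser \<alpha> of \<open>tilt s\<close> for q gives a lower rate for q, so one
  order in [0,1] at which p has a smaller value is enough. For \<alpha> < 1 it is \<alpha> itself.
  For \<alpha> = 1 the value to beat is 1, and orders slightly below 1 do so because
  \<open>ln s\<close> is below the relative entropy of p.\<close>

lemma overlap_local:
  assumes p: "dichotomy p1 p2" and q: "dichotomy q1 q2" and s: "0 < s"
    and lt: "\<And>\<alpha>. 0 \<le> \<alpha> \<Longrightarrow> \<alpha> < 1 \<Longrightarrow> renyi_sum \<alpha> p1 p2 < renyi_sum \<alpha> q1 q2"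
    and sp: "ln s < renyi_deriv 1 p1 p2"
  shows "\<exists>\<rho>>1. \<forall>\<^sub>F n in sequentially. \<forall>t. (s / \<rho>) ^ n \<le> t \<and> t \<le> (s * \<rho>) ^ n \<longrightarrow>
    overlap t (kron_pow p1 n) (kron_pow p2 n) \<le> overlap t (kron_pow q1 n) (kron_pow q2 n)"
proof -
  obtain \<alpha> where \<alpha>: "\<alpha> \<in> {0..1}" and min: "\<And>\<beta>. \<beta> \<in> {0..1} \<Longrightarrow> tilt s \<alpha> q1 q2 \<le> tilt s \<beta> q1 q2"
    using tilt_minimum[OF q s, of 0 1] by auto
  obtain \<beta> where \<beta>: "0 \<le> \<beta>" "\<beta> \<le> 1" "tilt s \<beta> p1 p2 < tilt s \<alpha> q1 q2"
  proof (cases "\<alpha> < 1")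
    case True
    then show ?thesis using that[of \<alpha>] lt[of \<alpha>] \<alpha> s by (simp add: tilt_def)
  next
    case False
    then have 1: "tilt s \<alpha> q1 q2 = 1" using \<alpha> tilt_1[OF q s] by simp
    have "0 < s powr (1 - 1) * (renyi_deriv 1 p1 p2 - ln s * renyi_sum 1 p1 p2)"
      using s sp by (simp add: renyi_sum_1[OF p])
    from DERIV_pos_inc_left[OF has_real_derivative_tilt[OF p s, of 1] this]
    obtain d where d: "0 < d" "\<And>h. 0 < h \<Longrightarrow> h < d \<Longrightarrow> tilt s (1 - h) p1 p2 < tilt s 1 p1 p2"
      by blast
    define h where "h = min (d / 2) 1"
    have "0 < h" "h < d" "h \<le> 1" using d(1) by (auto simp: h_def)
    then show ?thesis using that[of "1 - h"] d(2)[of h] 1 tilt_1[OF p s] by simp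
  qed
  define a where "a = tilt s \<beta> p1 p2"
  have a: "0 < a" using tilt_pos[OF p s] by (simp add: a_def)
  \<comment> \<open>One factor \<rho> pays for raising the threshold to s * \<rho> on the side of p,
    the other for lowering it to s / \<rho> on the side of q.\<close>
  obtain \<rho> where \<rho>: "1 < \<rho>" "a * \<rho> powr 2 < tilt s \<alpha> q1 q2"
  proof -
    have "a < tilt s \<alpha> q1 q2" "(1::real) < 2" using \<beta>(3) by (simp_all add: a_def)
    from exists_factor_above_1[OF this, of 2 2] show ?thesis using that by blast
  qed
  have "\<forall>\<^sub>F n in sequentially. (a * \<rho> powr 2) ^ n \<le> overlap (s ^ n) (kron_pow q1 n) (kron_pow q2 n)"
    using a \<rho> min by (intro overlap_rate[OF q s, where V = "tilt s \<alpha> q1 q2"]) auto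
  then have "\<forall>\<^sub>F n in sequentially. \<forall>t. (s / \<rho>) ^ n \<le> t \<and> t \<le> (s * \<rho>) ^ n \<longrightarrow>
    overlap t (kron_pow p1 n) (kron_pow p2 n) \<le> overlap t (kron_pow q1 n) (kron_pow q2 n)"
  proof (eventually_elim, intro allI impI)
    fix n t
    assume n: "(a * \<rho> powr 2) ^ n \<le> overlap (s ^ n) (kron_pow q1 n) (kron_pow q2 n)"
      and t: "(s / \<rho>) ^ n \<le> t \<and> t \<le> (s * \<rho>) ^ n"
    note dp = dichotomy_kron_pow[OF p, of n] and dq = dichotomy_kron_pow[OF q, of n]
    have s\<rho>: "0 < s * \<rho>" using s \<rho>(1) by simp
    have "overlap t (kron_pow p1 n) (kron_pow p2 n) \<le> overlap ((s * \<rho>) ^ n) (kron_pow p1 n) (kron_pow p2 n)"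
      using t by (intro overlap_mono[OF dp]) auto
    also have "\<dots> \<le> tilt ((s * \<rho>) ^ n) \<beta> (kron_pow p1 n) (kron_pow p2 n)"
      using s\<rho> \<beta> by (intro overlap_le_tilt[OF dp]) auto
    also have "\<dots> = (\<rho> powr (1 - \<beta>) * a) ^ n"
    proof -
      have "tilt (s * \<rho>) \<beta> p1 p2 = \<rho> powr (1 - \<beta>) * a"
        using tilt_rescale[OF s, of \<rho> \<beta> p1 p2] \<rho>(1) by (simp add: a_def mult.commute)
      then show ?thesis by (simp add: tilt_kron_pow[OF p s\<rho>])
    qed
    also have "\<dots> \<le> (\<rho> powr 1 * a) ^ n"
      using \<rho>(1) a \<beta> by (intro power_mono mult_right_mono powr_mono) auto
    also have "\<dots> = (1 / \<rho>) ^ n * (a * \<rho> powr 2) ^ n"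
      using \<rho>(1) by (simp add: power2_eq_square field_simps flip: power_mult_distrib)
    also have "\<dots> \<le> (1 / \<rho>) ^ n * overlap (s ^ n) (kron_pow q1 n) (kron_pow q2 n)"
      using n \<rho>(1) by (intro mult_left_mono) auto
    also have "\<dots> \<le> overlap ((1 / \<rho>) ^ n * s ^ n) (kron_pow q1 n) (kron_pow q2 n)"
      using \<rho>(1) by (intro overlap_scale[OF dq]) (auto intro: power_le_one)
    also have "\<dots> \<le> overlap t (kron_pow q1 n) (kron_pow q2 n)"
      using t by (intro overlap_mono[OF dq]) (simp add: power_divide)
    finally show "overlap t (kron_pow p1 n) (kron_pow p2 n) \<le> overlap t (kron_pow q1 n) (kron_pow q2 n)" .
  qed
  then show ?thesis using \<rho>(1) by blast
qed

text \<open>The mirror image with orders above 1 and the roles of p and q exchanged. Unlike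
  \<open>overlap\<close>, \<open>excess\<close> has no scaling estimate, as it vanishes beyond the
  largest ratio; so the lower bound for p is established directly at the upper end \<rho> * s of the
  window.\<close>

lemma excess_local:
  assumes p: "dichotomy p1 p2" and q: "dichotomy q1 q2" and s: "0 < s"
    and lt: "\<And>\<alpha>. 1 < \<alpha> \<Longrightarrow> renyi_sum \<alpha> q1 q2 < renyi_sum \<alpha> p1 p2"
    and sq: "renyi_deriv 1 q1 q2 < ln s"
    and j: "j < dim_vec p1" "s * p2 $ j < p1 $ j"
  shows "\<exists>\<rho>>1. \<forall>\<^sub>F n in sequentially. \<forall>t. (s / \<rho>) ^ n \<le> t \<and> t \<le> (s * \<rho>) ^ n \<longrightarrow>
    excess t (kron_pow q1 n) (kron_pow q2 n) \<le> excess t (kron_pow p1 n) (kron_pow p2 n)"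
proof -
  obtain K where K: "1 < K" "1 < tilt s K p1 p2" using tilt_unbounded[OF p s j] by blast
  obtain \<alpha> where \<alpha>: "\<alpha> \<in> {1..K}" and min: "\<And>\<beta>. \<beta> \<in> {1..K} \<Longrightarrow> tilt s \<alpha> p1 p2 \<le> tilt s \<beta> p1 p2"
    using tilt_minimum[OF p s, of 1 K] K by auto
  obtain \<beta> where \<beta>: "1 \<le> \<beta>" "tilt s \<beta> q1 q2 < tilt s \<alpha> p1 p2"
  proof (cases "1 < \<alpha>")
    case True
    then show ?thesis using that[of \<alpha>] lt[of \<alpha>] s by (simp add: tilt_def)
  next
    case False
    then have 1: "tilt s \<alpha> p1 p2 = 1" using \<alpha> tilt_1[OF p s] by simp
    have "s powr (1 - 1) * (renyi_deriv 1 q1 q2 - ln s * renyi_sum 1 q1 q2) < 0"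
      using s sq by (simp add: renyi_sum_1[OF q])
    from DERIV_neg_dec_right[OF has_real_derivative_tilt[OF q s, of 1] this]
    obtain d where d: "0 < d" "\<And>h. 0 < h \<Longrightarrow> h < d \<Longrightarrow> tilt s (1 + h) q1 q2 < tilt s 1 q1 q2"
      by blast
    then show ?thesis using that[of "1 + d / 2"] d(2)[of "d / 2"] 1 tilt_1[OF q s] by simp
  qed
  define a where "a = tilt s \<beta> q1 q2"
  have a: "0 < a" using tilt_pos[OF q s] by (simp add: a_def)
  \<comment> \<open>\<beta> - 1 pays for evaluating q at s / \<rho>, and K - 1 for evaluating p at
    \<rho> * s with orders up to K. The third inequality keeps \<open>tilt\<close> of p above 1 at
    order K there.\<close>
  obtain \<rho> where \<rho>: "1 < \<rho>" "a * \<rho> powr ((\<beta> - 1) + (K - 1)) < tilt s \<alpha> p1 p2" "\<rho> powr (K - 1) < tilt s K p1 p2"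
    using exists_factor_above_1[OF \<beta>(2) K(2)] by (auto simp: a_def)
  have inv: "\<rho> powr (1 - K) * \<rho> powr (K - 1) = 1" using \<rho>(1) by (simp flip: powr_add)
  have s\<rho>: "0 < \<rho> * s" "0 < 1 / \<rho> * s" using s \<rho>(1) by auto
  have tilt_p: "tilt (\<rho> * s) \<gamma> p1 p2 = \<rho> powr (1 - \<gamma>) * tilt s \<gamma> p1 p2" for \<gamma>
    using tilt_rescale[OF s, of \<rho>] \<rho>(1) by simp
  have "\<forall>\<^sub>F n in sequentially. (\<rho> powr (\<beta> - 1) * a) ^ n \<le> excess ((\<rho> * s) ^ n) (kron_pow p1 n) (kron_pow p2 n)"
  proof (rule excess_rate[OF p s\<rho>(1) K(1), where V = "\<rho> powr (1 - K) * tilt s \<alpha> p1 p2"])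
    have "\<rho> powr (1 - K) * \<rho> powr (K - 1) < \<rho> powr (1 - K) * tilt s K p1 p2"
      using \<rho> by (intro mult_strict_left_mono) auto
    then show "1 < tilt (\<rho> * s) K p1 p2" by (simp add: tilt_p inv)
  next
    fix \<gamma> assume \<gamma>: "1 \<le> \<gamma>" "\<gamma> \<le> K"
    show "\<rho> powr (1 - K) * tilt s \<alpha> p1 p2 \<le> tilt (\<rho> * s) \<gamma> p1 p2"
      unfolding tilt_p using \<gamma> \<rho>(1) min[of \<gamma>] tilt_pos[OF p s, of \<alpha>]
      by (intro mult_mono powr_mono) auto
  next
    have "\<rho> powr (1 - K) * (a * \<rho> powr ((\<beta> - 1) + (K - 1))) < \<rho> powr (1 - K) * tilt s \<alpha> p1 p2"
      using \<rho> by (intro mult_strict_left_mono) auto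
    moreover have "\<rho> powr (1 - K) * (a * \<rho> powr ((\<beta> - 1) + (K - 1))) = \<rho> powr (\<beta> - 1) * a"
    proof -
      have "\<rho> powr (1 - K) * \<rho> powr ((\<beta> - 1) + (K - 1)) = \<rho> powr (\<beta> - 1)" by (simp flip: powr_add)
      then show ?thesis by (metis mult.assoc mult.commute)
    qed
    ultimately show "\<rho> powr (\<beta> - 1) * a < \<rho> powr (1 - K) * tilt s \<alpha> p1 p2" by (simp only:)
  qed (use a in simp)
  then have "\<forall>\<^sub>F n in sequentially. \<forall>t. (s / \<rho>) ^ n \<le> t \<and> t \<le> (s * \<rho>) ^ n \<longrightarrow>
    excess t (kron_pow q1 n) (kron_pow q2 n) \<le> excess t (kron_pow p1 n) (kron_pow p2 n)"
  proof (eventually_elim, intro allI impI)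
    fix n t
    assume n: "(\<rho> powr (\<beta> - 1) * a) ^ n \<le> excess ((\<rho> * s) ^ n) (kron_pow p1 n) (kron_pow p2 n)"
      and t: "(s / \<rho>) ^ n \<le> t \<and> t \<le> (s * \<rho>) ^ n"
    note dp = dichotomy_kron_pow[OF p, of n] and dq = dichotomy_kron_pow[OF q, of n]
    have "excess t (kron_pow q1 n) (kron_pow q2 n) \<le> excess ((1 / \<rho> * s) ^ n) (kron_pow q1 n) (kron_pow q2 n)"
      using t by (intro excess_antimono[OF dq]) auto
    also have "\<dots> \<le> tilt ((1 / \<rho> * s) ^ n) \<beta> (kron_pow q1 n) (kron_pow q2 n)"
      using s\<rho>(2) \<beta>(1) by (intro excess_le_tilt[OF dq]) auto
    also have "\<dots> = (\<rho> powr (\<beta> - 1) * a) ^ n"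
    proof -
      have "(1 / \<rho>) powr (1 - \<beta>) = \<rho> powr (\<beta> - 1)"
        using \<rho>(1) powr_minus_divide[of \<rho> "1 - \<beta>"] by (simp add: powr_divide)
      then show ?thesis
        using tilt_rescale[OF s, of "1 / \<rho>" \<beta> q1 q2] \<rho>(1)
        unfolding tilt_kron_pow[OF q s\<rho>(2)] a_def by simp
    qed
    also note n
    also have "excess ((\<rho> * s) ^ n) (kron_pow p1 n) (kron_pow p2 n) \<le> excess t (kron_pow p1 n) (kron_pow p2 n)"
      using t by (intro excess_antimono[OF dp]) (simp add: mult.commute)
    finally show "excess t (kron_pow q1 n) (kron_pow q2 n) \<le> excess t (kron_pow p1 n) (kron_pow p2 n)" .
  qed
  then show ?thesis using \<rho>(1) by blast
qed

section \<open>Uniformity in the threshold\<close>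

lemma kron_pow_ratio_le:
  assumes "dim_vec x = dim_vec y" "0 \<le> c"
    and "\<And>i. i < dim_vec x \<Longrightarrow> 0 \<le> x $ i \<and> x $ i \<le> c * y $ i"
  shows "i < dim_vec x ^ n \<Longrightarrow> 0 \<le> kron_pow x n $ i \<and> kron_pow x n $ i \<le> c ^ n * kron_pow y n $ i"
proof (induction n arbitrary: i)
  case (Suc n)
  let ?a = "i div dim_vec x" and ?b = "i mod dim_vec x"
  have i: "i < dim_vec x ^ n * dim_vec x" using Suc.prems by (simp add: mult.commute)
  note a = Suc.IH[OF div_less_of_mult[OF i]] and b = assms(3)[OF mod_less_of_mult[OF i]]
  have "kron_pow x n $ ?a * x $ ?b \<le> (c ^ n * kron_pow y n $ ?a) * (c * y $ ?b)"
    using a b by (intro mult_mono) auto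
  then show ?case using a b i assms(1) by (simp add: kron_vec_def mult_ac)
qed simp

lemma excess_below_ratios:
  assumes xy: "dichotomy x y" and le: "\<And>i. i < dim_vec x \<Longrightarrow> t * y $ i \<le> x $ i"
  shows "excess t x y = 1 - t"
proof -
  have "excess t x y = (\<Sum>i<dim_vec x. x $ i - t * y $ i)"
    unfolding excess_def pair_sum_def using le by (intro sum.cong refl) auto
  then show ?thesis using dichotomyD(5,6)[OF xy] by (simp add: sum_subtractf flip: sum_distrib_left)
qed

lemma excess_ge:
  assumes xy: "dichotomy x y"
  shows "1 - t \<le> excess t x y"
proof -
  have "(\<Sum>i<dim_vec x. x $ i - t * y $ i) \<le> excess t x y"
    unfolding excess_def pair_sum_def by (intro sum_mono) auto
  then show ?thesis using dichotomyD(5,6)[OF xy] by (simp add: sum_subtractf flip: sum_distrib_left)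
qed

lemma excess_above_ratios:
  assumes "\<And>i. i < dim_vec x \<Longrightarrow> x $ i \<le> t * y $ i"
  shows "excess t x y = 0"
  unfolding excess_def pair_sum_def using assms by (intro sum.neutral) auto

lemma excess_nonneg: "0 \<le> excess t x y"
  unfolding excess_def pair_sum_def by (intro sum_nonneg) auto

text \<open>\<open>full\<close> makes the smallest likelihood ratio m of q positive, so [m,M] is a
  compact range of positive thresholds; \<open>inf\<close> puts a ratio of p beyond the largest
  ratio M of q, as the comparison through \<open>excess\<close> requires. Outside [m^n, M^n] q has
  its least possible value, 1 - t or 0.\<close>

lemma eventually_excess_le:
  assumes p: "dichotomy p1 p2" and q: "dichotomy q1 q2"
    and full: "\<And>i. i < dim_vec q1 \<Longrightarrow> q2 $ i \<noteq> 0 \<Longrightarrow> q1 $ i \<noteq> 0"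
    and lt1: "\<And>\<alpha>. 0 \<le> \<alpha> \<Longrightarrow> \<alpha> < 1 \<Longrightarrow> renyi_sum \<alpha> p1 p2 < renyi_sum \<alpha> q1 q2"
    and gt1: "\<And>\<alpha>. 1 < \<alpha> \<Longrightarrow> renyi_sum \<alpha> q1 q2 < renyi_sum \<alpha> p1 p2"
    and eq1: "renyi_deriv 1 q1 q2 < renyi_deriv 1 p1 p2"
    and inf: "\<And>i. i < dim_vec q1 \<Longrightarrow> q2 $ i \<noteq> 0 \<Longrightarrow> \<exists>j<dim_vec p1. q1 $ i / q2 $ i * p2 $ j < p1 $ j"
  shows "\<forall>\<^sub>F n in sequentially. \<forall>t\<ge>0.
    excess t (kron_pow q1 n) (kron_pow q2 n) \<le> excess t (kron_pow p1 n) (kron_pow p2 n)"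
proof -
  define R where "R = (\<lambda>i. q1 $ i / q2 $ i) ` {i. i < dim_vec q1 \<and> q2 $ i \<noteq> 0}"
  define m where "m = Min R"
  define M where "M = Max R"
  have fin: "finite R" by (simp add: R_def)
  have ne: "R \<noteq> {}"
  proof -
    obtain i where "i < dim_vec q1" "q2 $ i \<noteq> 0"
      using dichotomyD(6)[OF q] by (metis lessThan_iff sum.neutral zero_neq_one)
    then show ?thesis by (auto simp: R_def)
  qed
  have Rpos: "0 < r" if "r \<in> R" for r
    using that full dichotomyD(2,3)[OF q] by (fastforce simp: R_def less_le)
  have mM: "m \<in> R" "M \<in> R" "0 < m" "m \<le> M" "0 < M"
    using fin ne Rpos Min_in[OF fin ne] Max_in[OF fin ne] Max_ge[OF fin] by (auto simp: m_def M_def)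
  have lower: "0 \<le> q2 $ i \<and> q2 $ i \<le> 1 / m * q1 $ i" if i: "i < dim_vec q1" for i
  proof (cases "q2 $ i = 0")
    case False
    then have "m \<le> q1 $ i / q2 $ i" using i fin unfolding m_def R_def by (intro Min_le) auto
    then show ?thesis using mM(3) dichotomyD(3)[OF q i] False by (simp add: field_simps)
  qed (use dichotomyD(2)[OF q i] mM(3) in auto)
  have upper: "0 \<le> q1 $ i \<and> q1 $ i \<le> M * q2 $ i" if i: "i < dim_vec q1" for i
  proof (cases "q2 $ i = 0")
    case False
    then have "q1 $ i / q2 $ i \<le> M" using i fin unfolding M_def R_def by (intro Max_ge) auto
    then show ?thesis using dichotomyD(2,3)[OF q i] False by (simp add: field_simps)
  qed (use dichotomyD(4)[OF q i] in auto)
  obtain j where j: "j < dim_vec p1" "M * p2 $ j < p1 $ j"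
  proof -
    obtain i where i: "i < dim_vec q1" "q2 $ i \<noteq> 0" "M = q1 $ i / q2 $ i" using mM(2) by (auto simp: R_def)
    show ?thesis using inf[OF i(1,2)] that unfolding i(3) by blast
  qed
  define Q where "Q \<rho> s n \<longleftrightarrow> (\<forall>t. (s / \<rho>) ^ n \<le> t \<and> t \<le> (s * \<rho>) ^ n \<longrightarrow>
    excess t (kron_pow q1 n) (kron_pow q2 n) \<le> excess t (kron_pow p1 n) (kron_pow p2 n))" for \<rho> s :: real and n
  have "\<exists>\<rho>>1. \<forall>\<^sub>F n in sequentially. Q \<rho> s n" if s: "s \<in> {m..M}" for s
  proof -
    have s0: "0 < s" using s mM(3) by auto
    show ?thesis
    proof (cases "ln s < renyi_deriv 1 p1 p2")
      case True
      show ?thesis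
        using overlap_local[OF p q s0 lt1 True]
        by (simp add: Q_def excess_eq_overlap[OF dichotomy_kron_pow[OF p]] excess_eq_overlap[OF dichotomy_kron_pow[OF q]])
    next
      case False
      have "s * p2 $ j \<le> M * p2 $ j"
        using s dichotomyD(3)[OF p j(1)] by (intro mult_right_mono) auto
      then show ?thesis
        using excess_local[OF p q s0 gt1 _ j(1)] j(2) False eq1 by (simp add: Q_def)
    qed
  qed
  then obtain \<rho> where \<rho>: "\<And>s. s \<in> {m..M} \<Longrightarrow> 1 < \<rho> s"
    "\<And>s. s \<in> {m..M} \<Longrightarrow> \<forall>\<^sub>F n in sequentially. Q (\<rho> s) s n"
    by metis
  have "{m..M} \<subseteq> (\<Union>s\<in>{m..M}. {s / \<rho> s<..<s * \<rho> s})"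
  proof
    fix s assume s: "s \<in> {m..M}"
    then have "s \<in> {s / \<rho> s<..<s * \<rho> s}" using \<rho>(1)[OF s] mM(3) by (auto simp: field_simps)
    then show "s \<in> (\<Union>s\<in>{m..M}. {s / \<rho> s<..<s * \<rho> s})" using s by blast
  qed
  then obtain C where C: "C \<subseteq> {m..M}" "finite C" "{m..M} \<subseteq> (\<Union>s\<in>C. {s / \<rho> s<..<s * \<rho> s})"
    using compactE_image[of "{m..M}" "{m..M}" "\<lambda>s. {s / \<rho> s<..<s * \<rho> s}"] by auto
  have "\<forall>\<^sub>F n in sequentially. \<forall>s\<in>C. Q (\<rho> s) s n"
    using C(1,2) \<rho>(2) by (intro eventually_ball_finite) auto
  then show ?thesis using eventually_gt_at_top[of 0]
  proof (eventually_elim, intro allI impI)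
    fix n :: nat and t :: real
    assume Q: "\<forall>s\<in>C. Q (\<rho> s) s n" and n: "0 < n" and t: "0 \<le> t"
    note dp = dichotomy_kron_pow[OF p, of n] and dq = dichotomy_kron_pow[OF q, of n]
    note dim = dichotomyD(1)[OF q]
    consider "t < m ^ n" | "M ^ n < t" | "m ^ n \<le> t" "t \<le> M ^ n" by linarith
    then show "excess t (kron_pow q1 n) (kron_pow q2 n) \<le> excess t (kron_pow p1 n) (kron_pow p2 n)"
    proof cases
      case 1
      have "t * kron_pow q2 n $ i \<le> kron_pow q1 n $ i" if i: "i < dim_vec (kron_pow q1 n)" for i
      proof -
        have r: "0 \<le> kron_pow q2 n $ i \<and> kron_pow q2 n $ i \<le> (1 / m) ^ n * kron_pow q1 n $ i"
          using kron_pow_ratio_le[of q2 q1 "1 / m" i n] lower mM(3) i dim by simp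
        then have "t * kron_pow q2 n $ i \<le> m ^ n * kron_pow q2 n $ i"
          using 1 by (intro mult_right_mono) auto
        also have "\<dots> \<le> m ^ n * ((1 / m) ^ n * kron_pow q1 n $ i)"
          using r mM(3) by (intro mult_left_mono) auto
        also have "\<dots> = kron_pow q1 n $ i" using mM(3) by (simp add: power_divide)
        finally show ?thesis .
      qed
      then show ?thesis using excess_below_ratios[OF dq] excess_ge[OF dp] by simp
    next
      case 2
      have "kron_pow q1 n $ i \<le> t * kron_pow q2 n $ i" if i: "i < dim_vec (kron_pow q1 n)" for i
      proof -
        have "kron_pow q1 n $ i \<le> M ^ n * kron_pow q2 n $ i"
          using kron_pow_ratio_le[of q1 q2 M i n] upper mM(5) i dim by simp
        also have "\<dots> \<le> t * kron_pow q2 n $ i"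
          using 2 dichotomyD(3)[OF dq i] by (intro mult_right_mono) auto
        finally show ?thesis .
      qed
      then show ?thesis using excess_above_ratios excess_nonneg by metis
    next
      case 3
      define s where "s = root n t"
      have s: "s ^ n = t" "0 \<le> s" using n t by (auto simp: s_def)
      have "s \<in> {m..M}"
        using 3 n mM(3,5) s power_le_imp_le_base[of m "n - 1" s] power_le_imp_le_base[of s "n - 1" M] by auto
      then obtain s' where s': "s' \<in> C" "s' / \<rho> s' < s" "s < s' * \<rho> s'" using C(3) by auto
      have "0 < s' / \<rho> s'" using s'(1) C(1) mM(3) \<rho>(1)[of s'] by force
      then have "(s' / \<rho> s') ^ n \<le> t \<and> t \<le> (s' * \<rho> s') ^ n"
        using s s' by (auto simp flip: s(1) intro!: power_mono)
      then show ?thesis using Q s'(1) by (auto simp: Q_def)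
    qed
  qed
qed

section \<open>Data processing\<close>

lemma powr_perspective_scale:
  assumes "0 \<le> c" "0 \<le> u" "0 \<le> (v::real)"
  shows "(c * u) powr \<alpha> * (c * v) powr (1 - \<alpha>) = c * (u powr \<alpha> * v powr (1 - \<alpha>))"
proof -
  have "c powr \<alpha> * c powr (1 - \<alpha>) = c"
    using assms(1) by (cases "c = 0") (auto simp flip: powr_add)
  then show ?thesis using assms by (simp add: powr_mult)
qed

lemma holder_concave:
  fixes a b :: "'i \<Rightarrow> real"
  assumes fin: "finite A" and a: "\<And>i. i \<in> A \<Longrightarrow> 0 \<le> a i" and b: "\<And>i. i \<in> A \<Longrightarrow> 0 \<le> b i"
    and \<alpha>: "0 \<le> \<alpha>" "\<alpha> \<le> 1"
  shows "(\<Sum>i\<in>A. a i powr \<alpha> * b i powr (1 - \<alpha>)) \<le> sum a A powr \<alpha> * sum b A powr (1 - \<alpha>)"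
proof (cases "sum a A = 0 \<or> sum b A = 0")
  case True
  then have "(\<forall>i\<in>A. a i = 0) \<or> (\<forall>i\<in>A. b i = 0)"
    using a b fin by (auto simp: sum_nonneg_eq_0_iff)
  then have "(\<Sum>i\<in>A. a i powr \<alpha> * b i powr (1 - \<alpha>)) = 0" by (intro sum.neutral) auto
  then show ?thesis by simp
next
  case False
  define S where "S = sum a A"
  define T where "T = sum b A"
  have pos: "0 < S" "0 < T" using False a b by (auto simp: S_def T_def less_le intro!: sum_nonneg)
  have "a i powr \<alpha> * b i powr (1 - \<alpha>) \<le> S powr \<alpha> * T powr (1 - \<alpha>) * (\<alpha> * (a i / S) + (1 - \<alpha>) * (b i / T))"
    if i: "i \<in> A" for i
  proof (cases "a i = 0 \<or> b i = 0")
    case True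
    have "0 \<le> \<alpha> * (a i / S) + (1 - \<alpha>) * (b i / T)"
      using \<alpha> a[OF i] b[OF i] pos by (intro add_nonneg_nonneg mult_nonneg_nonneg) auto
    then have "0 \<le> S powr \<alpha> * T powr (1 - \<alpha>) * (\<alpha> * (a i / S) + (1 - \<alpha>) * (b i / T))"
      by (intro mult_nonneg_nonneg) auto
    moreover have "a i powr \<alpha> * b i powr (1 - \<alpha>) = 0" using True by auto
    ultimately show ?thesis by (simp only:)
  next
    case False
    then have "0 < a i" "0 < b i" using a[OF i] b[OF i] by auto
    then have "(a i / S) powr \<alpha> * (b i / T) powr (1 - \<alpha>) \<le> \<alpha> * (a i / S) + (1 - \<alpha>) * (b i / T)"
      using \<alpha> pos by (intro Youngs_inequality_0) auto
    then have "S powr \<alpha> * T powr (1 - \<alpha>) * ((a i / S) powr \<alpha> * (b i / T) powr (1 - \<alpha>))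
        \<le> S powr \<alpha> * T powr (1 - \<alpha>) * (\<alpha> * (a i / S) + (1 - \<alpha>) * (b i / T))"
      by (intro mult_left_mono) auto
    then show ?thesis using pos \<open>0 < a i\<close> \<open>0 < b i\<close> by (simp add: powr_divide)
  qed
  then have "(\<Sum>i\<in>A. a i powr \<alpha> * b i powr (1 - \<alpha>))
      \<le> (\<Sum>i\<in>A. S powr \<alpha> * T powr (1 - \<alpha>) * (\<alpha> * (a i / S) + (1 - \<alpha>) * (b i / T)))"
    by (rule sum_mono)
  also have "\<dots> = S powr \<alpha> * T powr (1 - \<alpha>) * (\<alpha> * (sum a A / S) + (1 - \<alpha>) * (sum b A / T))"
    by (simp only: sum_distrib_left sum_divide_distrib sum.distrib distrib_left)
  also have "\<dots> = S powr \<alpha> * T powr (1 - \<alpha>)" using pos by (simp flip: S_def T_def)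
  finally show ?thesis by (simp add: S_def T_def)
qed

text \<open>The tangent of z^\<alpha> at z = 1 lies below the graph. It comes from Young's
  inequality with weight 1 / \<alpha> applied to the numbers z^\<alpha> and 1.\<close>

lemma bernoulli_powr:
  fixes z :: real
  assumes "0 \<le> z" "1 \<le> \<alpha>"
  shows "\<alpha> * z + (1 - \<alpha>) \<le> z powr \<alpha>"
proof (cases "z = 0")
  case False
  then have "(z powr \<alpha>) powr (1 / \<alpha>) * 1 powr (1 - 1 / \<alpha>) \<le> 1 / \<alpha> * (z powr \<alpha>) + (1 - 1 / \<alpha>) * 1"
    using assms by (intro Youngs_inequality_0) auto
  then have "z \<le> 1 / \<alpha> * z powr \<alpha> + (1 - 1 / \<alpha>)"
    using assms by (simp add: powr_powr)
  then have "\<alpha> * z \<le> \<alpha> * (1 / \<alpha> * z powr \<alpha> + (1 - 1 / \<alpha>))"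
    using assms by (intro mult_left_mono) auto
  then show ?thesis using assms by (simp add: algebra_simps)
qed (use assms in auto)

text \<open>Bernoulli's inequality for the ratios of the normalised families, weighted by the
  normalised b and summed. The hypothesis on zeros matters because \<open>powr\<close> would turn an
  infinite term into 0.\<close>

lemma holder_convex:
  fixes a b :: "'i \<Rightarrow> real"
  assumes fin: "finite A" and a: "\<And>i. i \<in> A \<Longrightarrow> 0 \<le> a i" and b: "\<And>i. i \<in> A \<Longrightarrow> 0 \<le> b i"
    and ab: "\<And>i. i \<in> A \<Longrightarrow> b i = 0 \<Longrightarrow> a i = 0" and \<alpha>: "1 \<le> \<alpha>"
  shows "sum a A powr \<alpha> * sum b A powr (1 - \<alpha>) \<le> (\<Sum>i\<in>A. a i powr \<alpha> * b i powr (1 - \<alpha>))"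
proof (cases "sum a A = 0")
  case True
  then show ?thesis by (simp add: sum_nonneg)
next
  case False
  define S where "S = sum a A"
  define T where "T = sum b A"
  have S: "0 < S" using False a by (auto simp: S_def less_le intro!: sum_nonneg)
  have "T \<noteq> 0"
  proof
    assume "T = 0"
    then have "\<forall>i\<in>A. b i = 0" using b fin by (simp add: T_def sum_nonneg_eq_0_iff)
    then have "\<forall>i\<in>A. a i = 0" using ab by blast
    then show False using False by simp
  qed
  then have T: "0 < T" using b by (auto simp: T_def less_le intro!: sum_nonneg)
  have "S powr \<alpha> * T powr (1 - \<alpha>) * (\<alpha> * (a i / S) + (1 - \<alpha>) * (b i / T)) \<le> a i powr \<alpha> * b i powr (1 - \<alpha>)"
    if i: "i \<in> A" for i
  proof (cases "b i = 0")
    case True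
    then show ?thesis using ab[OF i] by simp
  next
    case False
    define u where "u = a i / S"
    define v where "v = b i / T"
    have u: "0 \<le> u" and v: "0 < v" using False a[OF i] b[OF i] S T by (auto simp: u_def v_def)
    have "v * (\<alpha> * (u / v) + (1 - \<alpha>)) \<le> v * (u / v) powr \<alpha>"
      using u v \<alpha> by (intro mult_left_mono bernoulli_powr) auto
    then have "\<alpha> * u + (1 - \<alpha>) * v \<le> u powr \<alpha> * v powr (1 - \<alpha>)"
      unfolding powr_perspective[OF u v] using v by (simp add: algebra_simps)
    then have "S powr \<alpha> * T powr (1 - \<alpha>) * (\<alpha> * u + (1 - \<alpha>) * v)
       \<le> S powr \<alpha> * T powr (1 - \<alpha>) * (u powr \<alpha> * v powr (1 - \<alpha>))"
      by (intro mult_left_mono) auto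
    also have "\<dots> = a i powr \<alpha> * b i powr (1 - \<alpha>)"
      using S T a[OF i] b[OF i] by (simp add: u_def v_def powr_divide)
    finally show ?thesis by (simp add: u_def v_def)
  qed
  then have "(\<Sum>i\<in>A. S powr \<alpha> * T powr (1 - \<alpha>) * (\<alpha> * (a i / S) + (1 - \<alpha>) * (b i / T)))
      \<le> (\<Sum>i\<in>A. a i powr \<alpha> * b i powr (1 - \<alpha>))"
    by (rule sum_mono)
  moreover have "(\<Sum>i\<in>A. S powr \<alpha> * T powr (1 - \<alpha>) * (\<alpha> * (a i / S) + (1 - \<alpha>) * (b i / T)))
      = S powr \<alpha> * T powr (1 - \<alpha>) * (\<alpha> * (sum a A / S) + (1 - \<alpha>) * (sum b A / T))"
    by (simp only: sum_distrib_left sum_divide_distrib sum.distrib distrib_left)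
  moreover have "\<alpha> * (sum a A / S) + (1 - \<alpha>) * (sum b A / T) = 1" using S T by (simp flip: S_def T_def)
  ultimately show ?thesis unfolding S_def[symmetric] T_def[symmetric] by (simp only: mult_1_right)
qed

lemma holder_concave2:
  fixes a b c d :: real
  assumes "0 \<le> a" "0 \<le> b" "0 \<le> c" "0 \<le> d" "0 \<le> \<alpha>" "\<alpha> \<le> 1"
  shows "a powr \<alpha> * b powr (1 - \<alpha>) + c powr \<alpha> * d powr (1 - \<alpha>) \<le> (a + c) powr \<alpha> * (b + d) powr (1 - \<alpha>)"
proof -
  have "(\<Sum>k\<in>{True, False}. (if k then a else c) powr \<alpha> * (if k then b else d) powr (1 - \<alpha>)) \<le>
    (\<Sum>k\<in>{True, False}. if k then a else c) powr \<alpha> * (\<Sum>k\<in>{True, False}. if k then b else d) powr (1 - \<alpha>)"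
    using assms by (intro holder_concave) simp_all
  then show ?thesis by simp
qed

lemma holder_convex2:
  fixes a b c d :: real
  assumes "0 \<le> a" "0 \<le> b" "0 \<le> c" "0 \<le> d" "b = 0 \<Longrightarrow> a = 0" "d = 0 \<Longrightarrow> c = 0" "1 \<le> \<alpha>"
  shows "(a + c) powr \<alpha> * (b + d) powr (1 - \<alpha>) \<le> a powr \<alpha> * b powr (1 - \<alpha>) + c powr \<alpha> * d powr (1 - \<alpha>)"
proof -
  have "(\<Sum>k\<in>{True, False}. if k then a else c) powr \<alpha> * (\<Sum>k\<in>{True, False}. if k then b else d) powr (1 - \<alpha>)
    \<le> (\<Sum>k\<in>{True, False}. (if k then a else c) powr \<alpha> * (if k then b else d) powr (1 - \<alpha>))"
    using assms by (intro holder_convex) (auto split: if_splits)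
  then show ?thesis by simp
qed

lemma maps_vec_entry:
  assumes "maps_vec T x y" "j < dim_vec y"
  shows "y $ j = (\<Sum>i<dim_vec x. T $$ (j, i) * x $ i)"
proof -
  have T: "T \<in> carrier_mat (dim_vec y) (dim_vec x)" and y: "y = T *\<^sub>v x"
    using assms(1) by (auto simp: maps_vec_def)
  have "(T *\<^sub>v x) $ j = (\<Sum>i<dim_vec x. T $$ (j, i) * x $ i)"
    using T assms(2) by (simp add: scalar_prod_def atLeast0LessThan)
  then show ?thesis by (simp only: y[symmetric])
qed

context
  fixes T :: "real mat" and x1 x2 y1 y2 :: "real vec"
  assumes T: "stochastic_mat T" and x: "dichotomy x1 x2"
    and m1: "maps_vec T x1 y1" and m2: "maps_vec T x2 y2"
begin

lemma mapping_dims: "dim_row T = dim_vec y1" "dim_col T = dim_vec x1" "dim_vec y2 = dim_vec y1" "dim_vec x2 = dim_vec x1"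
  using m1 m2 dichotomyD(1)[OF x] unfolding maps_vec_def carrier_mat_def by simp_all

lemma mapping_nonneg: "j < dim_vec y1 \<Longrightarrow> i < dim_vec x1 \<Longrightarrow> 0 \<le> T $$ (j, i)"
  using T by (simp add: stochastic_mat_def mapping_dims)

lemma mapping_column_sum: "i < dim_vec x1 \<Longrightarrow> (\<Sum>j<dim_vec y1. T $$ (j, i)) = 1"
  using T by (simp add: stochastic_mat_def mapping_dims)

text \<open>The easy half of Blackwell's theorem, from convexity of the hinge and unit column sums.
  It recovers the order of \<open>excess\<close> from a given map, which the passage from powers to
  the catalyst needs.\<close>

lemma excess_data_processing: "excess t y1 y2 \<le> excess t x1 x2"
proof -
  have "excess t y1 y2 \<le> (\<Sum>j<dim_vec y1. \<Sum>i<dim_vec x1. T $$ (j, i) * max 0 (x1 $ i - t * x2 $ i))"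
    unfolding excess_def pair_sum_def
  proof (rule sum_mono)
    fix j assume "j \<in> {..<dim_vec y1}"
    then have j: "j < dim_vec y1" by simp
    have "y1 $ j - t * y2 $ j = (\<Sum>i<dim_vec x1. T $$ (j, i) * (x1 $ i - t * x2 $ i))"
      using maps_vec_entry[OF m1 j] maps_vec_entry[OF m2, of j] j
      by (simp add: mapping_dims right_diff_distrib sum_subtractf sum_distrib_left mult.left_commute)
    also have "\<dots> \<le> (\<Sum>i<dim_vec x1. T $$ (j, i) * max 0 (x1 $ i - t * x2 $ i))"
      using mapping_nonneg[OF j] by (intro sum_mono mult_left_mono) auto
    finally show "max 0 (y1 $ j - t * y2 $ j) \<le> (\<Sum>i<dim_vec x1. T $$ (j, i) * max 0 (x1 $ i - t * x2 $ i))"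
      using mapping_nonneg[OF j] by (auto intro!: sum_nonneg)
  qed
  also have "\<dots> = (\<Sum>i<dim_vec x1. (\<Sum>j<dim_vec y1. T $$ (j, i)) * max 0 (x1 $ i - t * x2 $ i))"
    by (subst sum.swap) (simp add: sum_distrib_right)
  also have "\<dots> = excess t x1 x2" by (simp add: mapping_column_sum excess_def pair_sum_def)
  finally show ?thesis .
qed

text \<open>The double sum is the Renyi sum of the joint law of input and output, whose likelihood
  ratios are those of the input alone. Data processing is then Hoelder over the inputs for each
  fixed output.\<close>

lemma renyi_sum_mix:
  "(\<Sum>j<dim_vec y1. \<Sum>i<dim_vec x1. (T $$ (j, i) * x1 $ i) powr \<alpha> * (T $$ (j, i) * x2 $ i) powr (1 - \<alpha>)) = renyi_sum \<alpha> x1 x2"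
proof -
  have "(T $$ (j, i) * x1 $ i) powr \<alpha> * (T $$ (j, i) * x2 $ i) powr (1 - \<alpha>) = T $$ (j, i) * ((x1 $ i) powr \<alpha> * (x2 $ i) powr (1 - \<alpha>))"
    if "j < dim_vec y1" "i < dim_vec x1" for i j
    using mapping_nonneg[OF that] dichotomyD(2,3)[OF x that(2)] by (rule powr_perspective_scale)
  then have "(\<Sum>j<dim_vec y1. \<Sum>i<dim_vec x1. (T $$ (j, i) * x1 $ i) powr \<alpha> * (T $$ (j, i) * x2 $ i) powr (1 - \<alpha>)) =
      (\<Sum>j<dim_vec y1. \<Sum>i<dim_vec x1. T $$ (j, i) * ((x1 $ i) powr \<alpha> * (x2 $ i) powr (1 - \<alpha>)))"
    by simp
  also have "\<dots> = (\<Sum>i<dim_vec x1. (\<Sum>j<dim_vec y1. T $$ (j, i)) * ((x1 $ i) powr \<alpha> * (x2 $ i) powr (1 - \<alpha>)))"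
    by (subst sum.swap) (simp add: sum_distrib_right)
  finally show ?thesis by (simp add: mapping_column_sum renyi_sum_def pair_sum_def)
qed

lemma renyi_sum_data_processing_concave:
  assumes "0 \<le> \<alpha>" "\<alpha> \<le> 1"
  shows "renyi_sum \<alpha> x1 x2 \<le> renyi_sum \<alpha> y1 y2"
  unfolding renyi_sum_mix[symmetric] unfolding renyi_sum_def pair_sum_def
proof (rule sum_mono)
  fix j assume "j \<in> {..<dim_vec y1}"
  then have j: "j < dim_vec y1" by simp
  show "(\<Sum>i<dim_vec x1. (T $$ (j, i) * x1 $ i) powr \<alpha> * (T $$ (j, i) * x2 $ i) powr (1 - \<alpha>))
      \<le> (y1 $ j) powr \<alpha> * (y2 $ j) powr (1 - \<alpha>)"
    using maps_vec_entry[OF m1 j] maps_vec_entry[OF m2, of j] j assms mapping_nonneg[OF j] dichotomyD(2,3)[OF x]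
      holder_concave[of "{..<dim_vec x1}" "\<lambda>i. T $$ (j, i) * x1 $ i" "\<lambda>i. T $$ (j, i) * x2 $ i" \<alpha>]
    by (simp add: mapping_dims)
qed

lemma renyi_sum_data_processing_convex:
  assumes "1 \<le> \<alpha>"
  shows "renyi_sum \<alpha> y1 y2 \<le> renyi_sum \<alpha> x1 x2"
  unfolding renyi_sum_mix[symmetric] unfolding renyi_sum_def pair_sum_def
proof (rule sum_mono)
  fix j assume "j \<in> {..<dim_vec y1}"
  then have j: "j < dim_vec y1" by simp
  show "(y1 $ j) powr \<alpha> * (y2 $ j) powr (1 - \<alpha>)
     \<le> (\<Sum>i<dim_vec x1. (T $$ (j, i) * x1 $ i) powr \<alpha> * (T $$ (j, i) * x2 $ i) powr (1 - \<alpha>))"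
  proof -
    have "y1 $ j = (\<Sum>i<dim_vec x1. T $$ (j, i) * x1 $ i)" "y2 $ j = (\<Sum>i<dim_vec x1. T $$ (j, i) * x2 $ i)"
      using maps_vec_entry[OF m1 j] maps_vec_entry[OF m2, of j] j by (simp_all add: mapping_dims)
    then show ?thesis
      using assms mapping_nonneg[OF j] dichotomyD(2-4)[OF x] by (auto intro!: holder_convex)
  qed
qed

end

section \<open>Renyi divergences and power sums\<close>

definition renyi_dominates :: "real vec \<Rightarrow> real vec \<Rightarrow> real vec \<Rightarrow> real vec \<Rightarrow> bool" where
  "renyi_dominates p1 p2 q1 q2 \<longleftrightarrow>
     (\<forall>\<alpha>. 0 < \<alpha> \<longrightarrow> \<alpha> < 1 \<longrightarrow> renyi_sum \<alpha> p1 p2 \<le> renyi_sum \<alpha> q1 q2) \<and>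
     (\<forall>\<alpha>>1. renyi_sum \<alpha> q1 q2 \<le> renyi_sum \<alpha> p1 p2)"

lemma sum_supp_vec:
  assumes "\<And>i. i < dim_vec x \<Longrightarrow> x $ i = 0 \<Longrightarrow> f (x $ i) (y $ i) = (0::real)"
  shows "(\<Sum>i\<in>supp_vec x. f (x $ i) (y $ i)) = pair_sum f x y"
  unfolding pair_sum_def using assms by (intro sum.mono_neutral_left) (auto simp: supp_vec_def)

lemma renyi_div_real:
  assumes "\<alpha> \<noteq> 1"
  shows "renyi_div (ereal \<alpha>) x y = 1 / (\<alpha> - 1) * ln (renyi_sum \<alpha> x y)"
  using assms sum_supp_vec[of x "\<lambda>u v. u powr \<alpha> * v powr (1 - \<alpha>)" y]
  by (simp add: renyi_div_def renyi_sum_def one_ereal_def)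

lemma renyi_div_1:
  assumes xy: "dichotomy x y"
  shows "renyi_div 1 x y = renyi_deriv 1 x y"
proof -
  have "renyi_div 1 x y = pair_sum (\<lambda>u v. u * ln (u / v)) x y"
    using sum_supp_vec[of x "\<lambda>u v. u * ln (u / v)" y] by (simp add: renyi_div_def)
  also have "\<dots> = renyi_deriv 1 x y"
    unfolding renyi_deriv_def
  proof (rule pair_sum_cong)
    fix i assume i: "i < dim_vec x"
    show "x $ i * ln (x $ i / y $ i) = (x $ i) powr 1 * (y $ i) powr (1 - 1) * ln (x $ i / y $ i)"
      using dichotomyD(2-4)[OF xy i] by (cases "y $ i = 0") auto
  qed
  finally show ?thesis .
qed

text \<open>With M the largest ratio of p, \<open>tilt M\<close> of p stays at most 1 at all orders
  above 1. A larger ratio of q would push \<open>tilt M\<close> of q above 1 at some order, against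
  domination.\<close>

lemma renyi_div_infinity_le:
  assumes p: "dichotomy p1 p2" and q: "dichotomy q1 q2" and dom: "renyi_dominates p1 p2 q1 q2"
  shows "renyi_div \<infinity> q1 q2 \<le> renyi_div \<infinity> p1 p2"
proof -
  let ?L = "\<lambda>x y. (\<lambda>i. ln (x $ i / y $ i)) ` supp_vec x"
  have fin: "finite (?L x y)" for x y by (simp add: supp_vec_def)
  have ne: "supp_vec x \<noteq> {}" if "dichotomy x y" for x y
    using dichotomyD(5)[OF that] by (force simp: supp_vec_def intro: sum.neutral)
  define M where "M = exp (Max (?L p1 p2))"
  have M: "0 < M" by (simp add: M_def)
  have le: "p1 $ i \<le> M * p2 $ i" if i: "i < dim_vec p1" for i
  proof (cases "p1 $ i = 0")
    case False
    then have pos: "0 < p1 $ i" "0 < p2 $ i" using dichotomyD(2-4)[OF p i] by force+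
    have "ln (p1 $ i / p2 $ i) \<le> Max (?L p1 p2)"
      using fin i False by (intro Max_ge) (auto simp: supp_vec_def)
    then have "exp (ln (p1 $ i / p2 $ i)) \<le> M" unfolding M_def by simp
    then show ?thesis using pos by (simp add: field_simps)
  qed (use dichotomyD(3)[OF p i] M in simp)
  have "ln (q1 $ i / q2 $ i) \<le> Max (?L p1 p2)" if i: "i \<in> supp_vec q1" for i
  proof (rule ccontr)
    assume gt: "\<not> ln (q1 $ i / q2 $ i) \<le> Max (?L p1 p2)"
    have i': "i < dim_vec q1" "q1 $ i \<noteq> 0" using i by (auto simp: supp_vec_def)
    then have pos: "0 < q1 $ i" "0 < q2 $ i" using dichotomyD(2-4)[OF q i'(1)] by force+
    have "M < exp (ln (q1 $ i / q2 $ i))" using gt by (simp add: M_def)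
    then have "M * q2 $ i < q1 $ i" using pos by (simp add: field_simps)
    then obtain K where K: "1 < K" "1 < tilt M K q1 q2" using tilt_unbounded[OF q M i'(1)] by blast
    have "tilt M K q1 q2 \<le> tilt M K p1 p2"
      using dom K(1) by (simp add: renyi_dominates_def tilt_def mult_left_mono)
    also have "\<dots> \<le> 1" using K(1) le by (intro tilt_le_1[OF p M]) auto
    finally show False using K(2) by simp
  qed
  then show ?thesis
    using fin ne[OF q] by (auto simp: renyi_div_def)
qed

text \<open>Both sides of the hypothesis equal 1 at \<alpha> = 1, so it can be differentiated there
  from the right. The factor c = 1 gives the order of relative entropies; c = 1 - \<delta> gives the
  strict gap after mixing.\<close>

lemma renyi_deriv_le:
  assumes p: "dichotomy p1 p2" and q: "dichotomy q1 q2"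
    and le: "\<And>\<alpha>. 1 < \<alpha> \<Longrightarrow> renyi_sum \<alpha> q1 q2 \<le> c * renyi_sum \<alpha> p1 p2 + (1 - c)"
  shows "renyi_deriv 1 q1 q2 \<le> c * renyi_deriv 1 p1 p2"
proof (rule ccontr)
  assume "\<not> ?thesis"
  then have "c * renyi_deriv 1 p1 p2 - renyi_deriv 1 q1 q2 < 0" by simp
  moreover have "((\<lambda>\<alpha>. c * renyi_sum \<alpha> p1 p2 - renyi_sum \<alpha> q1 q2) has_real_derivative
     c * renyi_deriv 1 p1 p2 - renyi_deriv 1 q1 q2) (at 1)"
    by (auto intro!: derivative_eq_intros has_real_derivative_renyi_sum p q)
  ultimately obtain d where d: "0 < d" "\<And>h. 0 < h \<Longrightarrow> h < d \<Longrightarrow>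
      c * renyi_sum (1 + h) p1 p2 - renyi_sum (1 + h) q1 q2 < c * renyi_sum 1 p1 p2 - renyi_sum 1 q1 q2"
    using DERIV_neg_dec_right by blast
  have h: "0 < d / 2" "d / 2 < d" "1 < 1 + d / 2" using d(1) by auto
  show False using d(2)[OF h(1,2)] le[OF h(3)] unfolding renyi_sum_1[OF p] renyi_sum_1[OF q] by linarith
qed

lemma renyi_div_le_iff:
  assumes p: "dichotomy p1 p2" and q: "dichotomy q1 q2"
  shows "(\<forall>\<alpha>::ereal. 0 < \<alpha> \<longrightarrow> renyi_div \<alpha> p1 p2 \<ge> renyi_div \<alpha> q1 q2) \<longleftrightarrow> renyi_dominates p1 p2 q1 q2"
proof -
  note pos = renyi_sum_pos[OF p] renyi_sum_pos[OF q]
  have lt1: "renyi_div (ereal \<alpha>) q1 q2 \<le> renyi_div (ereal \<alpha>) p1 p2 \<longleftrightarrow> renyi_sum \<alpha> p1 p2 \<le> renyi_sum \<alpha> q1 q2"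
    if "\<alpha> < 1" for \<alpha>
    using that pos[of \<alpha>] by (simp add: renyi_div_real divide_le_cancel)
  have gt1: "renyi_div (ereal \<alpha>) q1 q2 \<le> renyi_div (ereal \<alpha>) p1 p2 \<longleftrightarrow> renyi_sum \<alpha> q1 q2 \<le> renyi_sum \<alpha> p1 p2"
    if "1 < \<alpha>" for \<alpha>
    using that pos[of \<alpha>] by (simp add: renyi_div_real divide_le_cancel)
  show ?thesis
  proof
    assume i: "\<forall>\<alpha>::ereal. 0 < \<alpha> \<longrightarrow> renyi_div \<alpha> p1 p2 \<ge> renyi_div \<alpha> q1 q2"
    have "renyi_div (ereal \<alpha>) q1 q2 \<le> renyi_div (ereal \<alpha>) p1 p2" if "0 < \<alpha>" for \<alpha> using i that by simp
    note i' = this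
    show "renyi_dominates p1 p2 q1 q2"
      unfolding renyi_dominates_def
    proof (intro conjI allI impI)
      show "renyi_sum \<alpha> p1 p2 \<le> renyi_sum \<alpha> q1 q2" if "0 < \<alpha>" "\<alpha> < 1" for \<alpha>
        using i'[OF that(1)] lt1[OF that(2)] by blast
      show "renyi_sum \<alpha> q1 q2 \<le> renyi_sum \<alpha> p1 p2" if "1 < \<alpha>" for \<alpha>
        using i'[of \<alpha>] gt1[OF that] that by simp
    qed
  next
    assume dom: "renyi_dominates p1 p2 q1 q2"
    have 1: "renyi_deriv 1 q1 q2 \<le> renyi_deriv 1 p1 p2"
      using renyi_deriv_le[OF p q, of 1] dom by (simp add: renyi_dominates_def)
    show "\<forall>\<alpha>::ereal. 0 < \<alpha> \<longrightarrow> renyi_div \<alpha> p1 p2 \<ge> renyi_div \<alpha> q1 q2"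
    proof (intro allI impI)
      fix \<alpha> :: ereal assume "0 < \<alpha>"
      then consider "\<alpha> = \<infinity>" | "\<alpha> = 1" | a where "\<alpha> = ereal a" "0 < a" "a < 1" | a where "\<alpha> = ereal a" "1 < a"
        by (cases \<alpha>) (auto simp: one_ereal_def, metis linorder_cases)
      then show "renyi_div \<alpha> p1 p2 \<ge> renyi_div \<alpha> q1 q2"
        using renyi_div_infinity_le[OF p q dom] 1 lt1 gt1 dom
        by cases (auto simp: renyi_div_1[OF p] renyi_div_1[OF q] renyi_dominates_def)
    qed
  qed
qed

section \<open>Strictness by mixing\<close>

text \<open>Always paired with the same y as second vector, so that y against itself, with all
  ratios equal to 1, is what gets mixed in.\<close>

definition mixture :: "real \<Rightarrow> real vec \<Rightarrow> real vec \<Rightarrow> real vec" where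
  "mixture \<delta> x y = vec (dim_vec x) (\<lambda>i. (1 - \<delta>) * x $ i + \<delta> * y $ i)"

lemma dim_mixture [simp]: "dim_vec (mixture \<delta> x y) = dim_vec x"
  by (simp add: mixture_def)

lemma index_mixture [simp]: "i < dim_vec x \<Longrightarrow> mixture \<delta> x y $ i = (1 - \<delta>) * x $ i + \<delta> * y $ i"
  by (simp add: mixture_def)

lemma dichotomy_mixture:
  assumes xy: "dichotomy x y" and \<delta>: "0 \<le> \<delta>" "\<delta> \<le> 1"
  shows "dichotomy (mixture \<delta> x y) y"
proof -
  have "(\<Sum>i<dim_vec x. (1 - \<delta>) * x $ i + \<delta> * y $ i) = 1"
    using dichotomyD(5,6)[OF xy] by (simp add: sum.distrib flip: sum_distrib_left)
  then show ?thesis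
    using \<delta> dichotomyD[OF xy] by (auto simp: dichotomy_iff pair_sum_def)
qed

lemma l1_dist_mixture:
  assumes xy: "dichotomy x y" and \<delta>: "0 \<le> \<delta>"
  shows "l1_dist x (mixture \<delta> x y) \<le> 2 * \<delta>"
proof -
  have "l1_dist x (mixture \<delta> x y) = (\<Sum>i<dim_vec x. \<bar>\<delta> * (x $ i - y $ i)\<bar>)"
    by (simp add: l1_dist_def pad_vec_def algebra_simps)
  also have "\<dots> \<le> (\<Sum>i<dim_vec x. \<delta> * (x $ i + y $ i))"
  proof (rule sum_mono)
    fix i assume "i \<in> {..<dim_vec x}"
    then have "\<bar>x $ i - y $ i\<bar> \<le> x $ i + y $ i" using dichotomyD(2,3)[OF xy, of i] by auto
    then show "\<bar>\<delta> * (x $ i - y $ i)\<bar> \<le> \<delta> * (x $ i + y $ i)"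
      using \<delta> by (simp add: abs_mult mult_left_mono)
  qed
  also have "\<dots> = 2 * \<delta>"
    using dichotomyD(5,6)[OF xy] by (simp add: sum.distrib flip: sum_distrib_left)
  finally show ?thesis .
qed

text \<open>The summand is jointly convex and homogeneous in both entries. Splitting the second
  entry as (1 - \<delta>) v + \<delta> v separates off the Renyi sum of y against itself, which is
  1; hence the additive \<delta>.\<close>

lemma renyi_sum_mixture_convex:
  assumes xy: "dichotomy x y" and \<delta>: "0 \<le> \<delta>" "\<delta> \<le> 1" and \<alpha>: "1 \<le> \<alpha>"
  shows "renyi_sum \<alpha> (mixture \<delta> x y) y \<le> (1 - \<delta>) * renyi_sum \<alpha> x y + \<delta>"
proof -
  have "renyi_sum \<alpha> (mixture \<delta> x y) y \<le> (\<Sum>i<dim_vec x. (1 - \<delta>) * ((x $ i) powr \<alpha> * (y $ i) powr (1 - \<alpha>)) + \<delta> * y $ i)"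
    unfolding renyi_sum_def pair_sum_def dim_mixture
  proof (rule sum_mono)
    fix i assume "i \<in> {..<dim_vec x}"
    then have i: "i < dim_vec x" by simp
    let ?u = "x $ i" and ?v = "y $ i"
    have uv: "0 \<le> ?u" "0 \<le> ?v" "?v = 0 \<longrightarrow> ?u = 0" using dichotomyD(2-4)[OF xy i] by auto
    have vv: "?v powr \<alpha> * ?v powr (1 - \<alpha>) = ?v"
      using uv(2) by (cases "?v = 0") (auto simp flip: powr_add)
    have "((1 - \<delta>) * ?u + \<delta> * ?v) powr \<alpha> * ((1 - \<delta>) * ?v + \<delta> * ?v) powr (1 - \<alpha>) \<le>
      ((1 - \<delta>) * ?u) powr \<alpha> * ((1 - \<delta>) * ?v) powr (1 - \<alpha>) + (\<delta> * ?v) powr \<alpha> * (\<delta> * ?v) powr (1 - \<alpha>)"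
      using uv \<delta> \<alpha> by (intro holder_convex2) auto
    then show "(mixture \<delta> x y $ i) powr \<alpha> * ?v powr (1 - \<alpha>) \<le> (1 - \<delta>) * (?u powr \<alpha> * ?v powr (1 - \<alpha>)) + \<delta> * ?v"
      using uv \<delta> vv i by (simp add: powr_perspective_scale flip: distrib_right)
  qed
  then show ?thesis
    using dichotomyD(6)[OF xy]
    by (simp add: renyi_sum_def pair_sum_def sum.distrib flip: sum_distrib_left)
qed

lemma renyi_sum_mixture_concave:
  assumes xy: "dichotomy x y" and \<delta>: "0 \<le> \<delta>" "\<delta> \<le> 1" and \<alpha>: "0 \<le> \<alpha>" "\<alpha> \<le> 1"
  shows "(1 - \<delta>) * renyi_sum \<alpha> x y + \<delta> \<le> renyi_sum \<alpha> (mixture \<delta> x y) y"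
proof -
  have "(\<Sum>i<dim_vec x. (1 - \<delta>) * ((x $ i) powr \<alpha> * (y $ i) powr (1 - \<alpha>)) + \<delta> * y $ i) \<le> renyi_sum \<alpha> (mixture \<delta> x y) y"
    unfolding renyi_sum_def pair_sum_def dim_mixture
  proof (rule sum_mono)
    fix i assume "i \<in> {..<dim_vec x}"
    then have i: "i < dim_vec x" by simp
    let ?u = "x $ i" and ?v = "y $ i"
    have uv: "0 \<le> ?u" "0 \<le> ?v" using dichotomyD(2,3)[OF xy i] by auto
    have vv: "?v powr \<alpha> * ?v powr (1 - \<alpha>) = ?v"
      using uv(2) by (cases "?v = 0") (auto simp flip: powr_add)
    have "((1 - \<delta>) * ?u) powr \<alpha> * ((1 - \<delta>) * ?v) powr (1 - \<alpha>) + (\<delta> * ?v) powr \<alpha> * (\<delta> * ?v) powr (1 - \<alpha>)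
      \<le> ((1 - \<delta>) * ?u + \<delta> * ?v) powr \<alpha> * ((1 - \<delta>) * ?v + \<delta> * ?v) powr (1 - \<alpha>)"
      using uv \<delta> \<alpha> by (intro holder_concave2) auto
    then show "(1 - \<delta>) * (?u powr \<alpha> * ?v powr (1 - \<alpha>)) + \<delta> * ?v \<le> (mixture \<delta> x y $ i) powr \<alpha> * ?v powr (1 - \<alpha>)"
      using uv \<delta> vv i by (simp add: powr_perspective_scale flip: distrib_right)
  qed
  then show ?thesis
    using dichotomyD(6)[OF xy]
    by (simp add: renyi_sum_def pair_sum_def sum.distrib flip: sum_distrib_left)
qed

lemma renyi_sum_0_full_support:
  assumes xy: "dichotomy x y" and full: "\<And>i. i < dim_vec x \<Longrightarrow> y $ i \<noteq> 0 \<Longrightarrow> x $ i \<noteq> 0"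
  shows "renyi_sum 0 x y = 1"
proof -
  have "renyi_sum 0 x y = (\<Sum>i<dim_vec x. y $ i)"
    unfolding renyi_sum_def pair_sum_def
  proof (rule sum.cong [OF refl])
    fix i assume "i \<in> {..<dim_vec x}"
    then have i: "i < dim_vec x" by simp
    show "(x $ i) powr 0 * (y $ i) powr (1 - 0) = y $ i"
      using full[OF i] dichotomyD(3)[OF xy i] by (cases "y $ i = 0") auto
  qed
  then show ?thesis using dichotomyD(6)[OF xy] by simp
qed

text \<open>The one-point pair \<open>(1, m)\<close> with \<open>m\<close> the mass of \<open>p2\<close> on the support of \<open>p1\<close> bounds
  \<open>(p1, p2)\<close> from below; \<open>m < 1\<close> is the source of all strict inequalities.\<close>

context
  fixes p1 p2 :: "real vec"
  assumes p: "dichotomy p1 p2" and strict: "supp_vec p1 \<subset> supp_vec p2"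
begin

lemma supp_mass: "0 < (\<Sum>i\<in>supp_vec p1. p2 $ i)" "(\<Sum>i\<in>supp_vec p1. p2 $ i) < 1"
proof -
  have fin: "finite (supp_vec x)" for x by (simp add: supp_vec_def)
  have pos: "0 < p2 $ i" if "i \<in> supp_vec p2" for i
    using that dichotomyD(1)[OF p] dichotomyD(3)[OF p, of i] by (auto simp: supp_vec_def)
  have "supp_vec p1 \<noteq> {}"
    using dichotomyD(5)[OF p] by (force simp: supp_vec_def intro: sum.neutral)
  then show "0 < (\<Sum>i\<in>supp_vec p1. p2 $ i)"
    using strict pos fin by (intro sum_pos) auto
  obtain k where k: "k \<in> supp_vec p2" "k \<notin> supp_vec p1" using strict by blast
  have "(\<Sum>i\<in>supp_vec p1. p2 $ i) < (\<Sum>i\<in>supp_vec p2. p2 $ i)"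
    using strict k pos fin less_imp_le[OF pos] by (intro sum_strict_mono2[of _ _ k]) auto
  also have "\<dots> = (\<Sum>i<dim_vec p1. p2 $ i)"
    using dichotomyD(1)[OF p] by (intro sum.mono_neutral_left) (auto simp: supp_vec_def)
  finally show "(\<Sum>i\<in>supp_vec p1. p2 $ i) < 1" using dichotomyD(6)[OF p] by simp
qed

lemma sum_fst_supp: "(\<Sum>i\<in>supp_vec p1. p1 $ i) = 1"
  using sum_supp_vec[of p1 "\<lambda>u v. u" p1] dichotomyD(5)[OF p] by (simp add: pair_sum_def)

lemma renyi_sum_supp: "renyi_sum \<alpha> p1 p2 = (\<Sum>i\<in>supp_vec p1. (p1 $ i) powr \<alpha> * (p2 $ i) powr (1 - \<alpha>))"
  unfolding renyi_sum_def by (rule sum_supp_vec[symmetric]) simp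

lemma supp_entries: "i \<in> supp_vec p1 \<Longrightarrow> 0 \<le> p1 $ i \<and> 0 < p2 $ i"
  using dichotomyD(2-4)[OF p, of i] by (force simp: supp_vec_def)

lemma renyi_sum_less_1:
  assumes "0 \<le> \<alpha>" "\<alpha> < 1"
  shows "renyi_sum \<alpha> p1 p2 < 1"
proof -
  have "renyi_sum \<alpha> p1 p2 \<le> (\<Sum>i\<in>supp_vec p1. p1 $ i) powr \<alpha> * (\<Sum>i\<in>supp_vec p1. p2 $ i) powr (1 - \<alpha>)"
    unfolding renyi_sum_supp using assms supp_entries less_imp_le
    by (intro holder_concave) (auto simp: supp_vec_def)
  also have "\<dots> < 1"
    using powr_less_mono2[of "1 - \<alpha>" "\<Sum>i\<in>supp_vec p1. p2 $ i" 1] supp_mass assms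
    by (simp add: sum_fst_supp)
  finally show ?thesis .
qed

lemma supp_mass_powr_le_renyi_sum:
  assumes "1 \<le> \<alpha>"
  shows "(\<Sum>i\<in>supp_vec p1. p2 $ i) powr (1 - \<alpha>) \<le> renyi_sum \<alpha> p1 p2"
proof -
  have "(\<Sum>i\<in>supp_vec p1. p1 $ i) powr \<alpha> * (\<Sum>i\<in>supp_vec p1. p2 $ i) powr (1 - \<alpha>) \<le> renyi_sum \<alpha> p1 p2"
    unfolding renyi_sum_supp
  proof (rule holder_convex[OF _ _ _ _ assms])
    show "finite (supp_vec p1)" by (simp add: supp_vec_def)
  qed (use supp_entries in force)+
  then show ?thesis by (simp add: sum_fst_supp)
qed

lemma renyi_sum_greater_1:
  assumes "1 < \<alpha>"
  shows "1 < renyi_sum \<alpha> p1 p2"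
  using supp_mass_powr_le_renyi_sum[of \<alpha>] powr_less_mono2_neg[of "1 - \<alpha>" "\<Sum>i\<in>supp_vec p1. p2 $ i" 1] supp_mass assms
  by simp

text \<open>To the right of 1, \<open>renyi_sum\<close> dominates m powr (1 - \<alpha>), m being the
  mass of \<open>p2\<close> on the support of \<open>p1\<close>. Both equal 1 at \<alpha> = 1, so
  the relative entropy is at least - ln m > 0.\<close>

lemma renyi_deriv_pos: "0 < renyi_deriv 1 p1 p2"
proof (rule ccontr)
  define m where "m = (\<Sum>i\<in>supp_vec p1. p2 $ i)"
  have m: "0 < m" "m < 1" using supp_mass by (auto simp: m_def)
  assume "\<not> 0 < renyi_deriv 1 p1 p2"
  moreover have "ln m < 0" using m by simp
  ultimately have "renyi_deriv 1 p1 p2 + ln m < 0" by linarith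
  moreover have "((\<lambda>\<alpha>. renyi_sum \<alpha> p1 p2 - m powr (1 - \<alpha>)) has_real_derivative renyi_deriv 1 p1 p2 + ln m) (at 1)"
    using m by (auto intro!: derivative_eq_intros has_real_derivative_renyi_sum p)
  ultimately obtain d where d: "0 < d" "\<And>h. 0 < h \<Longrightarrow> h < d \<Longrightarrow>
      renyi_sum (1 + h) p1 p2 - m powr (1 - (1 + h)) < renyi_sum 1 p1 p2 - m powr (1 - 1)"
    using DERIV_neg_dec_right by blast
  have h: "0 < d / 2" "d / 2 < d" "1 \<le> 1 + d / 2" using d(1) by auto
  show False
    using d(2)[OF h(1,2)] supp_mass_powr_le_renyi_sum[OF h(3)] renyi_sum_1[OF p] m
    unfolding m_def[symmetric] by simp
qed

text \<open>At orders above 1 mixing contracts the bound on the Renyi sum of q towards 1 by the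
  factor 1 - \<delta>, while that of p lies strictly above 1; below 1 the signs reverse. The same
  affine bound, differentiated at 1, separates the relative entropies because that of p is
  positive.\<close>

lemma eventually_stochastic_map:
  assumes q: "dichotomy q1 q2" and dom: "renyi_dominates p1 p2 q1 q2" and \<epsilon>: "0 < \<epsilon>"
  shows "\<exists>q1'. dichotomy q1' q2 \<and> l1_dist q1 q1' \<le> \<epsilon> \<and>
    (\<forall>\<^sub>F n in sequentially. \<exists>T. stochastic_mat T \<and>
       maps_vec T (kron_pow p1 n) (kron_pow q1' n) \<and> maps_vec T (kron_pow p2 n) (kron_pow q2 n))"
proof -
  \<comment> \<open>The mixture moves by at most 2 * \<delta>; the cap 1/2 keeps the weight 1 -
    \<delta> of \<open>q1\<close> positive.\<close>
  define \<delta> where "\<delta> = min (\<epsilon> / 2) (1 / 2)"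
  have \<delta>: "0 < \<delta>" "\<delta> < 1" "2 * \<delta> \<le> \<epsilon>" using \<epsilon> by (auto simp: \<delta>_def)
  define q where "q = mixture \<delta> q1 q2"
  have dq: "dichotomy q q2" using dichotomy_mixture[OF q] \<delta> by (simp add: q_def)
  have dim_q: "dim_vec q = dim_vec q1" by (simp add: q_def)
  have full: "q $ i \<noteq> 0" if "i < dim_vec q" "q2 $ i \<noteq> 0" for i
  proof -
    have i: "i < dim_vec q1" using that by (simp add: q_def)
    have "0 < \<delta> * q2 $ i" "0 \<le> (1 - \<delta>) * q1 $ i"
      using that(2) dichotomyD(2,3)[OF q i] \<delta> by auto
    then show ?thesis using i by (simp add: q_def)
  qed
  have gt1: "renyi_sum \<alpha> q q2 \<le> (1 - \<delta>) * renyi_sum \<alpha> p1 p2 + (1 - (1 - \<delta>))" if "1 < \<alpha>" for \<alpha>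
  proof -
    have "renyi_sum \<alpha> q q2 \<le> (1 - \<delta>) * renyi_sum \<alpha> q1 q2 + \<delta>"
      unfolding q_def using \<delta> that by (intro renyi_sum_mixture_convex[OF q]) auto
    also have "\<dots> \<le> (1 - \<delta>) * renyi_sum \<alpha> p1 p2 + \<delta>"
      using dom that \<delta> by (intro add_right_mono mult_left_mono) (auto simp: renyi_dominates_def)
    finally show ?thesis by simp
  qed
  have "\<forall>\<^sub>F n in sequentially. \<forall>t\<ge>0.
    excess t (kron_pow q n) (kron_pow q2 n) \<le> excess t (kron_pow p1 n) (kron_pow p2 n)"
  proof (rule eventually_excess_le[OF p dq])
    show "renyi_sum \<alpha> p1 p2 < renyi_sum \<alpha> q q2" if \<alpha>: "0 \<le> \<alpha>" "\<alpha> < 1" for \<alpha>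
    \<comment> \<open>Domination covers only positive orders. At 0 the full support of the mixture
      gives the value 1 directly.\<close>
    proof (cases "\<alpha> = 0")
      case True
      then show ?thesis using renyi_sum_less_1[of 0] renyi_sum_0_full_support[OF dq full] by simp
    next
      case False
      have "renyi_sum \<alpha> p1 p2 < (1 - \<delta>) * renyi_sum \<alpha> p1 p2 + \<delta>"
        using mult_strict_left_mono[OF renyi_sum_less_1[OF \<alpha>] \<delta>(1)] by (simp add: algebra_simps)
      also have "\<dots> \<le> (1 - \<delta>) * renyi_sum \<alpha> q1 q2 + \<delta>"
        using dom \<alpha> False \<delta> by (intro add_right_mono mult_left_mono) (auto simp: renyi_dominates_def)
      also have "\<dots> \<le> renyi_sum \<alpha> q q2"
        unfolding q_def using \<delta> \<alpha> by (intro renyi_sum_mixture_concave[OF q]) auto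
      finally show ?thesis .
    qed
  next
    show "renyi_sum \<alpha> q q2 < renyi_sum \<alpha> p1 p2" if \<alpha>: "1 < \<alpha>" for \<alpha>
      using gt1[OF \<alpha>] mult_strict_left_mono[OF renyi_sum_greater_1[OF \<alpha>] \<delta>(1)] by (simp add: algebra_simps)
  next
    have "renyi_deriv 1 q q2 \<le> (1 - \<delta>) * renyi_deriv 1 p1 p2"
      by (rule renyi_deriv_le[OF p dq gt1])
    then show "renyi_deriv 1 q q2 < renyi_deriv 1 p1 p2"
      using mult_pos_pos[OF \<delta>(1) renyi_deriv_pos] by (simp add: algebra_simps)
  next
    fix i assume i: "i < dim_vec q" "q2 $ i \<noteq> 0"
    define M where "M = q $ i / q2 $ i"
    show "\<exists>j<dim_vec p1. q $ i / q2 $ i * p2 $ j < p1 $ j"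
    proof (rule ccontr)
      assume "\<not> ?thesis"
      then have le: "p1 $ j \<le> M * p2 $ j" if "j < dim_vec p1" for j
        using that by (force simp: M_def)
      \<comment> \<open>Over the support of \<open>p1\<close> this sums to 1 \<le> M * m with mass m
        < 1, so M > 1. Mixing lowers every ratio above 1, hence the original ratio of q at i exceeds
        M, which \<open>tilt M\<close> at a large order rules out.\<close>
      have MP: "1 \<le> M * (\<Sum>j\<in>supp_vec p1. p2 $ j)"
        unfolding sum_fst_supp[symmetric] sum_distrib_left by (intro sum_mono le) (auto simp: supp_vec_def)
      have M: "1 < M"
      proof (rule ccontr)
        assume "\<not> 1 < M"
        then have "M * (\<Sum>j\<in>supp_vec p1. p2 $ j) \<le> 1 * (\<Sum>j\<in>supp_vec p1. p2 $ j)"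
          using supp_mass(1) by (intro mult_right_mono) auto
        then show False using MP supp_mass(2) by linarith
      qed
      have i': "i < dim_vec q1" using i(1) dim_q by simp
      have q2i: "0 < q2 $ i" using i(2) dichotomyD(3)[OF q i'] by simp
      have "M * q2 $ i = (1 - \<delta>) * q1 $ i + \<delta> * q2 $ i"
        using q2i i' by (simp add: M_def q_def)
      moreover have "\<delta> * q2 $ i < \<delta> * (M * q2 $ i)"
        using \<delta>(1) M q2i by simp
      ultimately have "(1 - \<delta>) * (M * q2 $ i) < (1 - \<delta>) * q1 $ i"
        by (simp add: algebra_simps)
      then have "M * q2 $ i < q1 $ i" using \<delta>(2) by simp
      then obtain K where K: "1 < K" "1 < tilt M K q1 q2"
        using tilt_unbounded[OF q _ i', of M] M by auto
      have "tilt M K q1 q2 \<le> tilt M K p1 p2"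
        using dom K(1) by (simp add: renyi_dominates_def tilt_def mult_left_mono)
      also have "\<dots> \<le> 1" using K(1) M le by (intro tilt_le_1[OF p]) auto
      finally show False using K(2) by simp
    qed
  qed (use full in blast)
  then have "\<forall>\<^sub>F n in sequentially. \<exists>T. stochastic_mat T \<and>
       maps_vec T (kron_pow p1 n) (kron_pow q n) \<and> maps_vec T (kron_pow p2 n) (kron_pow q2 n)"
    by eventually_elim (intro blackwell_dichotomy dichotomy_kron_pow p dq, blast)
  then show ?thesis
    using dq l1_dist_mixture[OF q, of \<delta>] \<delta> unfolding q_def[symmetric] by (intro exI[of _ q]) auto
qed

end

text \<open>The new map is not assembled from the given one. A map between powers of exponent n + 1
  orders their \<open>excess\<close>, the telescoping identity transfers this order to the catalytic
  pairs, and Blackwell's criterion returns a map.\<close>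

lemma eventually_catalytic_map:
  assumes p: "dichotomy p1 p2" and q: "dichotomy q1 q2"
    and ev: "\<forall>\<^sub>F n in sequentially. \<exists>T. stochastic_mat T \<and>
       maps_vec T (kron_pow p1 n) (kron_pow q1 n) \<and> maps_vec T (kron_pow p2 n) (kron_pow q2 n)"
  shows "\<forall>\<^sub>F n in sequentially. \<exists>T. stochastic_mat T \<and>
       maps_vec T (catalyst p1 q1 n \<otimes>\<^sub>v p1) (catalyst p1 q1 n \<otimes>\<^sub>v q1) \<and>
       maps_vec T (catalyst p2 q2 n \<otimes>\<^sub>v p2) (catalyst p2 q2 n \<otimes>\<^sub>v q2)"
proof -
  have "\<forall>\<^sub>F n in sequentially. \<exists>T. stochastic_mat T \<and>
       maps_vec T (kron_pow p1 (Suc n)) (kron_pow q1 (Suc n)) \<and> maps_vec T (kron_pow p2 (Suc n)) (kron_pow q2 (Suc n))"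
    using ev by (rule eventually_sequentially_Suc[THEN iffD2])
  then show ?thesis
  proof (rule eventually_mono)
    fix n assume "\<exists>T. stochastic_mat T \<and>
       maps_vec T (kron_pow p1 (Suc n)) (kron_pow q1 (Suc n)) \<and> maps_vec T (kron_pow p2 (Suc n)) (kron_pow q2 (Suc n))"
    then obtain T where T: "stochastic_mat T" "maps_vec T (kron_pow p1 (Suc n)) (kron_pow q1 (Suc n))"
      "maps_vec T (kron_pow p2 (Suc n)) (kron_pow q2 (Suc n))" by blast
    note dr = dichotomy_catalyst[OF p q, of n]
    show "\<exists>T. stochastic_mat T \<and>
       maps_vec T (catalyst p1 q1 n \<otimes>\<^sub>v p1) (catalyst p1 q1 n \<otimes>\<^sub>v q1) \<and>
       maps_vec T (catalyst p2 q2 n \<otimes>\<^sub>v p2) (catalyst p2 q2 n \<otimes>\<^sub>v q2)"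
    proof (intro blackwell_dichotomy dichotomy_kron dr p q)
      fix t
      have "excess t (kron_pow q1 (Suc n)) (kron_pow q2 (Suc n)) \<le> excess t (kron_pow p1 (Suc n)) (kron_pow p2 (Suc n))"
        by (rule excess_data_processing[OF T(1) dichotomy_kron_pow[OF p] T(2,3)])
      then have "0 \<le> excess t (catalyst p1 q1 n \<otimes>\<^sub>v p1) (catalyst p2 q2 n \<otimes>\<^sub>v p2) -
         excess t (catalyst p1 q1 n \<otimes>\<^sub>v q1) (catalyst p2 q2 n \<otimes>\<^sub>v q2)"
        unfolding excess_catalyst[OF p q] by (simp del: kron_pow.simps)
      then show "excess t (catalyst p1 q1 n \<otimes>\<^sub>v q1) (catalyst p2 q2 n \<otimes>\<^sub>v q2) \<le>
         excess t (catalyst p1 q1 n \<otimes>\<^sub>v p1) (catalyst p2 q2 n \<otimes>\<^sub>v p2)" by simp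
    qed
  qed
qed

text \<open>\<open>renyi_sum\<close> is multiplicative and strictly positive, so the factor of the
  catalyst cancels from the data-processing inequality at each order.\<close>

lemma renyi_dominates_of_catalytic_map:
  assumes p: "dichotomy p1 p2" and q: "dichotomy q1 q2" and r: "dichotomy r1 r2" and T: "stochastic_mat T"
    and m: "maps_vec T (r1 \<otimes>\<^sub>v p1) (r1 \<otimes>\<^sub>v q1)" "maps_vec T (r2 \<otimes>\<^sub>v p2) (r2 \<otimes>\<^sub>v q2)"
  shows "renyi_dominates p1 p2 q1 q2"
  unfolding renyi_dominates_def
proof (intro conjI allI impI)
  fix \<alpha> :: real
  note pos = renyi_sum_pos[OF r, of \<alpha>]
  show "renyi_sum \<alpha> p1 p2 \<le> renyi_sum \<alpha> q1 q2" if "0 < \<alpha>" "\<alpha> < 1"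
    using renyi_sum_data_processing_concave[OF T dichotomy_kron[OF r p] m, of \<alpha>] that pos
    by (simp add: renyi_sum_kron[OF r p] renyi_sum_kron[OF r q])
  show "renyi_sum \<alpha> q1 q2 \<le> renyi_sum \<alpha> p1 p2" if "1 < \<alpha>"
    using renyi_sum_data_processing_convex[OF T dichotomy_kron[OF r p] m, of \<alpha>] that pos
    by (simp add: renyi_sum_kron[OF r p] renyi_sum_kron[OF r q])
qed

section \<open>Stability of domination under approximation\<close>

lemma abs_pad_le_l1_dist: "\<bar>pad_vec x i - pad_vec y i\<bar> \<le> l1_dist x y"
proof (cases "i < max (dim_vec x) (dim_vec y)")
  case True
  then show ?thesis unfolding l1_dist_def
    by (intro member_le_sum[of i _ "\<lambda>i. \<bar>pad_vec x i - pad_vec y i\<bar>"]) auto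
next
  case False
  then have "pad_vec x i = 0" "pad_vec y i = 0" by (auto simp: pad_vec_def)
  then show ?thesis by (simp add: l1_dist_def sum_nonneg)
qed

lemma renyi_sum_pad:
  assumes "dichotomy x y" "dim_vec x \<le> D"
  shows "renyi_sum \<alpha> x y = (\<Sum>i<D. pad_vec x i powr \<alpha> * pad_vec y i powr (1 - \<alpha>))"
proof -
  have "renyi_sum \<alpha> x y = (\<Sum>i<dim_vec x. pad_vec x i powr \<alpha> * pad_vec y i powr (1 - \<alpha>))"
    using dichotomyD(1)[OF assms(1)] by (simp add: renyi_sum_def pair_sum_def pad_vec_def)
  also have "\<dots> = (\<Sum>i<D. pad_vec x i powr \<alpha> * pad_vec y i powr (1 - \<alpha>))"
    using assms(2) by (intro sum.mono_neutral_left) (auto simp: pad_vec_def)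
  finally show ?thesis .
qed

lemma pad_vec_nonneg:
  assumes "dichotomy x y"
  shows "0 \<le> pad_vec x i" "0 \<le> pad_vec y i"
  using dichotomyD(1-3)[OF assms] by (auto simp: pad_vec_def)

text \<open>The lengths of approximating vectors are not bounded, so indices outside the support of
  \<open>q1\<close> cannot be treated one by one. Hoelder bounds their joint contribution by the
  first mass there to the power \<alpha>, and this mass is at most \<epsilon>.\<close>

lemma renyi_sum_le_near:
  assumes q: "dichotomy q1 q2" and x: "dichotomy x1 x2" and \<alpha>: "0 < \<alpha>" "\<alpha> < 1" and e: "l1_dist q1 x1 \<le> \<epsilon>"
  shows "renyi_sum \<alpha> x1 x2 \<le> (\<Sum>i\<in>supp_vec q1. pad_vec x1 i powr \<alpha> * pad_vec x2 i powr (1 - \<alpha>)) + \<epsilon> powr \<alpha>"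
proof -
  define D where "D = max (dim_vec q1) (dim_vec x1)"
  let ?B = "{..<D} - supp_vec q1"
  let ?f = "\<lambda>i. pad_vec x1 i powr \<alpha> * pad_vec x2 i powr (1 - \<alpha>)"
  have I: "supp_vec q1 \<subseteq> {..<D}" by (auto simp: supp_vec_def D_def)
  have "renyi_sum \<alpha> x1 x2 = sum ?f {..<D}" by (rule renyi_sum_pad[OF x]) (simp add: D_def)
  also have "\<dots> = sum ?f (supp_vec q1) + sum ?f ?B"
    using sum.subset_diff[OF I, of ?f] by simp
  also have "sum ?f ?B \<le> sum (pad_vec x1) ?B powr \<alpha> * sum (pad_vec x2) ?B powr (1 - \<alpha>)"
    using \<alpha> pad_vec_nonneg[OF x] by (intro holder_concave) auto
  also have "\<dots> \<le> \<epsilon> powr \<alpha> * 1"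
  proof (intro mult_mono powr_mono2)
    have "sum (pad_vec x1) ?B = (\<Sum>i\<in>?B. \<bar>pad_vec q1 i - pad_vec x1 i\<bar>)"
    proof (rule sum.cong [OF refl])
      fix i assume "i \<in> ?B"
      then have "pad_vec q1 i = 0" by (auto simp: pad_vec_def supp_vec_def)
      then show "pad_vec x1 i = \<bar>pad_vec q1 i - pad_vec x1 i\<bar>" using pad_vec_nonneg(1)[OF x] by simp
    qed
    also have "\<dots> \<le> l1_dist q1 x1"
      unfolding l1_dist_def by (intro sum_mono2) (auto simp: D_def)
    finally show "sum (pad_vec x1) ?B \<le> \<epsilon>" using e by simp
    have "sum (pad_vec x2) ?B \<le> sum (pad_vec x2) {..<D}"
      using pad_vec_nonneg[OF x] by (intro sum_mono2) auto
    also have "\<dots> = (\<Sum>i<dim_vec x1. pad_vec x2 i)"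
      using dichotomyD(1)[OF x] by (intro sum.mono_neutral_right) (auto simp: D_def pad_vec_def)
    also have "\<dots> = 1" using dichotomyD(1,6)[OF x] by (simp add: pad_vec_def)
    finally have "sum (pad_vec x2) ?B powr (1 - \<alpha>) \<le> 1 powr (1 - \<alpha>)"
      using \<alpha> pad_vec_nonneg[OF x] by (intro powr_mono2 sum_nonneg) auto
    then show "sum (pad_vec x2) ?B powr (1 - \<alpha>) \<le> 1" by simp
  qed (use \<alpha> pad_vec_nonneg[OF x] in \<open>auto intro: sum_nonneg\<close>)
  finally show ?thesis by simp
qed

text \<open>On the support of \<open>q1\<close> both limit entries are positive and
  \<open>powr\<close> is continuous. The remaining indices contribute a vanishing amount for
  \<alpha> < 1 and are dropped for \<alpha> > 1; each one-sided estimate points the way the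
  inequality needs.\<close>

lemma renyi_dominates_limit:
  assumes q: "dichotomy q1 q2"
    and near: "\<And>\<epsilon>. 0 < \<epsilon> \<Longrightarrow> \<exists>x1 x2. dichotomy x1 x2 \<and> l1_dist q1 x1 \<le> \<epsilon> \<and> l1_dist q2 x2 \<le> \<epsilon> \<and> renyi_dominates p1 p2 x1 x2"
  shows "renyi_dominates p1 p2 q1 q2"
proof -
  have "\<forall>n. \<exists>x1 x2. dichotomy x1 x2 \<and> l1_dist q1 x1 \<le> inverse (real (Suc n)) \<and> l1_dist q2 x2 \<le> inverse (real (Suc n)) \<and> renyi_dominates p1 p2 x1 x2"
    using near by simp
  then obtain x1 x2 where x: "\<And>n. dichotomy (x1 n) (x2 n)"
    and e: "\<And>n. l1_dist q1 (x1 n) \<le> inverse (real (Suc n))" "\<And>n. l1_dist q2 (x2 n) \<le> inverse (real (Suc n))"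
    and dom: "\<And>n. renyi_dominates p1 p2 (x1 n) (x2 n)"
    by metis
  have conv: "(\<lambda>n. pad_vec (z n) i) \<longlonglongrightarrow> pad_vec y i" if "\<And>n. l1_dist y (z n) \<le> inverse (real (Suc n))" for y z i
  proof -
    have "(\<lambda>n. pad_vec (z n) i - pad_vec y i) \<longlonglongrightarrow> 0"
    proof (rule tendsto_0_le[OF LIMSEQ_inverse_real_of_nat])
      have "norm (pad_vec (z n) i - pad_vec y i) \<le> inverse (real (Suc n))" for n
        using abs_pad_le_l1_dist[of y i "z n"] that[of n] by (simp add: abs_minus_commute)
      then show "\<forall>\<^sub>F n in sequentially. norm (pad_vec (z n) i - pad_vec y i) \<le> norm (inverse (real (Suc n))) * 1" by simp
    qed
    then show ?thesis by (rule LIM_zero_cancel)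
  qed
  let ?f = "\<lambda>\<alpha> n i. pad_vec (x1 n) i powr \<alpha> * pad_vec (x2 n) i powr (1 - \<alpha>)"
  have fin: "finite (supp_vec q1)" by (simp add: supp_vec_def)
  have lim: "(\<lambda>n. \<Sum>i\<in>supp_vec q1. ?f \<alpha> n i) \<longlonglongrightarrow> renyi_sum \<alpha> q1 q2" for \<alpha>
  proof -
    have "(\<lambda>n. \<Sum>i\<in>supp_vec q1. ?f \<alpha> n i) \<longlonglongrightarrow> (\<Sum>i\<in>supp_vec q1. pad_vec q1 i powr \<alpha> * pad_vec q2 i powr (1 - \<alpha>))"
    proof (intro tendsto_sum tendsto_mult tendsto_powr conv e tendsto_const)
      fix i assume i: "i \<in> supp_vec q1"
      then show "pad_vec q1 i \<noteq> 0" "pad_vec q2 i \<noteq> 0"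
        using dichotomyD(1)[OF q] dichotomyD(4)[OF q, of i] by (auto simp: pad_vec_def supp_vec_def)
    qed
    also have "(\<Sum>i\<in>supp_vec q1. pad_vec q1 i powr \<alpha> * pad_vec q2 i powr (1 - \<alpha>)) =
        (\<Sum>i\<in>supp_vec q1. (q1 $ i) powr \<alpha> * (q2 $ i) powr (1 - \<alpha>))"
      using dichotomyD(1)[OF q] by (intro sum.cong refl) (auto simp: pad_vec_def supp_vec_def)
    also have "\<dots> = renyi_sum \<alpha> q1 q2"
      unfolding renyi_sum_def by (rule sum_supp_vec) simp
    finally show ?thesis .
  qed
  show ?thesis
    unfolding renyi_dominates_def
  proof (intro conjI allI impI)
    fix \<alpha> :: real assume \<alpha>: "0 < \<alpha>" "\<alpha> < 1"
    have "(\<lambda>n. inverse (real (Suc n)) powr \<alpha>) \<longlonglongrightarrow> 0 powr \<alpha>"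
      using \<alpha> by (intro tendsto_powr2 LIMSEQ_inverse_real_of_nat tendsto_const) auto
    then have "(\<lambda>n. (\<Sum>i\<in>supp_vec q1. ?f \<alpha> n i) + inverse (real (Suc n)) powr \<alpha>) \<longlonglongrightarrow> renyi_sum \<alpha> q1 q2 + 0"
      using \<alpha> by (intro tendsto_add lim) simp
    moreover have "renyi_sum \<alpha> p1 p2 \<le> (\<Sum>i\<in>supp_vec q1. ?f \<alpha> n i) + inverse (real (Suc n)) powr \<alpha>" for n
      using renyi_sum_le_near[OF q x \<alpha> e(1), of n] dom[of n] \<alpha> by (force simp: renyi_dominates_def)
    ultimately show "renyi_sum \<alpha> p1 p2 \<le> renyi_sum \<alpha> q1 q2"
      using LIMSEQ_le_const by fastforce
  next
    fix \<alpha> :: real assume \<alpha>: "1 < \<alpha>"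
    have "(\<Sum>i\<in>supp_vec q1. ?f \<alpha> n i) \<le> renyi_sum \<alpha> p1 p2" for n
    proof -
      have "(\<Sum>i\<in>supp_vec q1. ?f \<alpha> n i) \<le> (\<Sum>i<max (dim_vec q1) (dim_vec (x1 n)). ?f \<alpha> n i)"
        by (intro sum_mono2) (auto simp: supp_vec_def)
      also have "\<dots> = renyi_sum \<alpha> (x1 n) (x2 n)" by (rule renyi_sum_pad[OF x, symmetric]) simp
      also have "\<dots> \<le> renyi_sum \<alpha> p1 p2" using dom \<alpha> by (simp add: renyi_dominates_def)
      finally show ?thesis .
    qed
    then show "renyi_sum \<alpha> q1 q2 \<le> renyi_sum \<alpha> p1 p2"
      using LIMSEQ_le_const2[OF lim] by blast
  qed
qed

lemma l1_dist_self [simp]: "l1_dist x x = 0"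
  by (simp add: l1_dist_def)

text \<open>The first two equivalences carry the weakest forms of (ii) and (iii), with
  \<open>q2'\<close> free and an arbitrary catalyst; the last two carry the strongest, with
  \<open>q2'\<close> fixed and the explicit catalyst for all large n. Together they render the
  additional choices as well as the equivalence.\<close>

theorem theorem27:
  fixes p1 p2 q1 q2 :: "real Matrix.vec"
  assumes "dichotomy p1 p2"
    and "dichotomy q1 q2"
    and "supp_vec p1 \<subset> supp_vec p2"
  shows
    "((\<forall>\<alpha>::ereal. 0 < \<alpha> \<longrightarrow> renyi_div \<alpha> p1 p2 \<ge> renyi_div \<alpha> q1 q2) \<longleftrightarrow>
     (\<forall>\<epsilon>::real. \<epsilon> > 0 \<longrightarrow>
        (\<exists>T q1' q2' r1 r2. stochastic_mat T \<and> dichotomy q1' q2' \<and> dichotomy r1 r2 \<and>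
           l1_dist q1 q1' \<le> \<epsilon> \<and> l1_dist q2 q2' \<le> \<epsilon> \<and>
           maps_vec T (r1 \<otimes>\<^sub>v p1) (r1 \<otimes>\<^sub>v q1') \<and>
           maps_vec T (r2 \<otimes>\<^sub>v p2) (r2 \<otimes>\<^sub>v q2')))) \<and>
    ((\<forall>\<alpha>::ereal. 0 < \<alpha> \<longrightarrow> renyi_div \<alpha> p1 p2 \<ge> renyi_div \<alpha> q1 q2) \<longleftrightarrow>
     (\<forall>\<epsilon>::real. \<epsilon> > 0 \<longrightarrow>
        (\<exists>q1' q2'. dichotomy q1' q2' \<and>
           l1_dist q1 q1' \<le> \<epsilon> \<and> l1_dist q2 q2' \<le> \<epsilon> \<and>
           (\<forall>\<^sub>F n in sequentially. \<exists>T. stochastic_mat T \<and>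
              maps_vec T (kron_pow p1 n) (kron_pow q1' n) \<and>
              maps_vec T (kron_pow p2 n) (kron_pow q2' n))))) \<and>
    ((\<forall>\<alpha>::ereal. 0 < \<alpha> \<longrightarrow> renyi_div \<alpha> p1 p2 \<ge> renyi_div \<alpha> q1 q2) \<longleftrightarrow>
     (\<forall>\<epsilon>::real. \<epsilon> > 0 \<longrightarrow>
        (\<exists>q1' q2'. dichotomy q1' q2' \<and> l1_dist q1 q1' \<le> \<epsilon> \<and> q2' = q2 \<and>
           (\<forall>\<^sub>F n in sequentially. \<exists>T r1 r2. stochastic_mat T \<and> dichotomy r1 r2 \<and>
              r1 = catalyst p1 q1' n \<and> r2 = catalyst p2 q2' n \<and>
              maps_vec T (r1 \<otimes>\<^sub>v p1) (r1 \<otimes>\<^sub>v q1') \<and>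
              maps_vec T (r2 \<otimes>\<^sub>v p2) (r2 \<otimes>\<^sub>v q2'))))) \<and>
    ((\<forall>\<alpha>::ereal. 0 < \<alpha> \<longrightarrow> renyi_div \<alpha> p1 p2 \<ge> renyi_div \<alpha> q1 q2) \<longleftrightarrow>
     (\<forall>\<epsilon>::real. \<epsilon> > 0 \<longrightarrow>
        (\<exists>q1' q2'. dichotomy q1' q2' \<and> l1_dist q1 q1' \<le> \<epsilon> \<and> q2' = q2 \<and>
           (\<forall>\<^sub>F n in sequentially. \<exists>T. stochastic_mat T \<and>
              maps_vec T (kron_pow p1 n) (kron_pow q1' n) \<and>
              maps_vec T (kron_pow p2 n) (kron_pow q2' n)))))"
proof -
  note p = assms(1) and q = assms(2)
  let ?A = "\<forall>\<alpha>::ereal. 0 < \<alpha> \<longrightarrow> renyi_div \<alpha> p1 p2 \<ge> renyi_div \<alpha> q1 q2"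
  let ?pow = "\<lambda>q1' q2'. \<forall>\<^sub>F n in sequentially. \<exists>T. stochastic_mat T \<and>
              maps_vec T (kron_pow p1 n) (kron_pow q1' n) \<and> maps_vec T (kron_pow p2 n) (kron_pow q2' n)"
  let ?cat = "\<lambda>q1' q2'. \<exists>T r1 r2. stochastic_mat T \<and> dichotomy r1 r2 \<and>
              maps_vec T (r1 \<otimes>\<^sub>v p1) (r1 \<otimes>\<^sub>v q1') \<and> maps_vec T (r2 \<otimes>\<^sub>v p2) (r2 \<otimes>\<^sub>v q2')"
  let ?C = "\<lambda>q1' q2'. \<forall>\<^sub>F n in sequentially. \<exists>T r1 r2. stochastic_mat T \<and> dichotomy r1 r2 \<and>
              r1 = catalyst p1 q1' n \<and> r2 = catalyst p2 q2' n \<and>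
              maps_vec T (r1 \<otimes>\<^sub>v p1) (r1 \<otimes>\<^sub>v q1') \<and> maps_vec T (r2 \<otimes>\<^sub>v p2) (r2 \<otimes>\<^sub>v q2')"
  have pow_cat: "?C q1' q2'" if d: "dichotomy q1' q2'" and ev: "?pow q1' q2'" for q1' q2'
    using eventually_catalytic_map[OF p d ev] by eventually_elim (use dichotomy_catalyst[OF p d] in blast)
  have cat: "?cat q1' q2'" if "?C q1' q2'" for q1' q2'
    using eventually_happens[OF that] by auto
  have near: "\<exists>q1'. dichotomy q1' q2 \<and> l1_dist q1 q1' \<le> \<epsilon> \<and> ?pow q1' q2" if "?A" "0 < \<epsilon>" for \<epsilon>
    using eventually_stochastic_map[OF p assms(3) q] that renyi_div_le_iff[OF p q] by blast
  \<comment> \<open>All four conditions imply this weakest catalytic form, those on powers through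
    \<open>pow_cat\<close>, so necessity has to be proved only once.\<close>
  have converse: "?A"
    if "\<And>\<epsilon>. 0 < \<epsilon> \<Longrightarrow> \<exists>q1' q2'. dichotomy q1' q2' \<and> l1_dist q1 q1' \<le> \<epsilon> \<and> l1_dist q2 q2' \<le> \<epsilon> \<and> ?cat q1' q2'"
    unfolding renyi_div_le_iff[OF p q]
  proof (rule renyi_dominates_limit[OF q])
    fix \<epsilon> :: real assume "0 < \<epsilon>"
    then show "\<exists>x1 x2. dichotomy x1 x2 \<and> l1_dist q1 x1 \<le> \<epsilon> \<and> l1_dist q2 x2 \<le> \<epsilon> \<and> renyi_dominates p1 p2 x1 x2"
      using that[of \<epsilon>] renyi_dominates_of_catalytic_map[OF p] by blast
  qed
  have self: "l1_dist q2 q2 \<le> \<epsilon>" if "0 < \<epsilon>" for \<epsilon>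
    using that by simp
  show ?thesis
  proof (intro conjI iffI)
    assume A: "?A"
    show "\<forall>\<epsilon>::real. \<epsilon> > 0 \<longrightarrow>
        (\<exists>T q1' q2' r1 r2. stochastic_mat T \<and> dichotomy q1' q2' \<and> dichotomy r1 r2 \<and>
           l1_dist q1 q1' \<le> \<epsilon> \<and> l1_dist q2 q2' \<le> \<epsilon> \<and>
           maps_vec T (r1 \<otimes>\<^sub>v p1) (r1 \<otimes>\<^sub>v q1') \<and> maps_vec T (r2 \<otimes>\<^sub>v p2) (r2 \<otimes>\<^sub>v q2'))"
    proof (intro allI impI)
      fix \<epsilon> :: real assume \<epsilon>: "0 < \<epsilon>"
      obtain q1' where q1': "dichotomy q1' q2" "l1_dist q1 q1' \<le> \<epsilon>" "?pow q1' q2" using near[OF A \<epsilon>] by blast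
      then show "\<exists>T q1' q2' r1 r2. stochastic_mat T \<and> dichotomy q1' q2' \<and> dichotomy r1 r2 \<and>
           l1_dist q1 q1' \<le> \<epsilon> \<and> l1_dist q2 q2' \<le> \<epsilon> \<and>
           maps_vec T (r1 \<otimes>\<^sub>v p1) (r1 \<otimes>\<^sub>v q1') \<and> maps_vec T (r2 \<otimes>\<^sub>v p2) (r2 \<otimes>\<^sub>v q2')"
        using cat[OF pow_cat[OF q1'(1,3)]] self[OF \<epsilon>] by blast
    qed
  next
    assume "?A"
    then show "\<forall>\<epsilon>::real. \<epsilon> > 0 \<longrightarrow>
        (\<exists>q1' q2'. dichotomy q1' q2' \<and> l1_dist q1 q1' \<le> \<epsilon> \<and> l1_dist q2 q2' \<le> \<epsilon> \<and> ?pow q1' q2')"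
      using near self by blast
  next
    assume "?A"
    then show "\<forall>\<epsilon>::real. \<epsilon> > 0 \<longrightarrow>
        (\<exists>q1' q2'. dichotomy q1' q2' \<and> l1_dist q1 q1' \<le> \<epsilon> \<and> q2' = q2 \<and> ?C q1' q2')"
      using near pow_cat by blast
  next
    assume "?A"
    then show "\<forall>\<epsilon>::real. \<epsilon> > 0 \<longrightarrow>
        (\<exists>q1' q2'. dichotomy q1' q2' \<and> l1_dist q1 q1' \<le> \<epsilon> \<and> q2' = q2 \<and> ?pow q1' q2')"
      using near by blast
  next
    assume h: "\<forall>\<epsilon>::real. \<epsilon> > 0 \<longrightarrow>
        (\<exists>T q1' q2' r1 r2. stochastic_mat T \<and> dichotomy q1' q2' \<and> dichotomy r1 r2 \<and>
           l1_dist q1 q1' \<le> \<epsilon> \<and> l1_dist q2 q2' \<le> \<epsilon> \<and>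
           maps_vec T (r1 \<otimes>\<^sub>v p1) (r1 \<otimes>\<^sub>v q1') \<and> maps_vec T (r2 \<otimes>\<^sub>v p2) (r2 \<otimes>\<^sub>v q2'))"
    show "?A" by (rule converse) (use h in blast)
  next
    assume h: "\<forall>\<epsilon>::real. \<epsilon> > 0 \<longrightarrow>
        (\<exists>q1' q2'. dichotomy q1' q2' \<and> l1_dist q1 q1' \<le> \<epsilon> \<and> l1_dist q2 q2' \<le> \<epsilon> \<and> ?pow q1' q2')"
    show "?A" by (rule converse) (use h cat pow_cat in blast)
  next
    assume h: "\<forall>\<epsilon>::real. \<epsilon> > 0 \<longrightarrow>
        (\<exists>q1' q2'. dichotomy q1' q2' \<and> l1_dist q1 q1' \<le> \<epsilon> \<and> q2' = q2 \<and> ?C q1' q2')"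
    show "?A" by (rule converse) (use h cat self in blast)
  next
    assume h: "\<forall>\<epsilon>::real. \<epsilon> > 0 \<longrightarrow>
        (\<exists>q1' q2'. dichotomy q1' q2' \<and> l1_dist q1 q1' \<le> \<epsilon> \<and> q2' = q2 \<and> ?pow q1' q2')"
    show "?A" by (rule converse) (use h cat pow_cat self in blast)
  qed
qed

end
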